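(* For every $\epsilon>0$ and $M>0$ there exists an explicit dimensionless constant $\bar C=\bar C(\epsilon,M)>0$ (depending only on $\epsilon$ and $M$, not on the dimension $n$) so that for all $f\in\mathcal{F}(\epsilon,M)$, $$Ent(f)\le\bar C\,\delta(f)+\tfrac12|\mu(f)|^2,$$ where $\mu(f)=\int_{\mathbb{R}^n}x f(x)\,d\gamma(x)$ is the barycenter of $f$ with respect to $d\gamma$.
   Context: $d\gamma:=(2\pi)^{-n/2}e^{-|x|^2/2}dx$ is the standard Gaussian measure on $\mathbb{R}^n$. For $\epsilon>0$ and $M>0$, $$\mathcal{F}(\epsilon,M):=\{e^{-h}:\ (-1+\epsilon)\le D^2h\le M\},$$ where $h:\mathbb{R}^n\to\mathbb{R}$ is a $C^{1,1}$ function and the inequalities mean $(-1+\epsilon)\mathrm{Id}\le D^2h\le M\,\mathrm{Id}$ as symmetric matrices. For a positive function $f$ the Fisher information, entropy and log-Sobolev deficit are $$I(f)=\int_{\mathbb{R}^n}\frac{|\nabla f|^2}{f}\,d\gamma,\qquad Ent(f)=\int_{\mathbb{R}^n}f\log f\,d\gamma-\|f\|_{L^1(d\gamma)}\log\big(\|f\|_{L^1(d\gamma)}\big),\qquad \delta(f)=\tfrac12 I(f)-Ent(f).$$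
   Formalization: The function f is also assumed to have total mass 1 with respect to dγ; without this the claim fails, e.g. for f = λ exp(a·x − |a|²/2) with 0 < λ < 1 and a ≠ 0. Mass above 1 follows by scaling. The explicit constant is asserted to exist, without a formula. *)

theory Defs
  imports "HOL-Analysis.Analysis"
begin

text \<open>
  The constant of the theorem must not depend on the dimension, so \<open>n\<close> has to be quantified
  inside the formula. Points of \<open>n\<close>-space are therefore functions on the index set \<open>{..<n}\<close>
  (\<open>undefined\<close> elsewhere), which is the underlying space of the library's finite product measures.
  The update \<open>x(i := t)\<close> with \<open>i < n\<close> stays in this space.
\<close>

definition Rn :: "nat \<Rightarrow> (nat \<Rightarrow> real) set" where
  "Rn n = {..<n} \<rightarrow>\<^sub>E UNIV"

definition lebesgue_n :: "nat \<Rightarrow> (nat \<Rightarrow> real) measure" where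
  "lebesgue_n n = Pi\<^sub>M {..<n} (\<lambda>_. lborel)"

definition norm_n :: "nat \<Rightarrow> (nat \<Rightarrow> real) \<Rightarrow> real" where
  "norm_n n x = L2_set x {..<n}"

definition gauss :: "nat \<Rightarrow> (nat \<Rightarrow> real) measure" where
  "gauss n = density (lebesgue_n n)
     (\<lambda>x. ennreal ((2 * pi) powr (- real n / 2) * exp (- (norm_n n x)\<^sup>2 / 2)))"

definition partial :: "nat \<Rightarrow> ((nat \<Rightarrow> real) \<Rightarrow> real) \<Rightarrow> (nat \<Rightarrow> real) \<Rightarrow> real" where
  "partial i h x = deriv (\<lambda>t. h (x(i := t))) (x i)"

definition has_partial :: "nat \<Rightarrow> ((nat \<Rightarrow> real) \<Rightarrow> real) \<Rightarrow> (nat \<Rightarrow> real) \<Rightarrow> bool" where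
  "has_partial i h x \<longleftrightarrow> (\<lambda>t. h (x(i := t))) field_differentiable at (x i)"

definition grad :: "((nat \<Rightarrow> real) \<Rightarrow> real) \<Rightarrow> (nat \<Rightarrow> real) \<Rightarrow> nat \<Rightarrow> real" where
  "grad h x = (\<lambda>i. partial i h x)"

text \<open>
  Partial derivatives exist everywhere and form a Lipschitz, hence continuous, gradient; in
  particular \<open>h\<close> is continuously differentiable. Asking for a global or for a local Lipschitz
  constant makes no difference once the Hessian is bounded as in \<open>hessian_between\<close>.
\<close>

definition C11 :: "nat \<Rightarrow> ((nat \<Rightarrow> real) \<Rightarrow> real) \<Rightarrow> bool" where
  "C11 n h \<longleftrightarrow>
     (\<forall>x\<in>Rn n. \<forall>i<n. has_partial i h x) \<and>
     (\<exists>L. \<forall>x\<in>Rn n. \<forall>y\<in>Rn n.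
        norm_n n (\<lambda>i. grad h x i - grad h y i) \<le> L * norm_n n (\<lambda>i. x i - y i))"

definition hess :: "((nat \<Rightarrow> real) \<Rightarrow> real) \<Rightarrow> (nat \<Rightarrow> real) \<Rightarrow> nat \<Rightarrow> nat \<Rightarrow> real" where
  "hess h x i j = partial j (partial i h) x"

text \<open>
  \<open>a Id \<le> D\<^sup>2h \<le> b Id\<close> as an inequality of quadratic forms. The Hessian of a \<open>C\<^sup>1\<^sup>,\<^sup>1\<close> function
  exists, and is symmetric, only almost everywhere, so the bounds are imposed at almost every point.
  The existence clause is automatic for such functions; it keeps \<open>deriv\<close> from being applied where
  there is no derivative.
\<close>

definition hessian_between :: "nat \<Rightarrow> real \<Rightarrow> real \<Rightarrow> ((nat \<Rightarrow> real) \<Rightarrow> real) \<Rightarrow> bool" where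
  "hessian_between n a b h \<longleftrightarrow>
     (AE x in lebesgue_n n.
        (\<forall>i<n. \<forall>j<n. has_partial j (partial i h) x) \<and>
        (\<forall>v. a * (norm_n n v)\<^sup>2 \<le> (\<Sum>i<n. \<Sum>j<n. v i * hess h x i j * v j) \<and>
             (\<Sum>i<n. \<Sum>j<n. v i * hess h x i j * v j) \<le> b * (norm_n n v)\<^sup>2))"

definition family_F :: "nat \<Rightarrow> real \<Rightarrow> real \<Rightarrow> ((nat \<Rightarrow> real) \<Rightarrow> real) set" where
  "family_F n \<epsilon> M = {(\<lambda>x. exp (- h x)) | h. C11 n h \<and> hessian_between n (- 1 + \<epsilon>) M h}"

text \<open>
  For members of \<open>family_F n \<epsilon> M\<close> with \<open>\<epsilon> > 0\<close> all integrands below are integrable: \<open>h\<close> grows at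
  most quadratically, its gradient at most linearly, and \<open>exp (- h)\<close> times the Gaussian density is
  bounded by a Gaussian. So the Bochner integral never takes its default value \<open>0\<close>.
\<close>

definition L1_norm :: "nat \<Rightarrow> ((nat \<Rightarrow> real) \<Rightarrow> real) \<Rightarrow> real" where
  "L1_norm n f = (LINT x|gauss n. \<bar>f x\<bar>)"

definition Fisher :: "nat \<Rightarrow> ((nat \<Rightarrow> real) \<Rightarrow> real) \<Rightarrow> real" where
  "Fisher n f = (LINT x|gauss n. (norm_n n (grad f x))\<^sup>2 / f x)"

definition Ent :: "nat \<Rightarrow> ((nat \<Rightarrow> real) \<Rightarrow> real) \<Rightarrow> real" where
  "Ent n f = (LINT x|gauss n. f x * ln (f x)) - L1_norm n f * ln (L1_norm n f)"

definition deficit :: "nat \<Rightarrow> ((nat \<Rightarrow> real) \<Rightarrow> real) \<Rightarrow> real" where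
  "deficit n f = 1 / 2 * Fisher n f - Ent n f"

definition barycenter :: "nat \<Rightarrow> ((nat \<Rightarrow> real) \<Rightarrow> real) \<Rightarrow> nat \<Rightarrow> real" where
  "barycenter n f = (\<lambda>i. LINT x|gauss n. x i * f x)"

end

theory Submission
  imports Defs "HOL-Probability.Probability"
begin

text \<open>
  Write \<open>f d\<gamma> = exp (- V) dx\<close>, so that \<open>\<epsilon> \<le> D\<^sup>2V \<le> 1 + M\<close>, and let \<open>\<mu>\<close> be the barycenter. The claim follows
  from \<open>Ent \<le> (1 - c) / 2 * I + c / 2 * |\<mu>|\<^sup>2\<close> with \<open>c = c(\<epsilon>, M)\<close>, which tensorizes.

  On the line, let \<open>T\<close> be the monotone map from \<open>exp (- V) dx\<close> to the Gaussian and \<open>\<theta> = T - id\<close>. The deficit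
  is \<open>1 / 2 * E (\<theta> + (log f)')\<^sup>2 + E (T' - 1 - log T')\<close>. A maximum principle gives \<open>T' \<le> \<surd>(1 + M)\<close>, hence
  the second term controls \<open>E (\<theta>')\<^sup>2\<close>, and by the Poincare inequality the deficit controls the variance
  of \<open>(log f)'\<close>, which is \<open>I - \<mu>\<^sup>2\<close>.

  In dimension \<open>n + 1\<close> condition on the last coordinate. By Prekopa--Leindler and Jensen its marginal again
  has a potential with second derivative between \<open>\<epsilon>\<close> and \<open>1 + M\<close>. The conditional barycenters \<open>m\<close>
  need not be constant, but \<open>m' = - Cov (y, \<partial>V)\<close>, so by the Poincare inequality and the variance bound for
  linear functions their fluctuation is at most \<open>8 / \<epsilon>\<^sup>2 * E Var (\<partial>V | x)\<close>, which is paid for by the part of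
  \<open>I\<close> that the marginal does not see.
\<close>

section \<open>Monotone rearrangement and the Prekopa--Leindler inequality on the line\<close>

lemma cdf_exists:
  fixes f :: "real \<Rightarrow> real"
  assumes cont: "continuous_on UNIV f" and pos: "\<And>x. f x > 0" and int: "integrable lborel f"
  obtains F where "\<And>x. (F has_real_derivative f x) (at x)"
    "\<And>x. 0 < F x" "\<And>x. F x < (LINT x|lborel. f x)"
    "(F \<longlongrightarrow> 0) at_bot" "(F \<longlongrightarrow> (LINT x|lborel. f x)) at_top"
proof -
  define I where "I = (LINT x|lborel. f x)"
  define F where "F y = (LINT x|lborel. indicator {..y} x *\<^sub>R f x)" for y
  have [measurable]: "f \<in> borel_measurable borel" using int by auto
  have iF: "integrable lborel (\<lambda>x. indicator A x *\<^sub>R f x)" if "A \<in> sets borel" for A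
    using integrable_mult_indicator[of A lborel f] that int by simp
  have diff: "F b - F a = integral {a..b} f" if "a \<le> b" for a b
  proof -
    have "F b - F a = (LINT x|lborel. indicator {..b} x *\<^sub>R f x - indicator {..a} x *\<^sub>R f x)"
      unfolding F_def by (subst Bochner_Integration.integral_diff) (intro iF refl; simp)+
    also have "\<dots> = (LINT x|lborel. indicator {a..b} x *\<^sub>R f x)"
      by (rule integral_cong_AE)
         (use AE_lborel_singleton[of a] that in \<open>auto simp: indicator_def\<close>)
    also have "\<dots> = integral {a..b} f"
      using set_borel_integral_eq_integral(2)[of "{a..b}" f] iF[of "{a..b}"]
      by (simp add: set_lebesgue_integral_def set_integrable_def)
    finally show ?thesis .
  qed
  have der: "(F has_real_derivative f x) (at x)" for x
  proof -
    have "((\<lambda>y. integral {x - 1..y} f) has_real_derivative f x) (at x within {x-1..x+1})"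
      by (rule integral_has_real_derivative) (auto intro: continuous_on_subset[OF cont])
    hence "((\<lambda>y. F (x-1) + integral {x - 1..y} f) has_real_derivative f x) (at x within {x-1..x+1})"
      by (auto intro!: derivative_eq_intros)
    hence "(F has_real_derivative f x) (at x within {x-1..x+1})"
    proof (rule has_field_derivative_transform_within[of _ _ _ _ 1])
      show "F (x - 1) + integral {x - 1..y} f = F y" if "y \<in> {x - 1..x + 1}" for y
        using diff[of "x - 1" y] that by simp
    qed auto
    thus ?thesis
      by (simp add: at_within_Icc_at)
  qed
  have strict: "F a < F b" if "a < b" for a b
    using DERIV_pos_imp_increasing[OF that, of F] der pos by blast
  have top: "(F \<longlongrightarrow> I) at_top"
    unfolding F_def I_def using int by (intro tendsto_integral_at_top) auto
  have bot: "(F \<longlongrightarrow> 0) at_bot"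
  proof -
    have int': "integrable lborel (\<lambda>x. f (-x))"
      using lborel_integrable_real_affine[OF int, of "-1" 0] by simp
    have "((\<lambda>y. LINT x|lborel. indicator {..y} x *\<^sub>R f (- x)) \<longlongrightarrow> (LINT x|lborel. f (-x))) at_top"
      using int' by (intro tendsto_integral_at_top) auto
    also have "(LINT x|lborel. f (-x)) = I"
      using lborel_integral_real_affine[of "-1" f 0] by (simp add: I_def)
    also have "(\<lambda>y. LINT x|lborel. indicator {..y} x *\<^sub>R f (- x)) = (\<lambda>y. I - F (-y))"
    proof
      fix y
      have "(LINT x|lborel. indicator {..y} x *\<^sub>R f (- x)) = (LINT x|lborel. indicator {..y} (-x) *\<^sub>R f x)"
        using lborel_integral_real_affine[of "-1" "\<lambda>x. indicator {..y} (-x) *\<^sub>R f x" 0] by simp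
      also have "\<dots> = (LINT x|lborel. f x - indicator {..-y} x *\<^sub>R f x)"
        by (rule integral_cong_AE)
         (use AE_lborel_singleton[of "-y"] in \<open>auto simp: indicator_def\<close>)
      also have "\<dots> = I - F (-y)"
        unfolding F_def I_def using int iF[of "{..-y}"] by (subst Bochner_Integration.integral_diff) auto
      finally show "(LINT x|lborel. indicator {..y} x *\<^sub>R f (- x)) = I - F (-y)" .
    qed
    finally have "((\<lambda>y. I - (I - F (-y))) \<longlongrightarrow> I - I) at_top"
      by (intro tendsto_intros)
    thus ?thesis by (simp add: filterlim_at_bot_mirror)
  qed
  have nonneg: "0 \<le> F x" for x
    unfolding F_def using pos by (intro integral_nonneg_AE) (auto simp: less_imp_le)
  have le: "F x \<le> I" for x
    unfolding F_def I_def using pos int by (intro integral_mono iF) (auto simp: indicator_def less_imp_le)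
  have p: "0 < F x" for x using nonneg[of "x-1"] strict[of "x-1" x] by simp
  have l: "F x < I" for x using le[of "x+1"] strict[of x "x+1"] by simp
  show thesis using that[of F] der p l bot top unfolding I_def by blast
qed

lemma lborel_mass_pos:
  fixes f :: "real \<Rightarrow> real"
  assumes "continuous_on UNIV f" "\<And>x. f x > 0" "integrable lborel f"
  shows "0 < (LINT x|lborel. f x)"
  using cdf_exists[OF assms] by (metis less_trans)

lemma monotone_rearrangement:
  fixes f g :: "real \<Rightarrow> real"
  assumes f: "continuous_on UNIV f" "\<And>x. f x > 0" "integrable lborel f"
    and g: "continuous_on UNIV g" "\<And>x. g x > 0" "integrable lborel g"
    and mass: "(LINT x|lborel. f x) = 1" "(LINT x|lborel. g x) = 1"
  obtains T where "\<And>x. (T has_real_derivative f x / g (T x)) (at x)"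
    "filterlim T at_bot at_bot" "filterlim T at_top at_top"
proof -
  obtain F where F: "\<And>x. (F has_real_derivative f x) (at x)" "\<And>x. 0 < F x" "\<And>x. F x < 1"
    "(F \<longlongrightarrow> 0) at_bot" "(F \<longlongrightarrow> 1) at_top"
    using cdf_exists[OF f] mass by metis
  obtain G where G: "\<And>x. (G has_real_derivative g x) (at x)" "\<And>x. 0 < G x" "\<And>x. G x < 1"
    "(G \<longlongrightarrow> 0) at_bot" "(G \<longlongrightarrow> 1) at_top"
    using cdf_exists[OF g] mass by metis
  have strict: "G a < G b" if "a < b" for a b
    using DERIV_pos_imp_increasing[OF that, of G] G g by blast
  hence inj: "G a = G b \<Longrightarrow> a = b" for a b by (metis less_irrefl linorder_neqE_linordered_idom)
  have contG: "isCont G x" for x using G(1) DERIV_isCont by blast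
  define Q where "Q u = (THE t. G t = u)" for u
  have QG: "Q (G t) = t" for t unfolding Q_def using inj by blast
  have GQ: "G (Q u) = u" if u: "0 < u" "u < 1" for u
  proof -
    obtain a where a: "G a < u"
      using order_tendstoD(2)[OF G(4) u(1)] by (auto simp: eventually_at_bot_linorder)
    obtain b where b: "G b > u"
      using order_tendstoD(1)[OF G(5) u(2)] by (auto simp: eventually_at_top_linorder)
    have "a \<le> b" using a b strict by (metis less_trans less_le_not_le linorder_le_less_linear)
    then obtain t where "G t = u"
      using IVT'[of G a u b] a b contG by (auto simp: continuous_at_imp_continuous_on)
    thus ?thesis using QG by metis
  qed
  define T where "T x = Q (F x)" for x
  have GT: "G (T x) = F x" for x using GQ F by (simp add: T_def)
  have dT: "(T has_real_derivative f x / g (T x)) (at x)" for x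
  proof -
    have cQ: "isCont Q (F x)"
      using isCont_inverse_function[of 1 "T x" Q G] QG contG by (simp add: GT)
    have "DERIV Q (F x) :> inverse (g (T x))"
    proof (rule DERIV_inverse_function[of G])
      show "DERIV G (Q (F x)) :> g (T x)" using G(1) by (simp add: T_def)
      show "g (T x) \<noteq> 0" using g(2)[of "T x"] by simp
      show "0 < F x" "F x < 1" using F by auto
      show "\<And>y. 0 < y \<Longrightarrow> y < 1 \<Longrightarrow> G (Q y) = y" by (rule GQ)
      show "isCont Q (F x)" by fact
    qed
    from DERIV_chain2[OF this F(1)] show ?thesis
      by (simp add: T_def[abs_def] field_simps)
  qed
  have top: "filterlim T at_top at_top"
    unfolding filterlim_at_top
  proof
    fix N
    have "eventually (\<lambda>x. G N < F x) at_top" using order_tendstoD(1)[OF F(5)] G by blast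
    thus "eventually (\<lambda>x. N \<le> T x) at_top"
      by eventually_elim (metis GT strict linorder_not_less less_imp_le less_asym)
  qed
  have bot: "filterlim T at_bot at_bot"
    unfolding filterlim_at_bot
  proof
    fix N
    have "eventually (\<lambda>x. F x < G N) at_bot" using order_tendstoD(2)[OF F(4)] G by blast
    thus "eventually (\<lambda>x. T x \<le> N) at_bot"
      by eventually_elim (metis GT strict linorder_not_less less_imp_le less_asym)
  qed
  show thesis using that dT top bot by blast
qed

text \<open>
  The substitution \<open>w x = (1 - s) x + s T x\<close>, with \<open>T\<close> transporting the first density to the second,
  turns the hypothesis into \<open>(K \<circ> w)' \<ge> F'\<close> for the distribution functions.
\<close>

lemma prekopa_leindler_normalized:
  fixes a b c :: "real \<Rightarrow> real"
  assumes cont: "continuous_on UNIV a" "continuous_on UNIV b" "continuous_on UNIV c"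
    and int: "integrable lborel (\<lambda>x. exp (- a x))" "integrable lborel (\<lambda>x. exp (- b x))"
      "integrable lborel (\<lambda>x. exp (- c x))"
    and mass: "(LINT x|lborel. exp (- a x)) = 1" "(LINT x|lborel. exp (- b x)) = 1"
    and s: "0 \<le> s" "s \<le> 1"
    and le: "\<And>x y. c ((1 - s) * x + s * y) \<le> (1 - s) * a x + s * b y"
  shows "1 \<le> (LINT x|lborel. exp (- c x))"
proof -
  note ce = continuous_on_exp[OF continuous_on_minus]
  obtain T where T: "\<And>x. (T has_real_derivative exp (- a x) / exp (- b (T x))) (at x)"
    using monotone_rearrangement[OF ce[OF cont(1)] _ int(1) ce[OF cont(2)] _ int(2) mass]
    by (metis exp_gt_zero)
  obtain F where F: "\<And>x. (F has_real_derivative exp (- a x)) (at x)"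
      "(F \<longlongrightarrow> 0) at_bot" "(F \<longlongrightarrow> 1) at_top"
    using cdf_exists[OF ce[OF cont(1)] _ int(1)] mass by (metis exp_gt_zero)
  obtain K where K: "\<And>x. (K has_real_derivative exp (- c x)) (at x)"
      "\<And>x. 0 < K x" "\<And>x. K x < (LINT x|lborel. exp (- c x))"
    using cdf_exists[OF ce[OF cont(3)] _ int(3)] by (metis exp_gt_zero)
  define w where "w x = (1 - s) * x + s * T x" for x
  define H where "H x = K (w x) - F x" for x
  have dH: "(H has_real_derivative exp (- c (w x)) * ((1 - s) + s * (exp (- a x) / exp (- b (T x)))) - exp (- a x)) (at x)" for x
    unfolding H_def w_def
    by (auto intro!: derivative_eq_intros DERIV_chain2[OF K(1)] T F)
  have nn: "exp (- c (w x)) * ((1 - s) + s * (exp (- a x) / exp (- b (T x)))) - exp (- a x) \<ge> 0" for x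
  proof -
    define r where "r = b (T x) - a x"
    have cv: "exp (s * r) \<le> (1 - s) + s * exp r"
      using convex_onD[OF exp_convex, of s 0 r] s by simp
    have "exp (- a x) = exp (- ((1 - s) * a x + s * b (T x))) * exp (s * r)"
      by (simp add: exp_add[symmetric] r_def algebra_simps)
    also have "\<dots> \<le> exp (- c (w x)) * ((1 - s) + s * exp r)"
      using le[of x "T x"] cv by (intro mult_mono) (auto simp: w_def)
    also have "exp r = exp (- a x) / exp (- b (T x))"
      by (simp add: r_def exp_diff[symmetric] del: exp_diff)
    finally show ?thesis by simp
  qed
  have mono: "H x \<le> H y" if "x \<le> y" for x y
    using DERIV_nonneg_imp_nondecreasing[OF that, of H] dH nn by blast
  have "F y - F x \<le> (LINT x|lborel. exp (- c x))" if "x \<le> y" for x y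
    using mono[OF that] K(2)[of "w x"] K(3)[of "w y"] by (simp add: H_def)
  hence 1: "eventually (\<lambda>x. F y - F x \<le> (LINT x|lborel. exp (- c x))) at_bot" for y
    by (auto simp: eventually_at_bot_linorder)
  have "F y - 0 \<le> (LINT x|lborel. exp (- c x))" for y
    using tendsto_upperbound[OF tendsto_diff[OF tendsto_const F(2)] 1, of y] by simp
  hence "F y \<le> (LINT x|lborel. exp (- c x))" for y by simp
  thus ?thesis by (intro tendsto_upperbound[OF F(3)]) auto
qed

lemma prekopa_leindler_real:
  fixes a b c :: "real \<Rightarrow> real"
  assumes cont: "continuous_on UNIV a" "continuous_on UNIV b" "continuous_on UNIV c"
    and int: "integrable lborel (\<lambda>x. exp (- a x))" "integrable lborel (\<lambda>x. exp (- b x))"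
      "integrable lborel (\<lambda>x. exp (- c x))"
    and s: "0 \<le> s" "s \<le> 1"
    and le: "\<And>x y. c ((1 - s) * x + s * y) \<le> (1 - s) * a x + s * b y"
  shows "(1 - s) * ln (LINT x|lborel. exp (- a x)) + s * ln (LINT x|lborel. exp (- b x))
    \<le> ln (LINT x|lborel. exp (- c x))"
proof -
  note ce = continuous_on_exp[OF continuous_on_minus]
  define A B C where "A = ln (LINT x|lborel. exp (- a x))" and "B = ln (LINT x|lborel. exp (- b x))"
    and "C = ln (LINT x|lborel. exp (- c x))"
  define d where "d = (1 - s) * A + s * B"
  have pos: "0 < (LINT x|lborel. exp (- a x))" "0 < (LINT x|lborel. exp (- b x))" "0 < (LINT x|lborel. exp (- c x))"
    using cont int by (auto intro!: lborel_mass_pos ce)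
  have split: "exp (- (u + k)) = exp (- k) * exp (- u)" for u k :: real
    by (simp add: exp_add[symmetric])
  have ee: "exp (- A) * (LINT x|lborel. exp (- a x)) = 1" "exp (- B) * (LINT x|lborel. exp (- b x)) = 1"
    using pos by (simp_all add: A_def B_def exp_minus)
  have "1 \<le> (LINT x|lborel. exp (- (c x + d)))"
    apply (rule prekopa_leindler_normalized[of "\<lambda>x. a x + A" "\<lambda>x. b x + B" "\<lambda>x. c x + d" s])
    using cont int s le ee by (auto intro!: continuous_intros simp: split simp del: minus_add_distrib)
       (smt (verit, best) d_def distrib_left le)
  also have "\<dots> = exp (- d) * exp C" using pos by (simp add: split C_def del: minus_add_distrib)
  finally have "0 \<le> C - d" by (simp add: exp_add[symmetric])
  thus ?thesis by (simp add: A_def B_def C_def d_def)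
qed

lemma integral_derivative_vanishing_at_infinity:
  fixes F f :: "real \<Rightarrow> real"
  assumes d: "\<And>x. (F has_real_derivative f x) (at x)" and c: "continuous_on UNIV f"
    and i: "integrable lborel f" and lim: "(F \<longlongrightarrow> 0) at_bot" "(F \<longlongrightarrow> 0) at_top"
  shows "(LINT x|lborel. f x) = 0"
proof -
  have "(LBINT x=-\<infinity>..\<infinity>. f x) = 0 - 0"
  proof (rule interval_integral_FTC_integrable[of _ _ F])
    show "((F \<circ> real_of_ereal) \<longlongrightarrow> 0) (at_right (-\<infinity>))" "((F \<circ> real_of_ereal) \<longlongrightarrow> 0) (at_left \<infinity>)"
      using lim by (simp_all add: ereal_tendsto_simps)
  qed (use d c i in \<open>auto simp: set_integrable_def einterval_def
        has_real_derivative_iff_has_vector_derivative[symmetric] continuous_on_eq_continuous_at\<close>)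
  thus ?thesis by (simp add: interval_lebesgue_integral_def set_lebesgue_integral_def einterval_def)
qed

section \<open>Weights that integrate functions of quadratic growth\<close>

definition lin_bdd :: "'a measure \<Rightarrow> ('a \<Rightarrow> real) \<Rightarrow> ('a \<Rightarrow> real) \<Rightarrow> bool" where
  "lin_bdd M N g \<longleftrightarrow> g \<in> borel_measurable M \<and> (\<exists>A. \<forall>x. \<bar>g x\<bar> \<le> A * (1 + \<bar>N x\<bar>))"

definition quad_bdd :: "'a measure \<Rightarrow> ('a \<Rightarrow> real) \<Rightarrow> ('a \<Rightarrow> real) \<Rightarrow> bool" where
  "quad_bdd M N g \<longleftrightarrow> g \<in> borel_measurable M \<and> (\<exists>A. \<forall>x. \<bar>g x\<bar> \<le> A * (1 + (N x)\<^sup>2))"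

abbreviation "lin_bdd_real \<equiv> lin_bdd lborel (\<lambda>x. x)"

abbreviation "quad_bdd_real \<equiv> quad_bdd lborel (\<lambda>x. x)"

lemma lin_bddI: "g \<in> borel_measurable M \<Longrightarrow> (\<And>x. \<bar>g x\<bar> \<le> A * (1 + \<bar>N x\<bar>)) \<Longrightarrow> lin_bdd M N g"
  unfolding lin_bdd_def by blast

lemma quad_bddI: "g \<in> borel_measurable M \<Longrightarrow> (\<And>x. \<bar>g x\<bar> \<le> A * (1 + (N x)\<^sup>2)) \<Longrightarrow> quad_bdd M N g"
  unfolding quad_bdd_def by blast

lemma lin_bdd_const [simp, intro]: "lin_bdd M N (\<lambda>_. c)"
  by (rule lin_bddI[of _ _ "\<bar>c\<bar>"]) (auto simp: algebra_simps)

lemma lin_bdd_cmult [simp, intro!]: "lin_bdd M N g \<Longrightarrow> lin_bdd M N (\<lambda>x. c * g x)"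
  unfolding lin_bdd_def
proof safe
  fix A assume "\<forall>x. \<bar>g x\<bar> \<le> A * (1 + \<bar>N x\<bar>)"
  hence "\<bar>c * g x\<bar> \<le> (\<bar>c\<bar> * A) * (1 + \<bar>N x\<bar>)" for x
    by (simp add: abs_mult mult.assoc mult_left_mono)
  thus "\<exists>A. \<forall>x. \<bar>c * g x\<bar> \<le> A * (1 + \<bar>N x\<bar>)" by blast
qed auto

lemma lin_bdd_add [simp, intro!]:
  assumes "lin_bdd M N g" "lin_bdd M N h"
  shows "lin_bdd M N (\<lambda>x. g x + h x)"
proof -
  obtain A B where AB: "\<And>x. \<bar>g x\<bar> \<le> A * (1 + \<bar>N x\<bar>)" "\<And>x. \<bar>h x\<bar> \<le> B * (1 + \<bar>N x\<bar>)"
    using assms unfolding lin_bdd_def by blast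
  have "\<bar>g x + h x\<bar> \<le> (A + B) * (1 + \<bar>N x\<bar>)" for x
    using AB[of x] unfolding distrib_right[of A B] by linarith
  thus ?thesis using assms by (intro lin_bddI) (auto simp: lin_bdd_def)
qed

lemma lin_bdd_minus [simp, intro!]: "lin_bdd M N g \<Longrightarrow> lin_bdd M N (\<lambda>x. - g x)"
  using lin_bdd_cmult[of M N g "-1"] by simp

lemma lin_bdd_diff [simp, intro!]:
  "lin_bdd M N g \<Longrightarrow> lin_bdd M N h \<Longrightarrow> lin_bdd M N (\<lambda>x. g x - h x)"
  unfolding diff_conv_add_uminus by (intro lin_bdd_add lin_bdd_minus)

lemma lin_bdd_sum [simp, intro!]:
  "(\<And>i. i \<in> I \<Longrightarrow> lin_bdd M N (g i)) \<Longrightarrow> lin_bdd M N (\<lambda>x. \<Sum>i\<in>I. g i x)"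
  by (induction I rule: infinite_finite_induct) auto

lemma one_plus_abs_sq: "(1 + \<bar>t\<bar>)\<^sup>2 \<le> 2 * (1 + t\<^sup>2)" for t :: real
  using zero_le_power2[of "\<bar>t\<bar> - 1"] by (simp add: power2_eq_square algebra_simps)

lemma quad_bdd_mult [simp, intro]:
  assumes "lin_bdd M N g" "lin_bdd M N h"
  shows "quad_bdd M N (\<lambda>x. g x * h x)"
proof -
  obtain A B where AB: "\<And>x. \<bar>g x\<bar> \<le> A * (1 + \<bar>N x\<bar>)" "\<And>x. \<bar>h x\<bar> \<le> B * (1 + \<bar>N x\<bar>)"
    using assms unfolding lin_bdd_def by blast
  have "\<bar>g x * h x\<bar> \<le> (2 * \<bar>A\<bar> * \<bar>B\<bar>) * (1 + (N x)\<^sup>2)" for x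
  proof -
    have "\<bar>g x * h x\<bar> \<le> (\<bar>A\<bar> * (1 + \<bar>N x\<bar>)) * (\<bar>B\<bar> * (1 + \<bar>N x\<bar>))"
      unfolding abs_mult using AB[of x]
      by (intro mult_mono order_trans[OF _ mult_right_mono[OF abs_ge_self]]) auto
    also have "\<dots> = (\<bar>A\<bar> * \<bar>B\<bar>) * (1 + \<bar>N x\<bar>)\<^sup>2" by (simp add: power2_eq_square mult_ac)
    also have "\<dots> \<le> (\<bar>A\<bar> * \<bar>B\<bar>) * (2 * (1 + (N x)\<^sup>2))"
      by (intro mult_left_mono one_plus_abs_sq) auto
    finally show ?thesis by (simp add: mult_ac)
  qed
  thus ?thesis using assms by (intro quad_bddI) (auto simp: lin_bdd_def)
qed

lemma quad_bdd_power2 [simp, intro]: "lin_bdd M N g \<Longrightarrow> quad_bdd M N (\<lambda>x. (g x)\<^sup>2)"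
  unfolding power2_eq_square by (rule quad_bdd_mult)

lemma quad_bdd_lin [simp, intro]: "lin_bdd M N g \<Longrightarrow> quad_bdd M N g"
  using quad_bdd_mult[of M N g "\<lambda>_. 1"] unfolding mult_1_right by blast

lemma quad_bdd_const [simp, intro]: "quad_bdd M N (\<lambda>_. c)" by auto

lemma quad_bdd_cmult [simp, intro!]: "quad_bdd M N g \<Longrightarrow> quad_bdd M N (\<lambda>x. c * g x)"
  unfolding quad_bdd_def
proof safe
  fix A assume "\<forall>x. \<bar>g x\<bar> \<le> A * (1 + (N x)\<^sup>2)"
  hence "\<bar>c * g x\<bar> \<le> (\<bar>c\<bar> * A) * (1 + (N x)\<^sup>2)" for x
    by (simp add: abs_mult mult.assoc mult_left_mono)
  thus "\<exists>A. \<forall>x. \<bar>c * g x\<bar> \<le> A * (1 + (N x)\<^sup>2)" by blast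
qed auto

lemma quad_bdd_add [simp, intro!]:
  assumes "quad_bdd M N g" "quad_bdd M N h"
  shows "quad_bdd M N (\<lambda>x. g x + h x)"
proof -
  obtain A B where AB: "\<And>x. \<bar>g x\<bar> \<le> A * (1 + (N x)\<^sup>2)" "\<And>x. \<bar>h x\<bar> \<le> B * (1 + (N x)\<^sup>2)"
    using assms unfolding quad_bdd_def by blast
  have "\<bar>g x + h x\<bar> \<le> (A + B) * (1 + (N x)\<^sup>2)" for x
    using AB[of x] unfolding distrib_right[of A B] by linarith
  thus ?thesis using assms by (intro quad_bddI) (auto simp: quad_bdd_def)
qed

lemma quad_bdd_minus [simp, intro!]: "quad_bdd M N g \<Longrightarrow> quad_bdd M N (\<lambda>x. - g x)"
  using quad_bdd_cmult[of M N g "-1"] by simp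

lemma quad_bdd_diff [simp, intro!]:
  "quad_bdd M N g \<Longrightarrow> quad_bdd M N h \<Longrightarrow> quad_bdd M N (\<lambda>x. g x - h x)"
  unfolding diff_conv_add_uminus by (intro quad_bdd_add quad_bdd_minus)

lemma quad_bdd_divide [simp, intro!]: "quad_bdd M N g \<Longrightarrow> quad_bdd M N (\<lambda>x. g x / c)"
  using quad_bdd_cmult[of M N g "1 / c"] unfolding times_divide_eq_left mult_1_left .

lemma quad_bdd_sum [simp, intro!]:
  "(\<And>i. i \<in> I \<Longrightarrow> quad_bdd M N (g i)) \<Longrightarrow> quad_bdd M N (\<lambda>x. \<Sum>i\<in>I. g i x)"
  by (induction I rule: infinite_finite_induct) auto

locale quad_weight =
  fixes M :: "'a measure" and N w :: "'a \<Rightarrow> real"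
  assumes w_nonneg: "\<And>x. w x \<ge> 0"
    and integrable_quad: "\<And>g. quad_bdd M N g \<Longrightarrow> integrable M (\<lambda>x. g x * w x)"
    and w_mass: "(LINT x|M. w x) = 1"
begin

definition E :: "('a \<Rightarrow> real) \<Rightarrow> real" where "E g = (LINT x|M. g x * w x)"

lemma E_add: "quad_bdd M N g \<Longrightarrow> quad_bdd M N h \<Longrightarrow> E (\<lambda>x. g x + h x) = E g + E h"
  unfolding E_def by (simp add: distrib_right integrable_quad)

lemma E_diff: "quad_bdd M N g \<Longrightarrow> quad_bdd M N h \<Longrightarrow> E (\<lambda>x. g x - h x) = E g - E h"
  unfolding E_def by (simp add: left_diff_distrib integrable_quad)

lemma E_cmult: "E (\<lambda>x. c * g x) = c * E g"
  unfolding E_def by (simp add: mult.assoc)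

lemma E_divide: "E (\<lambda>x. g x / c) = E g / c"
  using E_cmult[of "1 / c" g] by simp

lemma E_minus: "E (\<lambda>x. - g x) = - E g"
  using E_cmult[of "-1" g] by simp

lemma E_const: "E (\<lambda>x. c) = c"
  unfolding E_def by (simp add: w_mass)

lemma E_sum: "(\<And>i. i \<in> I \<Longrightarrow> quad_bdd M N (g i)) \<Longrightarrow> E (\<lambda>x. \<Sum>i\<in>I. g i x) = (\<Sum>i\<in>I. E (g i))"
  by (induction I rule: infinite_finite_induct) (auto simp: E_const E_add quad_bdd_sum)

lemma E_mono:
  "quad_bdd M N g \<Longrightarrow> quad_bdd M N h \<Longrightarrow> (\<And>x. x \<in> space M \<Longrightarrow> g x \<le> h x) \<Longrightarrow> E g \<le> E h"
  unfolding E_def by (intro integral_mono integrable_quad mult_right_mono w_nonneg)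

lemma E_nonneg: "(\<And>x. g x \<ge> 0) \<Longrightarrow> E g \<ge> 0"
  unfolding E_def by (intro integral_nonneg_AE) (simp add: w_nonneg)

definition cov :: "('a \<Rightarrow> real) \<Rightarrow> ('a \<Rightarrow> real) \<Rightarrow> real" where
  "cov g h = E (\<lambda>x. g x * h x) - E g * E h"

abbreviation var :: "('a \<Rightarrow> real) \<Rightarrow> real" where "var g \<equiv> cov g g"

lemma var_centered:
  assumes [intro]: "lin_bdd M N g"
  shows "E (\<lambda>x. (g x - a)\<^sup>2) = var g + (E g - a)\<^sup>2"
proof -
  have "E (\<lambda>x. (g x - a)\<^sup>2) = E (\<lambda>x. (g x * g x - 2 * a * g x) + a\<^sup>2)"
    by (simp add: power2_eq_square algebra_simps)
  also have "\<dots> = E (\<lambda>x. g x * g x) - 2 * a * E g + a\<^sup>2"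
    using assms by (simp add: E_add E_diff E_cmult E_const)
  finally show ?thesis by (simp add: cov_def power2_eq_square algebra_simps)
qed

lemma var_le: "lin_bdd M N g \<Longrightarrow> var g \<le> E (\<lambda>x. (g x - a)\<^sup>2)"
  using var_centered[of g a] by simp

lemma var_nonneg: "lin_bdd M N g \<Longrightarrow> 0 \<le> var g"
  using var_centered[of g "E g"] E_nonneg[of "\<lambda>x. (g x - E g)\<^sup>2"] by simp

lemma var_lincomb:
  assumes [intro]: "lin_bdd M N g" "lin_bdd M N h"
  shows "var (\<lambda>x. a * g x + b * h x) = a\<^sup>2 * var g + 2 * a * b * cov g h + b\<^sup>2 * var h"
proof -
  have "E (\<lambda>x. (a * g x + b * h x) * (a * g x + b * h x)) =
    E (\<lambda>x. a\<^sup>2 * (g x * g x) + 2 * a * b * (g x * h x) + b\<^sup>2 * (h x * h x))"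
    by (simp add: power2_eq_square algebra_simps)
  also have "\<dots> = a\<^sup>2 * E (\<lambda>x. g x * g x) + 2 * a * b * E (\<lambda>x. g x * h x) + b\<^sup>2 * E (\<lambda>x. h x * h x)"
    using assms by (simp add: E_add E_cmult)
  moreover have "E (\<lambda>x. a * g x + b * h x) = a * E g + b * E h"
    using assms by (simp add: E_add E_cmult)
  ultimately show ?thesis by (simp add: cov_def power2_eq_square algebra_simps)
qed

lemma cov_sq_le:
  assumes [intro]: "lin_bdd M N g" "lin_bdd M N h"
  shows "(cov g h)\<^sup>2 \<le> var g * var h"
proof -
  have q: "0 \<le> a\<^sup>2 * var g + 2 * a * b * cov g h + b\<^sup>2 * var h" for a b
    using var_nonneg[of "\<lambda>x. a * g x + b * h x"] var_lincomb[of g h a b] assms by simp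
  show ?thesis
  proof (cases "var h = 0")
    case True
    show ?thesis
    proof (cases "cov g h = 0")
      case False
      have "0 \<le> var g + 2 * b * cov g h" for b using q[of 1 b] True by simp
      from this[of "- (var g + 1) / (2 * cov g h)"] False have False by (simp add: field_simps)
      thus ?thesis ..
    qed (simp add: True)
  next
    case False
    hence "var h > 0" using var_nonneg[of h] by fastforce
    moreover have "0 \<le> var h * (var h * var g - (cov g h)\<^sup>2)"
      using q[of "var h" "- cov g h"] by (simp add: power2_eq_square algebra_simps)
    ultimately show ?thesis by (simp add: zero_le_mult_iff mult.commute)
  qed
qed

lemma cov_sum_left:
  assumes "\<And>i. i \<in> I \<Longrightarrow> lin_bdd M N (g i)" "lin_bdd M N h"
  shows "cov (\<lambda>x. \<Sum>i\<in>I. a i * g i x) h = (\<Sum>i\<in>I. a i * cov (g i) h)"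
proof -
  have "E (\<lambda>x. (\<Sum>i\<in>I. a i * g i x) * h x) = E (\<lambda>x. \<Sum>i\<in>I. a i * (g i x * h x))"
    by (simp add: sum_distrib_right mult.assoc)
  also have "\<dots> = (\<Sum>i\<in>I. a i * E (\<lambda>x. g i x * h x))"
    using assms by (simp add: E_sum E_cmult)
  moreover have "E (\<lambda>x. \<Sum>i\<in>I. a i * g i x) = (\<Sum>i\<in>I. a i * E (g i))"
    using assms by (simp add: E_sum E_cmult)
  ultimately show ?thesis
    by (simp add: cov_def sum_distrib_right mult.assoc sum_subtractf[symmetric] right_diff_distrib)
qed

end

lemma one_plus_le_exp:
  fixes u b :: real
  assumes "b > 0" "u \<ge> 0"
  shows "1 + u \<le> (1 + 1 / b) * exp (b * u)"
proof -
  have "1 + u \<le> (1 + 1 / b) * (1 + b * u)" using assms by (simp add: field_simps)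
  also have "\<dots> \<le> (1 + 1 / b) * exp (b * u)" using assms by (intro mult_left_mono) auto
  finally show ?thesis .
qed

lemma integrable_exp_neg_sq:
  fixes b :: real assumes "b > 0" shows "integrable lborel (\<lambda>x::real. exp (- b * x\<^sup>2))"
proof -
  have "integrable lborel (\<lambda>x. sqrt (2 * pi * (sqrt (1 / (2*b)))\<^sup>2) * normal_density 0 (sqrt (1 / (2 * b))) x)"
    using assms by (intro integrable_mult_right integrable_normal_density) auto
  thus ?thesis using assms by (simp add: normal_density_def field_simps real_sqrt_divide)
qed

section \<open>Uniformly convex potentials on the line\<close>

lemma quadratic_upper_bound:
  fixes f f' :: "real \<Rightarrow> real"
  assumes d: "\<And>x. (f has_real_derivative f' x) (at x)"
    and u: "\<And>s t. s \<le> t \<Longrightarrow> f' t - f' s \<le> K * (t - s)"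
  shows "f t \<le> f s + f' s * (t - s) + K / 2 * (t - s)\<^sup>2"
proof -
  define k where "k x = f s + f' s * (x - s) + K / 2 * (x - s)\<^sup>2 - f x" for x
  have dk: "(k has_real_derivative f' s + K * (x - s) - f' x) (at x)" for x
    unfolding k_def by (auto intro!: derivative_eq_intros d)
  have "k s \<le> k t"
  proof (cases "s \<le> t")
    case True
    show ?thesis
    proof (rule DERIV_nonneg_imp_nondecreasing[OF True])
      fix x assume "s \<le> x" "x \<le> t"
      thus "\<exists>y. (k has_real_derivative y) (at x) \<and> 0 \<le> y" using dk[of x] u[of s x] by auto
    qed
  next
    case False
    hence st: "t \<le> s" by simp
    show ?thesis
    proof (rule DERIV_nonpos_imp_nonincreasing[OF st])
      fix x assume "t \<le> x" "x \<le> s"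
      hence "f' s + K * (x - s) - f' x \<le> 0" using u[of x s] by (simp add: algebra_simps)
      thus "\<exists>y. (k has_real_derivative y) (at x) \<and> y \<le> 0" using dk[of x] by blast
    qed
  qed
  thus ?thesis by (simp add: k_def)
qed

locale line_potential =
  fixes \<epsilon> \<Lambda> :: real and V V' :: "real \<Rightarrow> real"
  assumes eps_pos: "\<epsilon> > 0"
    and V_deriv: "\<And>x. (V has_real_derivative V' x) (at x)"
    and V'_lower: "\<And>s t. s \<le> t \<Longrightarrow> \<epsilon> * (t - s) \<le> V' t - V' s"
    and V'_upper: "\<And>s t. s \<le> t \<Longrightarrow> V' t - V' s \<le> \<Lambda> * (t - s)"
    and mass: "(LINT x|lborel. exp (- V x)) = 1"
begin

lemma V'_lipschitz: "\<bar>V' t - V' s\<bar> \<le> \<Lambda> * \<bar>t - s\<bar>"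
proof -
  have "\<bar>V' t - V' s\<bar> \<le> \<Lambda> * \<bar>t - s\<bar>" if "s \<le> t" for s t
  proof -
    have "0 \<le> \<epsilon> * (t - s)" using that eps_pos by simp
    thus ?thesis using V'_lower[OF that] V'_upper[OF that] that by simp
  qed
  thus ?thesis by (cases "s \<le> t") (metis abs_minus_commute le_cases)+
qed

lemma Lam_pos: "\<Lambda> > 0"
  using V'_lower[of 0 1] V'_upper[of 0 1] eps_pos by simp

lemma continuous_V': "continuous_on A V'"
proof (rule lipschitz_on_continuous_on)
  show "\<Lambda>-lipschitz_on A V'"
    using V'_lipschitz Lam_pos by (auto simp: lipschitz_on_def dist_real_def)
qed

lemma continuous_V: "continuous_on A V"
  using V_deriv by (meson DERIV_isCont continuous_at_imp_continuous_on)

lemma measurable_V [measurable]: "V \<in> borel_measurable borel" "V' \<in> borel_measurable borel"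
  by (intro borel_measurable_continuous_onI continuous_V continuous_V')+

lemma V'_lin [simp, intro]: "lin_bdd_real V'"
proof (rule lin_bddI)
  fix x
  have "\<bar>V' x\<bar> \<le> \<bar>V' 0\<bar> + \<Lambda> * \<bar>x\<bar>" using V'_lipschitz[of x 0] by simp
  also have "\<dots> \<le> (\<bar>V' 0\<bar> + \<Lambda>) * (1 + \<bar>x\<bar>)" using Lam_pos by (simp add: algebra_simps)
  finally show "\<bar>V' x\<bar> \<le> (\<bar>V' 0\<bar> + \<Lambda>) * (1 + \<bar>x\<bar>)" .
qed simp

lemma id_lin [simp, intro]: "lin_bdd_real (\<lambda>x. x)"
  by (rule lin_bddI[of _ _ 1]) auto

lemma lin_of_bounded_deriv:
  assumes d: "\<And>x. (g has_real_derivative g' x) (at x)" and b: "\<And>x. \<bar>g' x\<bar> \<le> B"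
  shows "lin_bdd_real g"
proof (rule lin_bddI)
  show "g \<in> borel_measurable lborel"
    using d by (simp, intro borel_measurable_continuous_onI) (meson DERIV_isCont continuous_at_imp_continuous_on)
  fix x
  have "norm (g x - g 0) \<le> B * norm (x - 0)"
    by (rule field_differentiable_bound[of UNIV g g']) (use d b in \<open>auto simp: has_field_derivative_at_within\<close>)
  hence "\<bar>g x\<bar> \<le> \<bar>g 0\<bar> + B * \<bar>x\<bar>" by simp
  also have "\<dots> \<le> (\<bar>g 0\<bar> + B) * (1 + \<bar>x\<bar>)"
    using b[of 0] by (simp add: algebra_simps)
  finally show "\<bar>g x\<bar> \<le> (\<bar>g 0\<bar> + B) * (1 + \<bar>x\<bar>)" .
qed

lemma V_lower: "V 0 + V' 0 * x + \<epsilon> / 2 * x\<^sup>2 \<le> V x"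
proof -
  have "- V x \<le> - V 0 + - V' 0 * (x - 0) + - \<epsilon> / 2 * (x - 0)\<^sup>2"
  proof (rule quadratic_upper_bound[of "\<lambda>x. - V x" "\<lambda>x. - V' x"])
    show "- V' t - - V' s \<le> - \<epsilon> * (t - s)" if "s \<le> t" for s t using V'_lower[OF that] by simp
  qed (rule DERIV_minus[OF V_deriv])
  thus ?thesis by simp
qed

lemma V_quad [simp, intro]: "quad_bdd_real V"
proof (rule quad_bddI)
  fix x
  define C where "C = \<bar>V' 0\<bar> + \<Lambda> * \<bar>x\<bar>"
  have "norm (V x - V 0) \<le> C * norm (x - 0)"
  proof (rule field_differentiable_bound[of "closed_segment 0 x" V V'])
    fix z assume z: "z \<in> closed_segment 0 x"
    hence "\<bar>z\<bar> \<le> \<bar>x\<bar>" by (auto simp: closed_segment_eq_real_ivl split: if_splits)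
    hence "\<Lambda> * \<bar>z\<bar> \<le> \<Lambda> * \<bar>x\<bar>" using Lam_pos by simp
    thus "norm (V' z) \<le> C" using V'_lipschitz[of z 0] by (simp add: C_def)
  qed (auto intro: has_field_derivative_at_within V_deriv)
  hence "\<bar>V x\<bar> \<le> \<bar>V 0\<bar> + \<bar>V' 0\<bar> * \<bar>x\<bar> + \<Lambda> * x\<^sup>2" by (simp add: C_def algebra_simps power2_eq_square)
  also have "\<bar>V' 0\<bar> * \<bar>x\<bar> \<le> \<bar>V' 0\<bar> * (1 + x\<^sup>2)"
    using zero_le_power2[of "\<bar>x\<bar> - 1"] by (intro mult_left_mono) (auto simp: power2_eq_square algebra_simps abs_mult_self_eq)
  finally have "\<bar>V x\<bar> \<le> \<bar>V 0\<bar> + \<bar>V' 0\<bar> * (1 + x\<^sup>2) + \<Lambda> * x\<^sup>2" by simp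
  also have "\<dots> \<le> (\<bar>V 0\<bar> + \<bar>V' 0\<bar> + \<Lambda>) * (1 + x\<^sup>2)" using Lam_pos by (simp add: algebra_simps)
  finally show "\<bar>V x\<bar> \<le> (\<bar>V 0\<bar> + \<bar>V' 0\<bar> + \<Lambda>) * (1 + x\<^sup>2)" .
qed simp

lemma quad_exp_bound:
  assumes "quad_bdd_real g"
  obtains B where "\<And>x. \<bar>g x * exp (- V x)\<bar> \<le> B * exp (- (\<epsilon> / 8) * x\<^sup>2)"
proof -
  obtain A where A: "\<And>x. \<bar>g x\<bar> \<le> A * (1 + x\<^sup>2)" using assms by (auto simp: quad_bdd_def)
  define B where "B = \<bar>A\<bar> * (1 + 8 / \<epsilon>) * exp (- V 0 + (V' 0)\<^sup>2 / \<epsilon>)"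
  have "\<bar>g x * exp (- V x)\<bar> \<le> B * exp (- (\<epsilon> / 8) * x\<^sup>2)" for x
  proof -
    have "0 \<le> (V' 0 / sqrt \<epsilon> + sqrt \<epsilon> * x / 2)\<^sup>2" by simp
    also have "\<dots> = (V' 0)\<^sup>2 / \<epsilon> + V' 0 * x + \<epsilon> / 4 * x\<^sup>2"
      using eps_pos by (simp add: power2_sum power_mult_distrib power_divide)
    finally have "- V x \<le> (- V 0 + (V' 0)\<^sup>2 / \<epsilon>) - \<epsilon> / 4 * x\<^sup>2" using V_lower[of x] by simp
    hence e: "exp (- V x) \<le> exp (- V 0 + (V' 0)\<^sup>2 / \<epsilon>) * exp (- (\<epsilon> / 4) * x\<^sup>2)"
      by (simp add: exp_add[symmetric] exp_diff[symmetric])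
    have "\<bar>g x\<bar> \<le> \<bar>A\<bar> * ((1 + 8 / \<epsilon>) * exp (\<epsilon> / 8 * x\<^sup>2))"
      using A[of x] one_plus_le_exp[of "\<epsilon> / 8" "x\<^sup>2"] eps_pos
      by (intro order_trans[OF A] mult_mono) auto
    hence "\<bar>g x * exp (- V x)\<bar> \<le> (\<bar>A\<bar> * ((1 + 8 / \<epsilon>) * exp (\<epsilon> / 8 * x\<^sup>2))) * (exp (- V 0 + (V' 0)\<^sup>2 / \<epsilon>) * exp (- (\<epsilon> / 4) * x\<^sup>2))"
      unfolding abs_mult abs_exp_cancel using eps_pos by (intro mult_mono e) auto
    also have "\<dots> = B * (exp (\<epsilon> / 8 * x\<^sup>2) * exp (- (\<epsilon> / 4) * x\<^sup>2))" by (simp add: B_def mult_ac)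
    also have "exp (\<epsilon> / 8 * x\<^sup>2) * exp (- (\<epsilon> / 4) * x\<^sup>2) = exp (- (\<epsilon> / 8) * x\<^sup>2)"
      by (simp add: exp_add[symmetric] algebra_simps)
    finally show ?thesis .
  qed
  thus thesis using that by blast
qed

lemma quad_integrable: "quad_bdd_real g \<Longrightarrow> integrable lborel (\<lambda>x. g x * exp (- V x))"
proof (goal_cases)
  case 1
  obtain B where B: "\<And>x. \<bar>g x * exp (- V x)\<bar> \<le> B * exp (- (\<epsilon> / 8) * x\<^sup>2)" using quad_exp_bound[OF 1] by blast
  have [measurable]: "g \<in> borel_measurable borel" using 1 by (simp add: quad_bdd_def)
  show ?case
  proof (rule Bochner_Integration.integrable_bound)
    show "integrable lborel (\<lambda>x. B * exp (- (\<epsilon> / 8) * x\<^sup>2))"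
      by (intro integrable_mult_right integrable_exp_neg_sq) (use eps_pos in simp)
    show "AE x in lborel. norm (g x * exp (- V x)) \<le> norm (B * exp (- (\<epsilon> / 8) * x\<^sup>2))"
      unfolding real_norm_def by (intro AE_I2 order_trans[OF B abs_ge_self])
  qed measurable
qed

lemma quad_vanishes:
  assumes "quad_bdd_real g"
  shows "((\<lambda>x. g x * exp (- V x)) \<longlongrightarrow> 0) at_bot" "((\<lambda>x. g x * exp (- V x)) \<longlongrightarrow> 0) at_top"
proof -
  obtain B where B: "\<And>x. \<bar>g x * exp (- V x)\<bar> \<le> B * exp (- (\<epsilon> / 8) * x\<^sup>2)" using quad_exp_bound[OF assms] by blast
  have 1: "((\<lambda>x. B * exp (- (\<epsilon> / 8) * x\<^sup>2)) \<longlongrightarrow> 0) at_bot" 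
    and 2: "((\<lambda>x. B * exp (- (\<epsilon> / 8) * x\<^sup>2)) \<longlongrightarrow> 0) at_top" 
    using eps_pos by real_asymp+
  show "((\<lambda>x. g x * exp (- V x)) \<longlongrightarrow> 0) at_bot" "((\<lambda>x. g x * exp (- V x)) \<longlongrightarrow> 0) at_top"
    by (rule Lim_null_comparison[OF _ 1] Lim_null_comparison[OF _ 2], use B in simp)+
qed

sublocale quad_weight lborel "\<lambda>x. x" "\<lambda>x. exp (- V x)"
  by standard (auto simp: quad_integrable mass)

lemma integration_by_parts:
  assumes d: "\<And>x. (u has_real_derivative u' x) (at x)" and c: "continuous_on UNIV u'"
    and u: "lin_bdd_real u" and u': "quad_bdd_real u'"
  shows "E (\<lambda>x. V' x * u x) = E u'"
proof -
  have cu: "continuous_on UNIV u" using d by (meson DERIV_isCont continuous_at_imp_continuous_on)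
  have q: "quad_bdd_real (\<lambda>x. u' x - V' x * u x)"
    using u u' V'_lin by auto
  have "(LINT x|lborel. (u' x - V' x * u x) * exp (- V x)) = 0"
  proof (rule integral_derivative_vanishing_at_infinity[of "\<lambda>x. u x * exp (- V x)"])
    show "((\<lambda>x. u x * exp (- V x)) has_real_derivative (u' x - V' x * u x) * exp (- V x)) (at x)" for x
      by (auto intro!: derivative_eq_intros d V_deriv simp: algebra_simps)
    show "continuous_on UNIV (\<lambda>x. (u' x - V' x * u x) * exp (- V x))"
      by (intro continuous_intros c cu continuous_V continuous_V')
    show "integrable lborel (\<lambda>x. (u' x - V' x * u x) * exp (- V x))" by (rule quad_integrable[OF q])
  qed (intro quad_vanishes quad_bdd_lin u)+
  hence "E (\<lambda>x. u' x - V' x * u x) = 0" by (simp add: E_def)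
  thus ?thesis using u u' V'_lin by (subst (asm) E_diff) auto
qed

lemma E_V': "E V' = 0"
  using integration_by_parts[of "\<lambda>_. 1" "\<lambda>_. 0"] by (simp add: E_const)

lemma poincare:
  assumes d: "\<And>x. (g has_real_derivative g' x) (at x)" and c: "continuous_on UNIV g'"
    and b: "\<And>x. \<bar>g' x\<bar> \<le> B"
  shows "\<epsilon> * var g \<le> E (\<lambda>x. (g' x)\<^sup>2)"
proof -
  have c2: "continuous_on UNIV (\<lambda>x. (g' x)\<^sup>2)" by (intro continuous_intros c)
  obtain \<Gamma> where \<Gamma>: "(\<Gamma> has_real_derivative (g' x)\<^sup>2) (at x)" for x
    using einterval_antiderivative[of "-\<infinity>" \<infinity> "\<lambda>x. (g' x)\<^sup>2"] c2
    by (auto simp: has_real_derivative_iff_has_vector_derivative continuous_on_eq_continuous_at)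
  have bb: "\<bar>(g' x)\<^sup>2\<bar> \<le> B\<^sup>2" for x using b[of x] by (simp add: abs_le_square_iff[symmetric])
  have [measurable]: "g' \<in> borel_measurable borel" by (intro borel_measurable_continuous_onI c)
  have lg [simp, intro]: "lin_bdd_real g" by (rule lin_of_bounded_deriv[OF d b])
  have l\<Gamma> [simp, intro]: "lin_bdd_real \<Gamma>" by (rule lin_of_bounded_deriv[OF \<Gamma> bb])
  have lg' [simp, intro]: "lin_bdd_real g'"
  proof (rule lin_bddI[of _ _ B])
    show "\<bar>g' x\<bar> \<le> B * (1 + \<bar>x\<bar>)" for x using b[of x] abs_ge_zero[of "g' x"]
      by (metis add_increasing2 abs_ge_zero mult.right_neutral mult_left_mono order_trans le_add_same_cancel1)
  qed simp
  have cs: "\<epsilon> * (g x - g y)\<^sup>2 \<le> (V' x - V' y) * (\<Gamma> x - \<Gamma> y)" if xy: "y < x" for x y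
  proof -
    define l where "l = (g x - g y) / (x - y)"
    define k where "k t = \<Gamma> t + l\<^sup>2 * t - 2 * l * g t" for t
    have "(k has_real_derivative (g' t - l)\<^sup>2) (at t)" for t
      unfolding k_def by (auto intro!: derivative_eq_intros d \<Gamma> simp: power2_eq_square algebra_simps)
    hence "k y \<le> k x"
      using DERIV_nonneg_imp_nondecreasing[of y x k] xy by fastforce
    hence "2 * l * (g x - g y) - l\<^sup>2 * (x - y) \<le> \<Gamma> x - \<Gamma> y" by (simp add: k_def algebra_simps)
    also have "2 * l * (g x - g y) - l\<^sup>2 * (x - y) = (g x - g y)\<^sup>2 / (x - y)"
    proof -
      have "2 * (u / d) * u - (u / d)\<^sup>2 * d = u\<^sup>2 / d" if "d \<noteq> 0" for u d :: real
        using that by (simp add: power2_eq_square field_simps)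
      moreover have "x - y \<noteq> 0" using xy by simp
      ultimately show ?thesis unfolding l_def by blast
    qed
    finally have 1: "(g x - g y)\<^sup>2 / (x - y) \<le> \<Gamma> x - \<Gamma> y" .
    have "\<epsilon> * (g x - g y)\<^sup>2 = (\<epsilon> * (x - y)) * ((g x - g y)\<^sup>2 / (x - y))" using xy by simp
    also have "\<dots> \<le> (V' x - V' y) * (\<Gamma> x - \<Gamma> y)"
    proof (intro mult_mono 1)
      show "\<epsilon> * (x - y) \<le> V' x - V' y" using V'_lower[of y x] xy by simp
      moreover have "0 \<le> \<epsilon> * (x - y)" using xy eps_pos by simp
      ultimately show "0 \<le> V' x - V' y" by linarith
    qed (use xy in simp)
    finally show ?thesis .
  qed
  have cs': "\<epsilon> * (g x - g y)\<^sup>2 \<le> (V' x - V' y) * (\<Gamma> x - \<Gamma> y)" for x y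
    using cs[of x y] cs[of y x]
    by (cases y x rule: linorder_cases) (auto simp: power2_commute algebra_simps)
  have inner: "\<epsilon> * (var g + (E g - g y)\<^sup>2) \<le> E (\<lambda>x. (g' x)\<^sup>2) - V' y * E \<Gamma> + V' y * \<Gamma> y" for y
  proof -
    have "\<epsilon> * (var g + (E g - g y)\<^sup>2) = E (\<lambda>x. \<epsilon> * (g x - g y)\<^sup>2)"
      by (simp add: E_cmult var_centered[OF lg])
    also have "\<dots> \<le> E (\<lambda>x. (V' x - V' y) * (\<Gamma> x - \<Gamma> y))"
      by (rule E_mono) (use cs' V'_lin in auto)
    also have "\<dots> = E (\<lambda>x. (V' x * \<Gamma> x - \<Gamma> y * V' x) - (V' y * \<Gamma> x - V' y * \<Gamma> y))"
      by (simp add: algebra_simps)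
    also have "\<dots> = (E (\<lambda>x. V' x * \<Gamma> x) - \<Gamma> y * E V') - (V' y * E \<Gamma> - V' y * \<Gamma> y)"
      by (simp add: E_diff E_cmult E_const)
    also have "E (\<lambda>x. V' x * \<Gamma> x) = E (\<lambda>x. (g' x)\<^sup>2)"
      by (rule integration_by_parts[OF \<Gamma> c2]) auto
    finally show ?thesis by (simp add: E_V')
  qed
  have "E (\<lambda>y. \<epsilon> * (var g + (g y - E g)\<^sup>2)) \<le> E (\<lambda>y. E (\<lambda>x. (g' x)\<^sup>2) - V' y * E \<Gamma> + V' y * \<Gamma> y)"
    using inner by (intro E_mono) (use V'_lin in \<open>auto simp: power2_commute mult.commute\<close>)
  also have "E (\<lambda>y. \<epsilon> * (var g + (g y - E g)\<^sup>2)) = \<epsilon> * (var g + var g)"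
    by (subst E_cmult, subst E_add) (auto simp: E_const var_centered[OF lg])
  also have "E (\<lambda>y. E (\<lambda>x. (g' x)\<^sup>2) - V' y * E \<Gamma> + V' y * \<Gamma> y) = 
     E (\<lambda>y. E (\<lambda>x. (g' x)\<^sup>2) - E \<Gamma> * V' y + V' y * \<Gamma> y)" by (simp add: mult.commute)
  also have "\<dots> = E (\<lambda>x. (g' x)\<^sup>2) + E (\<lambda>x. V' x * \<Gamma> x)"
    by (simp add: E_add E_diff E_cmult E_const E_V')
  also have "E (\<lambda>x. V' x * \<Gamma> x) = E (\<lambda>x. (g' x)\<^sup>2)"
    by (rule integration_by_parts[OF \<Gamma> c2]) auto
  finally show ?thesis by simp
qed

end

lemma attains_max_of_vanishing:
  fixes G :: "real \<Rightarrow> real"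
  assumes c: "continuous_on UNIV G" and l: "(G \<longlongrightarrow> 0) at_bot" "(G \<longlongrightarrow> 0) at_top"
    and pos: "G x1 > 0"
  obtains x0 where "\<And>x. G x \<le> G x0"
proof -
  obtain a where a: "\<And>x. x \<le> a \<Longrightarrow> G x < G x1"
    using order_tendstoD(2)[OF l(1) pos] by (auto simp: eventually_at_bot_linorder)
  obtain b where b: "\<And>x. x \<ge> b \<Longrightarrow> G x < G x1"
    using order_tendstoD(2)[OF l(2) pos] by (auto simp: eventually_at_top_linorder)
  have ab: "a < x1" "x1 < b" using a b by (metis less_irrefl linorder_not_less)+
  obtain x0 where x0: "x0 \<in> {a..b}" "\<And>x. x \<in> {a..b} \<Longrightarrow> G x \<le> G x0"
    using continuous_attains_sup[of "{a..b}" G] ab continuous_on_subset[OF c] by auto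
  have "G x \<le> G x0" for x
  proof (cases "x \<in> {a..b}")
    case False
    hence "G x < G x1" using a[of x] b[of x] by auto
    thus ?thesis using x0(2)[of x1] ab by simp
  qed (use x0 in auto)
  thus thesis using that by blast
qed

lemma log_gap_quadratic:
  fixes t K :: real
  assumes "0 < t" "t \<le> K" "1 \<le> K"
  shows "(t - 1)\<^sup>2 / (2 * K) \<le> t - 1 - ln t"
proof -
  define k where "k t = t - 1 - ln t - (t - 1)\<^sup>2 / (2 * K)" for t
  have dk: "(k has_real_derivative (s - 1) * (1 / s - 1 / K)) (at s)" if "s > 0" for s
    unfolding k_def using that assms
    by (auto intro!: derivative_eq_intros simp: field_simps)
  have "k 1 \<le> k t"
  proof (cases "1 \<le> t")
    case True
    show ?thesis
    proof (rule DERIV_nonneg_imp_nondecreasing[OF True])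
      fix s assume s: "1 \<le> s" "s \<le> t"
      hence "0 \<le> (s - 1) * (1 / s - 1 / K)"
        using assms by (intro mult_nonneg_nonneg) (auto simp: field_simps)
      thus "\<exists>y. (k has_real_derivative y) (at s) \<and> 0 \<le> y" using dk[of s] s by auto
    qed
  next
    case False
    hence t: "t \<le> 1" by simp
    show ?thesis
    proof (rule DERIV_nonpos_imp_nonincreasing[OF t])
      fix s assume s: "t \<le> s" "s \<le> 1"
      hence "(s - 1) * (1 / s - 1 / K) \<le> 0"
        using assms by (intro mult_nonpos_nonneg) (auto simp: field_simps)
      thus "\<exists>y. (k has_real_derivative y) (at s) \<and> y \<le> 0" using dk[of s] s assms by auto
    qed
  qed
  thus ?thesis by (simp add: k_def)
qed

lemma std_normal_density_deriv:
  "(std_normal_density has_real_derivative - (x * std_normal_density x)) (at x)"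
proof -
  have "((\<lambda>x. c * exp (- x\<^sup>2 / 2)) has_real_derivative - (x * (c * exp (- x\<^sup>2 / 2)))) (at x)" for c
    by (auto intro!: derivative_eq_intros)
  thus ?thesis unfolding std_normal_density_def[abs_def] .
qed

context line_potential
begin

text \<open>
  The maximum principle behind Caffarelli's contraction theorem, applied to the difference of the
  density and \<open>\<surd>\<Lambda>\<close> times the Gaussian density read through the transport map.
\<close>

lemma transport_to_gaussian:
  obtains T where "\<And>x. (T has_real_derivative exp (- V x) / std_normal_density (T x)) (at x)"
    "\<And>x. exp (- V x) / std_normal_density (T x) \<le> sqrt \<Lambda>"
proof -
  let ?\<phi> = "std_normal_density"
  define K where "K = sqrt \<Lambda>"
  have K: "K > 0" "K * K = \<Lambda>" using Lam_pos by (auto simp: K_def)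
  have c\<phi>: "continuous_on UNIV ?\<phi>"
    using std_normal_density_deriv by (meson DERIV_isCont continuous_at_imp_continuous_on)
  have cV: "continuous_on UNIV (\<lambda>x. exp (- V x))" by (intro continuous_intros continuous_V)
  have iV: "integrable lborel (\<lambda>x. exp (- V x))" using quad_integrable[of "\<lambda>_. 1"] by simp
  obtain T where T: "\<And>x. (T has_real_derivative exp (- V x) / ?\<phi> (T x)) (at x)"
    and lim: "filterlim T at_bot at_bot" "filterlim T at_top at_top"
    using monotone_rearrangement[OF cV _ iV c\<phi>] mass normal_density_pos[of 1 0]
    by (metis exp_gt_zero integrable_normal_density integral_normal_density zero_less_one)
  have p: "?\<phi> x > 0" for x by (simp add: normal_density_pos)
  define G where "G x = exp (- V x) - K * ?\<phi> (T x)" for x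
  have dG: "(G has_real_derivative exp (- V x) * (K * T x - V' x)) (at x)" for x
  proof -
    have "(G has_real_derivative exp (- V x) * (- V' x) -
        K * (- (T x * ?\<phi> (T x)) * (exp (- V x) / ?\<phi> (T x)))) (at x)"
      unfolding G_def
      by (auto intro!: derivative_eq_intros V_deriv DERIV_chain2[OF std_normal_density_deriv T])
    thus ?thesis using p[of "T x"] by (simp add: algebra_simps)
  qed
  have cG: "continuous_on UNIV G"
    using dG by (meson DERIV_isCont continuous_at_imp_continuous_on)
  have \<phi>lim: "(?\<phi> \<longlongrightarrow> 0) at_bot" "(?\<phi> \<longlongrightarrow> 0) at_top"
    unfolding std_normal_density_def[abs_def] by real_asymp+
  have Glim: "(G \<longlongrightarrow> 0) at_bot" "(G \<longlongrightarrow> 0) at_top"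
  proof -
    have "(G \<longlongrightarrow> 0 - K * 0) at_bot" "(G \<longlongrightarrow> 0 - K * 0) at_top"
      unfolding G_def
      by (intro tendsto_diff tendsto_mult tendsto_const filterlim_compose[OF \<phi>lim(1) lim(1)]
            filterlim_compose[OF \<phi>lim(2) lim(2)], use quad_vanishes[of "\<lambda>_. 1"] in simp)+
    thus "(G \<longlongrightarrow> 0) at_bot" "(G \<longlongrightarrow> 0) at_top" by simp_all
  qed
  have "G x1 \<le> 0" for x1
  proof (rule ccontr)
    assume "\<not> G x1 \<le> 0"
    hence pos: "G x1 > 0" by simp
    obtain x0 where x0: "\<And>x. G x \<le> G x0" using attains_max_of_vanishing[OF cG Glim pos] by blast
    have "exp (- V x0) * (K * T x0 - V' x0) = 0"
      by (rule DERIV_local_max[OF dG, of 1]) (use x0 in auto)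
    hence q0: "K * T x0 = V' x0" by simp
    have "\<forall>\<^sub>F x in at x0. 0 < G x"
      using order_tendstoD(1)[of G "G x0" "at x0" 0] pos x0[of x1] cG
      by (auto simp: continuous_on_eq_continuous_at isCont_def)
    then obtain d where d: "d > 0" "\<And>x. x \<noteq> x0 \<Longrightarrow> dist x x0 < d \<Longrightarrow> 0 < G x"
      by (auto simp: eventually_at)
    have Gp: "0 < G x" if "x0 \<le> x" "x < x0 + d" for x
      using d(2)[of x] that pos x0[of x1] by (cases "x = x0") (auto simp: dist_real_def)
    have T': "K < exp (- V x) / ?\<phi> (T x)" if "x0 \<le> x" "x < x0 + d" for x
      using Gp[OF that] p[of "T x"] by (simp add: G_def field_simps)
    have q: "0 < K * T x - V' x" if x: "x0 < x" "x < x0 + d" for x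
    proof -
      define k where "k x = T x - K * x" for x
      have "k x0 < k x"
      proof (rule DERIV_pos_imp_increasing[OF x(1)])
        fix y assume y: "x0 \<le> y" "y \<le> x"
        have "(k has_real_derivative exp (- V y) / ?\<phi> (T y) - K) (at y)"
          unfolding k_def by (auto intro!: derivative_eq_intros T)
        thus "\<exists>z. (k has_real_derivative z) (at y) \<and> 0 < z" using T'[of y] y x by auto
      qed
      hence "K * (x - x0) < T x - T x0" by (simp add: k_def algebra_simps)
      hence "K * (K * (x - x0)) < K * (T x - T x0)" using K by (intro mult_strict_left_mono)
      moreover have "V' x - V' x0 \<le> K * (K * (x - x0))"
        using V'_upper[of x0 x] x K by (simp add: mult.assoc[symmetric])
      ultimately show ?thesis using q0 by (simp add: algebra_simps)
    qed
    have "G x0 < G (x0 + d / 2)"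
    proof (rule DERIV_pos_imp_increasing_open[of _ _ G])
      show "x0 < x0 + d / 2" using d by simp
      fix x assume "x0 < x" "x < x0 + d / 2"
      thus "\<exists>y. (G has_real_derivative y) (at x) \<and> 0 < y"
        using dG[of x] q[of x] d by (intro exI[of _ "exp (- V x) * (K * T x - V' x)"]) auto
    qed (use cG in \<open>auto intro: continuous_on_subset\<close>)
    thus False using x0[of "x0 + d / 2"] by simp
  qed
  hence "exp (- V x) / ?\<phi> (T x) \<le> K" for x
    using p[of "T x"] by (simp add: G_def field_simps)
  thus thesis using that[of T] T by (simp add: K_def)
qed

theorem log_sobolev_centered:
  assumes L: "1 \<le> \<Lambda>" and c: "0 \<le> c" "c \<le> 1 / 2" "c \<le> \<epsilon> / (2 * sqrt \<Lambda>)"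
  shows "E (\<lambda>x. x\<^sup>2 / 2 - V x) + ln (2 * pi) / 2
    \<le> (1 - c) / 2 * E (\<lambda>x. (V' x - x)\<^sup>2) + c / 2 * (E (\<lambda>x. x))\<^sup>2"
proof -
  let ?\<phi> = "std_normal_density"
  define K where "K = sqrt \<Lambda>"
  have K: "K \<ge> 1" using L by (simp add: K_def)
  obtain T where T0: "\<And>x. (T has_real_derivative exp (- V x) / ?\<phi> (T x)) (at x)"
    and TK0: "\<And>x. exp (- V x) / ?\<phi> (T x) \<le> K"
    using transport_to_gaussian unfolding K_def by blast
  define T' where "T' x = exp (- V x) / ?\<phi> (T x)" for x
  have T: "\<And>x. (T has_real_derivative T' x) (at x)" and TK: "\<And>x. T' x \<le> K"
    using T0 TK0 by (auto simp: T'_def)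
  have Tpos: "0 < T' x" for x by (simp add: T'_def normal_density_pos)
  have logT: "ln (T' x) = - V x + (T x)\<^sup>2 / 2 + ln (2 * pi) / 2" for x
  proof -
    have "ln (?\<phi> (T x)) = - (ln (2 * pi) / 2) - (T x)\<^sup>2 / 2"
      unfolding std_normal_density_def
      by (simp add: ln_mult ln_div ln_sqrt)
    thus ?thesis unfolding T'_def using normal_density_pos[of 1 0 "T x"] by (simp add: ln_div)
  qed
  define \<theta> where "\<theta> x = T x - x" for x
  define \<theta>' where "\<theta>' x = T' x - 1" for x
  define h' where "h' x = V' x - x" for x
  have d\<theta>: "(\<theta> has_real_derivative \<theta>' x) (at x)" for x
    unfolding \<theta>_def \<theta>'_def by (auto intro!: derivative_eq_intros T)
  have cT: "continuous_on UNIV T" using T by (meson DERIV_isCont continuous_at_imp_continuous_on)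
  have c\<theta>': "continuous_on UNIV \<theta>'"
  proof -
    have "\<theta>' x = exp (- V x + (T x)\<^sup>2 / 2 + ln (2 * pi) / 2) - 1" for x
    proof -
      have "T' x = exp (ln (T' x))" using Tpos[of x] by simp
      thus ?thesis unfolding \<theta>'_def logT by simp
    qed
    thus ?thesis by (subst continuous_on_cong[OF refl]) (auto intro!: continuous_intros continuous_V cT)
  qed
  have b\<theta>': "\<bar>\<theta>' x\<bar> \<le> K" for x using Tpos[of x] TK[of x] K by (auto simp: \<theta>'_def)
  have l\<theta> [simp]: "lin_bdd_real \<theta>" by (rule lin_of_bounded_deriv[OF d\<theta> b\<theta>'])
  have lh' [simp]: "lin_bdd_real h'" unfolding h'_def by auto
  have l\<theta>' [simp]: "lin_bdd_real \<theta>'"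
  proof (rule lin_bddI[of _ _ K])
    show "\<theta>' \<in> borel_measurable lborel" using borel_measurable_continuous_onI[OF c\<theta>'] by simp
    fix x
    have "K * 1 \<le> K * (1 + \<bar>x\<bar>)" using K by (intro mult_left_mono) auto
    thus "\<bar>\<theta>' x\<bar> \<le> K * (1 + \<bar>x\<bar>)" using b\<theta>'[of x] by simp
  qed
  have pw: "x\<^sup>2 / 2 - V x + ln (2 * pi) / 2
      \<le> (1 / 2 * (h' x)\<^sup>2 - 1 / 2 * (h' x - \<theta> x)\<^sup>2 - 1 / (2 * K) * (\<theta>' x)\<^sup>2) + (\<theta>' x - V' x * \<theta> x)" for x
  proof -
    define r where "r = 1 / (2 * K) * (\<theta>' x)\<^sup>2"
    have "r \<le> T' x - 1 - ln (T' x)"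
      using log_gap_quadratic[OF Tpos TK K, of x] by (simp add: r_def \<theta>'_def)
    moreover have "T x = x + \<theta> x" "V' x = h' x + x" by (simp_all add: \<theta>_def h'_def)
    ultimately show ?thesis
      unfolding logT r_def[symmetric] by (simp add: \<theta>'_def power2_eq_square algebra_simps add_divide_distrib)
  qed
  have "E (\<lambda>x. x\<^sup>2 / 2 - V x) + ln (2 * pi) / 2 = E (\<lambda>x. x\<^sup>2 / 2 - V x + ln (2 * pi) / 2)"
    by (simp add: E_add E_const)
  also have "\<dots> \<le> E (\<lambda>x. (1 / 2 * (h' x)\<^sup>2 - 1 / 2 * (h' x - \<theta> x)\<^sup>2 - 1 / (2 * K) * (\<theta>' x)\<^sup>2) + (\<theta>' x - V' x * \<theta> x))"
    by (rule E_mono) (use pw in simp_all)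
  also have "\<dots> = (1 / 2 * E (\<lambda>x. (h' x)\<^sup>2) - 1 / 2 * E (\<lambda>x. (h' x - \<theta> x)\<^sup>2) - 1 / (2 * K) * E (\<lambda>x. (\<theta>' x)\<^sup>2))
      + (E \<theta>' - E (\<lambda>x. V' x * \<theta> x))"
    by (simp add: E_add E_diff E_cmult E_divide del: times_divide_eq_left)
  also have "E (\<lambda>x. V' x * \<theta> x) = E \<theta>'"
    by (rule integration_by_parts[OF d\<theta> c\<theta>']) simp_all
  finally have main: "E (\<lambda>x. x\<^sup>2 / 2 - V x) + ln (2 * pi) / 2 \<le>
    1 / 2 * E (\<lambda>x. (h' x)\<^sup>2) - 1 / 2 * E (\<lambda>x. (h' x - \<theta> x)\<^sup>2) - 1 / (2 * K) * E (\<lambda>x. (\<theta>' x)\<^sup>2)" by simp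
  have vh: "var h' \<le> 2 * E (\<lambda>x. (h' x - \<theta> x)\<^sup>2) + 2 * var \<theta>"
  proof -
    have "var h' \<le> E (\<lambda>x. (h' x - E \<theta>)\<^sup>2)" by (rule var_le) simp
    also have "\<dots> \<le> E (\<lambda>x. 2 * (h' x - \<theta> x)\<^sup>2 + 2 * (\<theta> x - E \<theta>)\<^sup>2)"
    proof (rule E_mono)
      fix x
      show "(h' x - E \<theta>)\<^sup>2 \<le> 2 * (h' x - \<theta> x)\<^sup>2 + 2 * (\<theta> x - E \<theta>)\<^sup>2"
        using zero_le_power2[of "(h' x - \<theta> x) - (\<theta> x - E \<theta>)"]
        by (simp add: power2_eq_square algebra_simps)
    qed simp_all
    also have "\<dots> = 2 * E (\<lambda>x. (h' x - \<theta> x)\<^sup>2) + 2 * var \<theta>"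
      by (simp add: E_add E_cmult var_centered)
    finally show ?thesis .
  qed
  have eh: "E h' = - E (\<lambda>x. x)"
    unfolding h'_def by (simp add: E_diff E_V')
  have vh': "E (\<lambda>x. (h' x)\<^sup>2) = var h' + (E (\<lambda>x. x))\<^sup>2"
    using var_centered[of h' 0] by (simp add: eh)
  have p\<theta>: "\<epsilon> * var \<theta> \<le> E (\<lambda>x. (\<theta>' x)\<^sup>2)" by (rule poincare[OF d\<theta> c\<theta>' b\<theta>'])
  have n1: "0 \<le> E (\<lambda>x. (h' x - \<theta> x)\<^sup>2)" by (rule E_nonneg) simp
  have n2: "0 \<le> var \<theta>" by (rule var_nonneg) simp
  have "c / 2 * var h' \<le> c * E (\<lambda>x. (h' x - \<theta> x)\<^sup>2) + c * var \<theta>"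
    using mult_left_mono[OF vh, of "c / 2"] c by (simp add: algebra_simps)
  also have "c * E (\<lambda>x. (h' x - \<theta> x)\<^sup>2) \<le> 1 / 2 * E (\<lambda>x. (h' x - \<theta> x)\<^sup>2)"
    by (rule mult_right_mono[OF c(2) n1])
  also have "c * var \<theta> \<le> \<epsilon> / (2 * K) * var \<theta>" using c(3) by (intro mult_right_mono n2) (simp add: K_def)
  also have "\<epsilon> / (2 * K) * var \<theta> \<le> 1 / (2 * K) * E (\<lambda>x. (\<theta>' x)\<^sup>2)"
    using p\<theta> K by (simp add: divide_right_mono)
  finally have "c / 2 * var h' \<le> 1 / 2 * E (\<lambda>x. (h' x - \<theta> x)\<^sup>2) + 1 / (2 * K) * E (\<lambda>x. (\<theta>' x)\<^sup>2)" by simp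
  hence "E (\<lambda>x. x\<^sup>2 / 2 - V x) + ln (2 * pi) / 2 \<le> 1 / 2 * E (\<lambda>x. (h' x)\<^sup>2) - c / 2 * var h'"
    using main by linarith
  also have "\<dots> = (1 - c) / 2 * E (\<lambda>x. (h' x)\<^sup>2) + c / 2 * (E (\<lambda>x. x))\<^sup>2"
    unfolding vh' by (simp add: field_simps)
  finally show ?thesis by (simp add: h'_def)
qed

end

section \<open>Uniformly convex potentials in several variables\<close>

definition nsq :: "nat \<Rightarrow> (nat \<Rightarrow> real) \<Rightarrow> real" where "nsq n x = (\<Sum>i<n. (x i)\<^sup>2)"

definition n1 :: "nat \<Rightarrow> (nat \<Rightarrow> real) \<Rightarrow> real" where "n1 n x = (\<Sum>i<n. \<bar>x i\<bar>)"

abbreviation "lin_bdd_n n \<equiv> lin_bdd (lebesgue_n n) (n1 n)"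

abbreviation "quad_bdd_n n \<equiv> quad_bdd (lebesgue_n n) (n1 n)"

lemma nsq_nonneg [simp]: "0 \<le> nsq n x" by (simp add: nsq_def sum_nonneg)

lemma n1_nonneg [simp]: "0 \<le> n1 n x" by (simp add: n1_def sum_nonneg)

lemma abs_n1 [simp]: "\<bar>n1 n x\<bar> = n1 n x" by simp

lemma coord_le_n1: "i < n \<Longrightarrow> \<bar>x i\<bar> \<le> n1 n x"
  unfolding n1_def by (rule member_le_sum) auto

lemma n1_add_le: "n1 n (\<lambda>i. x i + y i) \<le> n1 n x + n1 n y"
  unfolding n1_def sum.distrib[symmetric] by (rule sum_mono) simp

lemma n1_minus_commute: "n1 n (\<lambda>i. x i - y i) = n1 n (\<lambda>i. y i - x i)"
  by (simp add: n1_def abs_minus_commute)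

lemma n1_sq_le: "(n1 n x)\<^sup>2 \<le> real n * nsq n x"
proof -
  have "(\<Sum>i<n. \<bar>x i\<bar>)\<^sup>2 \<le> (\<Sum>i<n. 1\<^sup>2) * (\<Sum>i<n. \<bar>x i\<bar>\<^sup>2)"
    using Cauchy_Schwarz_ineq_sum[of "\<lambda>_. 1" "\<lambda>i. \<bar>x i\<bar>" "{..<n}"] by simp
  thus ?thesis by (simp add: n1_def nsq_def)
qed

lemma space_lebesgue_n [simp]: "space (lebesgue_n n) = {..<n} \<rightarrow>\<^sub>E UNIV"
  by (simp add: lebesgue_n_def space_PiM)

interpretation lborel_product: product_sigma_finite "\<lambda>_::nat. lborel :: real measure"
  by standard

lemma sigma_finite_lebesgue_n: "sigma_finite_measure (lebesgue_n n)"
proof -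
  interpret finite_product_sigma_finite "\<lambda>_. lborel" "{..<n}" by standard simp
  show ?thesis unfolding lebesgue_n_def by (rule sigma_finite_measure_axioms)
qed

lemma measurable_coord [measurable, simp]: "i < n \<Longrightarrow> (\<lambda>x. x i) \<in> borel_measurable (lebesgue_n n)"
  unfolding lebesgue_n_def by measurable

lemma measurable_nsq [measurable]: "nsq n \<in> borel_measurable (lebesgue_n n)"
  unfolding nsq_def[abs_def] by (intro borel_measurable_sum borel_measurable_power measurable_coord) auto

lemma measurable_n1 [measurable]: "n1 n \<in> borel_measurable (lebesgue_n n)"
  unfolding n1_def[abs_def] by (intro borel_measurable_sum borel_measurable_abs measurable_coord) auto

lemma measurable_of_local_lipschitz:
  fixes g :: "(nat \<Rightarrow> real) \<Rightarrow> real"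
  assumes dep: "\<And>x y. (\<And>i. i < n \<Longrightarrow> x i = y i) \<Longrightarrow> g x = g y"
    and lip: "\<And>x. \<exists>C. \<forall>y. n1 n (\<lambda>i. y i - x i) \<le> 1 \<longrightarrow> \<bar>g y - g x\<bar> \<le> C * n1 n (\<lambda>i. y i - x i)"
  shows "g \<in> borel_measurable (lebesgue_n n)"
proof -
  have "continuous_on UNIV g"
    unfolding continuous_on_def
  proof
    fix x :: "nat \<Rightarrow> real"
    obtain C where C: "\<And>y. n1 n (\<lambda>i. y i - x i) \<le> 1 \<Longrightarrow> \<bar>g y - g x\<bar> \<le> C * n1 n (\<lambda>i. y i - x i)"
      using lip by blast
    have "((\<lambda>y. y i) \<longlongrightarrow> x i) (at x)" for i
      using continuous_on_product_coordinates[of i] by (auto simp: continuous_on_def)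
    hence "((\<lambda>y. n1 n (\<lambda>i. y i - x i)) \<longlongrightarrow> (\<Sum>i<n. \<bar>x i - x i\<bar>)) (at x)"
      unfolding n1_def by (intro tendsto_intros)
    hence lim: "((\<lambda>y. n1 n (\<lambda>i. y i - x i)) \<longlongrightarrow> 0) (at x)" by simp
    hence ev: "\<forall>\<^sub>F y in at x. n1 n (\<lambda>i. y i - x i) < 1" by (rule order_tendstoD) simp
    have "((\<lambda>y. C * n1 n (\<lambda>i. y i - x i)) \<longlongrightarrow> 0) (at x)" using tendsto_mult_right_zero[OF lim] .
    hence "((\<lambda>y. g y - g x) \<longlongrightarrow> 0) (at x)"
      by (rule Lim_null_comparison[rotated]) (use ev C in \<open>auto elim!: eventually_mono\<close>)
    thus "(g \<longlongrightarrow> g x) (at x within UNIV)" by (simp add: LIM_zero_iff)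
  qed
  hence g: "g \<in> borel_measurable borel" by (rule borel_measurable_continuous_onI)
  have "(\<lambda>x i. if i < n then x i else 0) \<in> borel_measurable (lebesgue_n n)"
  proof (rule measurable_coordinatewise_then_product)
    show "(\<lambda>x. if i < n then x i else 0) \<in> borel_measurable (lebesgue_n n)" for i
      by (cases "i < n") auto
  qed
  from measurable_compose[OF this g] have "(\<lambda>x. g (\<lambda>i. if i < n then x i else 0)) \<in> borel_measurable (lebesgue_n n)" .
  moreover have "(\<lambda>x. g (\<lambda>i. if i < n then x i else 0)) = g" by (intro ext dep) simp
  ultimately show ?thesis by simp
qed

lemma integrable_exp_neg_nsq:
  assumes "b > 0" shows "integrable (lebesgue_n n) (\<lambda>x. exp (- b * nsq n x))"
proof -
  have "integrable (lebesgue_n n) (\<lambda>x. \<Prod>i<n. exp (- b * (x i)\<^sup>2))"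
    unfolding lebesgue_n_def
    by (rule lborel_product.product_integrable_prod) (use assms integrable_exp_neg_sq in auto)
  moreover have "exp (- b * nsq n x) = (\<Prod>i<n. exp (- b * (x i)\<^sup>2))" for x
    unfolding nsq_def sum_distrib_left by (simp add: exp_sum del: mult_minus_left)
  ultimately show ?thesis by simp
qed

lemma fun_upd_measurable [measurable]:
  "(\<lambda>(x, y). y(n := x)) \<in> measurable (lborel \<Otimes>\<^sub>M lebesgue_n n) (lebesgue_n (Suc n))"
  unfolding lebesgue_n_def lessThan_Suc by measurable

lemma distr_fun_upd:
  "distr (lborel \<Otimes>\<^sub>M lebesgue_n n) (lebesgue_n (Suc n)) (\<lambda>(x, y). y(n := x)) = lebesgue_n (Suc n)"
proof (rule measure_eqI)
  interpret Y: sigma_finite_measure "lebesgue_n n" by (rule sigma_finite_lebesgue_n)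
  fix A assume "A \<in> sets (distr (lborel \<Otimes>\<^sub>M lebesgue_n n) (lebesgue_n (Suc n)) (\<lambda>(x, y). y(n := x)))"
  hence A [measurable]: "A \<in> sets (lebesgue_n (Suc n))" by simp
  have A': "A \<in> sets (Pi\<^sub>M (insert n {..<n}) (\<lambda>_. lborel))"
    using A by (simp add: lebesgue_n_def lessThan_Suc)
  have "emeasure (distr (lborel \<Otimes>\<^sub>M lebesgue_n n) (lebesgue_n (Suc n)) (\<lambda>(x, y). y(n := x))) A =
      (\<integral>\<^sup>+ z. indicator A z \<partial>distr (lborel \<Otimes>\<^sub>M lebesgue_n n) (lebesgue_n (Suc n)) (\<lambda>(x, y). y(n := x)))"
    by simp
  also have "\<dots> = (\<integral>\<^sup>+ p. indicator A (case p of (x, y) \<Rightarrow> y(n := x)) \<partial>(lborel \<Otimes>\<^sub>M lebesgue_n n))"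
    by (rule nn_integral_distr) auto
  also have "\<dots> = (\<integral>\<^sup>+ x. \<integral>\<^sup>+ y. indicator A (y(n := x)) \<partial>lebesgue_n n \<partial>lborel)"
    by (subst Y.nn_integral_fst[symmetric]) auto
  also have "\<dots> = (\<integral>\<^sup>+ z. indicator A z \<partial>Pi\<^sub>M (insert n {..<n}) (\<lambda>_. lborel))"
    unfolding lebesgue_n_def
    by (rule lborel_product.product_nn_integral_insert_rev[symmetric]) (use A' in auto)
  also have "\<dots> = emeasure (lebesgue_n (Suc n)) A"
    using A' by (simp add: lebesgue_n_def lessThan_Suc)
  finally show "emeasure (distr (lborel \<Otimes>\<^sub>M lebesgue_n n) (lebesgue_n (Suc n)) (\<lambda>(x, y). y(n := x))) A =
    emeasure (lebesgue_n (Suc n)) A" .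
qed simp

lemma measurable_section:
  assumes "g \<in> borel_measurable (lebesgue_n (Suc n))"
  shows "(\<lambda>y. g (y(n := x))) \<in> borel_measurable (lebesgue_n n)"
  using measurable_compose[OF measurable_Pair2[OF fun_upd_measurable, of x] assms] by simp

lemma lebesgue_n_Fubini:
  fixes g :: "(nat \<Rightarrow> real) \<Rightarrow> real"
  assumes g: "integrable (lebesgue_n (Suc n)) g"
  shows "(LINT z|lebesgue_n (Suc n). g z) = (LINT x|lborel. LINT y|lebesgue_n n. g (y(n := x)))"
    "integrable lborel (\<lambda>x. LINT y|lebesgue_n n. g (y(n := x)))"
proof -
  interpret Y: sigma_finite_measure "lebesgue_n n" by (rule sigma_finite_lebesgue_n)
  interpret P: pair_sigma_finite lborel "lebesgue_n n" ..
  have gm: "g \<in> borel_measurable (lebesgue_n (Suc n))" using g by auto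
  have i: "integrable (lborel \<Otimes>\<^sub>M lebesgue_n n) (\<lambda>p. g (case p of (x, y) \<Rightarrow> y(n := x)))"
    using integrable_distr[OF fun_upd_measurable, of n g] g by (simp add: distr_fun_upd)
  hence i': "integrable (lborel \<Otimes>\<^sub>M lebesgue_n n) (\<lambda>(x, y). g (y(n := x)))"
    by (simp add: case_prod_unfold)
  show "integrable lborel (\<lambda>x. LINT y|lebesgue_n n. g (y(n := x)))"
    using P.integrable_fst[OF i'] .
  have "(LINT z|lebesgue_n (Suc n). g z) = (LINT p|(lborel \<Otimes>\<^sub>M lebesgue_n n). g (case p of (x, y) \<Rightarrow> y(n := x)))"
    by (subst distr_fun_upd[symmetric], rule integral_distr[OF fun_upd_measurable gm])
  also have "\<dots> = (LINT x|lborel. LINT y|lebesgue_n n. g (y(n := x)))"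
    using P.integral_fst[OF i'] by (simp add: case_prod_unfold)
  finally show "(LINT z|lebesgue_n (Suc n). g z) = (LINT x|lborel. LINT y|lebesgue_n n. g (y(n := x)))" .
qed

locale potential =
  fixes n :: nat and \<epsilon> \<Lambda> L :: real and V :: "(nat \<Rightarrow> real) \<Rightarrow> real" and D :: "nat \<Rightarrow> (nat \<Rightarrow> real) \<Rightarrow> real"
  assumes eps_pos: "\<epsilon> > 0" and L_nonneg: "L \<ge> 0"
    and V_cong: "\<And>x y. (\<And>i. i < n \<Longrightarrow> x i = y i) \<Longrightarrow> V x = V y"
    and D_cong: "\<And>j x y. j < n \<Longrightarrow> (\<And>i. i < n \<Longrightarrow> x i = y i) \<Longrightarrow> D j x = D j y"
    and V_deriv: "\<And>i x. i < n \<Longrightarrow> ((\<lambda>t. V (x(i := t))) has_real_derivative D i x) (at (x i))"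
    and D_lipschitz: "\<And>i x y. i < n \<Longrightarrow> \<bar>D i x - D i y\<bar> \<le> L * n1 n (\<lambda>j. x j - y j)"
    and V_convex: "\<And>s x y. 0 \<le> s \<Longrightarrow> s \<le> 1 \<Longrightarrow> V (\<lambda>i. (1 - s) * x i + s * y i)
      \<le> (1 - s) * V x + s * V y - \<epsilon> * s * (1 - s) / 2 * nsq n (\<lambda>i. x i - y i)"
    and D_upper: "\<And>i x s t. i < n \<Longrightarrow> s \<le> t \<Longrightarrow> D i (x(i := t)) - D i (x(i := s)) \<le> \<Lambda> * (t - s)"

lemma taylor_of_lipschitz_partials:
  fixes V :: "(nat \<Rightarrow> real) \<Rightarrow> real" and D :: "nat \<Rightarrow> (nat \<Rightarrow> real) \<Rightarrow> real"
  assumes L: "L \<ge> 0" 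
    and V_cong: "\<And>x y. (\<And>i. i < n \<Longrightarrow> x i = y i) \<Longrightarrow> V x = V y"
    and V_deriv: "\<And>i x. i < n \<Longrightarrow> ((\<lambda>t. V (x(i := t))) has_real_derivative D i x) (at (x i))"
    and D_lip: "\<And>i x y. i < n \<Longrightarrow> \<bar>D i x - D i y\<bar> \<le> L * n1 n (\<lambda>j. x j - y j)"
  shows "\<bar>V (\<lambda>i. x i + w i) - V x - (\<Sum>i<n. D i x * w i)\<bar> \<le> L * (n1 n w)\<^sup>2"
proof -
  define z where "z k = (\<lambda>i. if i < k then x i + w i else x i)" for k
  have step: "\<bar>V (z (Suc k)) - V (z k) - D k x * w k\<bar> \<le> (L * n1 n w) * \<bar>w k\<bar>" if k: "k < n" for k
  proof -
    define u where "u t = V ((z k)(k := t)) - D k x * t" for t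
    have du: "(u has_real_derivative (D k ((z k)(k := t)) - D k x)) (at t)" for t
      using V_deriv[OF k, of "(z k)(k := t)"] unfolding u_def
      by (auto intro!: derivative_eq_intros)
    have "norm (u (x k + w k) - u (x k)) \<le> L * n1 n w * norm ((x k + w k) - x k)"
    proof (rule field_differentiable_bound[of "closed_segment (x k) (x k + w k)"])
      fix t assume t: "t \<in> closed_segment (x k) (x k + w k)"
      hence "\<bar>t - x k\<bar> \<le> \<bar>w k\<bar>" by (auto simp: closed_segment_eq_real_ivl split: if_splits)
      hence "n1 n (\<lambda>j. ((z k)(k := t)) j - x j) \<le> n1 n w"
        unfolding n1_def by (intro sum_mono) (auto simp: z_def)
      hence "L * n1 n (\<lambda>j. ((z k)(k := t)) j - x j) \<le> L * n1 n w" using L by (rule mult_left_mono)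
      thus "norm (D k ((z k)(k := t)) - D k x) \<le> L * n1 n w"
        using D_lip[OF k, of "(z k)(k := t)" x] by simp
    qed (auto intro: has_field_derivative_at_within du)
    moreover have "(z k)(k := x k + w k) = z (Suc k)" "(z k)(k := x k) = z k"
      by (auto simp: z_def fun_eq_iff less_Suc_eq)
    ultimately show ?thesis by (simp add: u_def algebra_simps)
  qed
  have "k \<le> n \<Longrightarrow> \<bar>V (z k) - V x - (\<Sum>i<k. D i x * w i)\<bar> \<le> (L * n1 n w) * (\<Sum>i<k. \<bar>w i\<bar>)" for k
  proof (induction k)
    case (Suc k)
    have "\<bar>V (z (Suc k)) - V x - (\<Sum>i<Suc k. D i x * w i)\<bar>
      \<le> \<bar>V (z k) - V x - (\<Sum>i<k. D i x * w i)\<bar> + \<bar>V (z (Suc k)) - V (z k) - D k x * w k\<bar>" by simp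
    also have "\<dots> \<le> (L * n1 n w) * (\<Sum>i<k. \<bar>w i\<bar>) + (L * n1 n w) * \<bar>w k\<bar>"
      using Suc step[of k] by (intro add_mono) auto
    finally show ?case by (simp add: distrib_left)
  qed (simp add: z_def)
  from this[of n] have "\<bar>V (z n) - V x - (\<Sum>i<n. D i x * w i)\<bar> \<le> L * (n1 n w)\<^sup>2"
    by (simp add: n1_def power2_eq_square mult.assoc)
  also have "V (z n) = V (\<lambda>i. x i + w i)" by (rule V_cong) (simp add: z_def)
  finally show ?thesis .
qed

lemma quad_exp_nsq_integrable:
  assumes g: "quad_bdd_n n g" and b: "b > 0"
  shows "integrable (lebesgue_n n) (\<lambda>x. g x * exp (- b * nsq n x))"
proof -
  obtain A where A: "\<And>x. \<bar>g x\<bar> \<le> A * (1 + (n1 n x)\<^sup>2)" using g by (auto simp: quad_bdd_def)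
  have [measurable]: "g \<in> borel_measurable (lebesgue_n n)" using g by (simp add: quad_bdd_def)
  define B where "B = \<bar>A\<bar> * (1 + real n) * (1 + 2 / b)"
  have B: "\<bar>g x * exp (- b * nsq n x)\<bar> \<le> B * exp (- (b / 2) * nsq n x)" for x
  proof -
    have "1 + (n1 n x)\<^sup>2 \<le> (1 + real n) * (1 + nsq n x)"
      using n1_sq_le[of n x] nsq_nonneg[of n x]
      by (simp only: distrib_left distrib_right mult_1_right mult_1_left)
    also have "\<dots> \<le> (1 + real n) * ((1 + 2 / b) * exp (b / 2 * nsq n x))"
      using one_plus_le_exp[of "b / 2" "nsq n x"] b by (intro mult_left_mono) auto
    finally have "\<bar>A\<bar> * (1 + (n1 n x)\<^sup>2) \<le> \<bar>A\<bar> * ((1 + real n) * ((1 + 2 / b) * exp (b / 2 * nsq n x)))"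
      by (rule mult_left_mono) simp
    moreover have "\<bar>g x\<bar> \<le> \<bar>A\<bar> * (1 + (n1 n x)\<^sup>2)"
      by (rule order_trans[OF A mult_right_mono]) auto
    ultimately have "\<bar>g x\<bar> \<le> B * exp (b / 2 * nsq n x)" unfolding B_def mult.assoc by linarith
    hence "\<bar>g x * exp (- b * nsq n x)\<bar> \<le> (B * exp (b / 2 * nsq n x)) * exp (- b * nsq n x)"
      unfolding abs_mult abs_exp_cancel by (intro mult_right_mono) auto
    also have "\<dots> = B * exp (- (b / 2) * nsq n x)"
      by (simp add: mult.assoc exp_add[symmetric] algebra_simps)
    finally show ?thesis .
  qed
  show ?thesis
  proof (rule Bochner_Integration.integrable_bound)
    show "integrable (lebesgue_n n) (\<lambda>x. B * exp (- (b / 2) * nsq n x))"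
      by (intro integrable_mult_right integrable_exp_neg_nsq) (use b in simp)
    show "AE x in lebesgue_n n. norm (g x * exp (- b * nsq n x)) \<le> norm (B * exp (- (b / 2) * nsq n x))"
      unfolding real_norm_def by (intro AE_I2 order_trans[OF B abs_ge_self])
  qed measurable
qed

context potential
begin

lemma taylor: "\<bar>V (\<lambda>i. x i + w i) - V x - (\<Sum>i<n. D i x * w i)\<bar> \<le> L * (n1 n w)\<^sup>2"
proof (rule taylor_of_lipschitz_partials[where V = V and D = D, OF L_nonneg])
  show "V x = V y" if "\<And>i. i < n \<Longrightarrow> x i = y i" for x y using that by (rule V_cong)
qed (rule V_deriv D_lipschitz; assumption)+

lemma D_lin: "i < n \<Longrightarrow> lin_bdd_n n (D i)"
proof (rule lin_bddI)
  assume i: "i < n"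
  show "D i \<in> borel_measurable (lebesgue_n n)"
  proof (rule measurable_of_local_lipschitz)
    show "D i x = D i y" if "\<And>i. i < n \<Longrightarrow> x i = y i" for x y using i that by (rule D_cong)
    show "\<exists>C. \<forall>y. n1 n (\<lambda>i. y i - x i) \<le> 1 \<longrightarrow> \<bar>D i y - D i x\<bar> \<le> C * n1 n (\<lambda>i. y i - x i)" for x
      by (intro exI[of _ L] allI impI D_lipschitz i)
  qed
  fix x
  have "\<bar>D i x\<bar> \<le> \<bar>D i (\<lambda>_. 0)\<bar> + L * n1 n x" using D_lipschitz[OF i, of x "\<lambda>_. 0"] by simp
  also have "\<dots> \<le> (\<bar>D i (\<lambda>_. 0)\<bar> + L) * (1 + \<bar>n1 n x\<bar>)" using L_nonneg by (simp add: algebra_simps)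
  finally show "\<bar>D i x\<bar> \<le> (\<bar>D i (\<lambda>_. 0)\<bar> + L) * (1 + \<bar>n1 n x\<bar>)" .
qed

lemma coord_lin: "i < n \<Longrightarrow> lin_bdd_n n (\<lambda>x. x i)"
proof (rule lin_bddI[of _ _ 1])
  show "\<bar>x i\<bar> \<le> 1 * (1 + \<bar>n1 n x\<bar>)" if "i < n" for x
    using coord_le_n1[OF that, of x] by simp
qed simp

lemma gradient_sum_le: "\<bar>\<Sum>i<n. D i x * w i\<bar> \<le> (\<Sum>i<n. \<bar>D i x\<bar>) * n1 n w"
proof -
  have "\<bar>\<Sum>i<n. D i x * w i\<bar> \<le> (\<Sum>i<n. \<bar>D i x\<bar> * n1 n w)"
    by (rule order_trans[OF sum_abs sum_mono]) (simp add: abs_mult mult_left_mono coord_le_n1)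
  thus ?thesis by (simp add: sum_distrib_right)
qed

lemma V_diff_le: "\<bar>V (\<lambda>i. x i + w i) - V x\<bar> \<le> (\<Sum>i<n. \<bar>D i x\<bar>) * n1 n w + L * (n1 n w)\<^sup>2"
  using taylor[of x w] gradient_sum_le[of x w] by linarith

lemma measurable_V [measurable]: "V \<in> borel_measurable (lebesgue_n n)"
proof (rule measurable_of_local_lipschitz[OF V_cong])
  fix x
  define C where "C = (\<Sum>i<n. \<bar>D i x\<bar>)"
  have "\<bar>V y - V x\<bar> \<le> (C + L) * n1 n (\<lambda>i. y i - x i)" if "n1 n (\<lambda>i. y i - x i) \<le> 1" for y
  proof -
    have "(n1 n (\<lambda>i. y i - x i))\<^sup>2 \<le> n1 n (\<lambda>i. y i - x i)"
      using that n1_nonneg by (simp add: power2_eq_square mult_left_le)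
    hence "L * (n1 n (\<lambda>i. y i - x i))\<^sup>2 \<le> L * n1 n (\<lambda>i. y i - x i)"
      using L_nonneg by (rule mult_left_mono)
    thus ?thesis using V_diff_le[of x "\<lambda>i. y i - x i"] by (simp add: C_def distrib_right)
  qed
  thus "\<exists>C. \<forall>y. n1 n (\<lambda>i. y i - x i) \<le> 1 \<longrightarrow> \<bar>V y - V x\<bar> \<le> C * n1 n (\<lambda>i. y i - x i)"
    by (intro exI[of _ "C + L"] allI impI)
qed

lemma V_quad: "quad_bdd_n n V"
proof (rule quad_bddI)
  fix x
  define C where "C = (\<Sum>i<n. \<bar>D i (\<lambda>_. 0)\<bar>)"
  have C: "C \<ge> 0" by (simp add: C_def sum_nonneg)
  have "n1 n x \<le> 1 + (n1 n x)\<^sup>2"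
    using zero_le_power2[of "n1 n x - 1"] n1_nonneg[of n x]
    unfolding power2_diff power_one mult_1_right by linarith
  hence 1: "C * n1 n x \<le> C * (1 + (n1 n x)\<^sup>2)" using C by (rule mult_left_mono)
  have "\<bar>V x\<bar> \<le> \<bar>V (\<lambda>_. 0)\<bar> + (C * n1 n x + L * (n1 n x)\<^sup>2)"
    using V_diff_le[of "\<lambda>_. 0" x] by (simp add: C_def)
  also have "\<dots> \<le> (\<bar>V (\<lambda>_. 0)\<bar> + C + L) * (1 + (n1 n x)\<^sup>2)"
    using 1 L_nonneg C mult_nonneg_nonneg[OF abs_ge_zero zero_le_power2, of "V (\<lambda>_. 0)" "n1 n x"]
    by (simp only: distrib_left distrib_right mult_1_right)
  finally show "\<bar>V x\<bar> \<le> (\<bar>V (\<lambda>_. 0)\<bar> + C + L) * (1 + (n1 n x)\<^sup>2)" .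
qed simp

lemma V_lower: "V (\<lambda>_. 0) + (\<Sum>i<n. D i (\<lambda>_. 0) * x i) + \<epsilon> / 2 * nsq n x \<le> V x"
proof -
  let ?l = "\<Sum>i<n. D i (\<lambda>_. 0) * x i"
  have "V (\<lambda>_. 0) + ?l - s * (L * (n1 n x)\<^sup>2) + \<epsilon> * (1 - s) / 2 * nsq n x \<le> V x" if s: "0 < s" "s \<le> 1" for s
  proof -
    have "V (\<lambda>i. s * x i) \<le> (1 - s) * V (\<lambda>_. 0) + s * V x - \<epsilon> * s * (1 - s) / 2 * nsq n x"
      using V_convex[of s "\<lambda>_. 0" x] s by (simp add: nsq_def)
    moreover have "V (\<lambda>_. 0) + s * ?l - L * (s\<^sup>2 * (n1 n x)\<^sup>2) \<le> V (\<lambda>i. s * x i)"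
    proof -
      have "n1 n (\<lambda>i. s * x i) = s * n1 n x" using s by (simp add: n1_def abs_mult sum_distrib_left)
      moreover have "(\<Sum>i<n. D i (\<lambda>_. 0) * (s * x i)) = s * ?l" by (simp add: sum_distrib_left mult_ac)
      ultimately show ?thesis using taylor[of "\<lambda>_. 0" "\<lambda>i. s * x i"] by (simp add: power_mult_distrib)
    qed
    ultimately have "s * (V (\<lambda>_. 0) + ?l - s * (L * (n1 n x)\<^sup>2) + \<epsilon> * (1 - s) / 2 * nsq n x) \<le> s * V x"
      by (simp add: algebra_simps power2_eq_square)
    thus ?thesis using s by (simp only: mult_le_cancel_left_pos)
  qed
  hence ev: "\<forall>\<^sub>F s in at_right 0. V (\<lambda>_. 0) + ?l - s * (L * (n1 n x)\<^sup>2) + \<epsilon> * (1 - s) / 2 * nsq n x \<le> V x"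
    by (auto simp: eventually_at_right_field intro!: exI[of _ 1])
  have "((\<lambda>s. V (\<lambda>_. 0) + ?l - s * (L * (n1 n x)\<^sup>2) + \<epsilon> * (1 - s) / 2 * nsq n x) \<longlongrightarrow>
     V (\<lambda>_. 0) + ?l - 0 * (L * (n1 n x)\<^sup>2) + \<epsilon> * (1 - 0) / 2 * nsq n x) (at_right 0)"
    by (intro tendsto_intros) auto
  from tendsto_upperbound[OF this ev] show ?thesis by simp
qed

lemma V_lower_quadratic:
  obtains C where "\<And>x. \<epsilon> / 4 * nsq n x - C \<le> V x"
proof -
  have "\<epsilon> / 4 * nsq n x - ((\<Sum>i<n. (D i (\<lambda>_. 0))\<^sup>2 / \<epsilon>) - V (\<lambda>_. 0)) \<le> V x" for x
  proof -
    have "0 \<le> (\<Sum>i<n. (D i (\<lambda>_. 0) / sqrt \<epsilon> + sqrt \<epsilon> * x i / 2)\<^sup>2)" by (simp add: sum_nonneg)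
    also have "\<dots> = (\<Sum>i<n. (D i (\<lambda>_. 0))\<^sup>2 / \<epsilon> + D i (\<lambda>_. 0) * x i + \<epsilon> / 4 * (x i)\<^sup>2)"
      using eps_pos by (simp add: power2_sum power_mult_distrib power_divide add_ac)
    also have "\<dots> = (\<Sum>i<n. (D i (\<lambda>_. 0))\<^sup>2 / \<epsilon>) + (\<Sum>i<n. D i (\<lambda>_. 0) * x i) + \<epsilon> / 4 * nsq n x"
      by (simp add: sum.distrib sum_distrib_left nsq_def)
    finally show ?thesis using V_lower[of x] by simp
  qed
  thus thesis using that by blast
qed

lemma quad_integrable:
  assumes g: "quad_bdd_n n g"
  shows "integrable (lebesgue_n n) (\<lambda>x. g x * exp (- V x))"
proof -
  obtain C where C: "\<And>x. \<epsilon> / 4 * nsq n x - C \<le> V x" using V_lower_quadratic by blast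
  have [measurable]: "g \<in> borel_measurable (lebesgue_n n)" using g by (simp add: quad_bdd_def)
  show ?thesis
  proof (rule Bochner_Integration.integrable_bound)
    show "integrable (lebesgue_n n) (\<lambda>x. exp C * (g x * exp (- (\<epsilon> / 4) * nsq n x)))"
      by (intro integrable_mult_right quad_exp_nsq_integrable g) (use eps_pos in simp)
    have "exp (- V x) \<le> exp C * exp (- (\<epsilon> / 4) * nsq n x)" for x
      using C[of x] by (simp add: exp_add[symmetric])
    hence "\<bar>g x\<bar> * exp (- V x) \<le> \<bar>g x\<bar> * (exp C * exp (- (\<epsilon> / 4) * nsq n x))" for x
      by (intro mult_left_mono) auto
    thus "AE x in lebesgue_n n. norm (g x * exp (- V x)) \<le> norm (exp C * (g x * exp (- (\<epsilon> / 4) * nsq n x)))"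
      by (intro AE_I2) (simp add: abs_mult mult_ac)
  qed measurable
qed

lemma exp_integrable: "integrable (lebesgue_n n) (\<lambda>x. exp (- V x))"
  using quad_integrable[of "\<lambda>_. 1"] by simp

lemma potential_add_const: "potential n \<epsilon> \<Lambda> L (\<lambda>x. V x + c) D"
proof
  show "V (\<lambda>i. (1 - s) * x i + s * y i) + c
      \<le> (1 - s) * (V x + c) + s * (V y + c) - \<epsilon> * s * (1 - s) / 2 * nsq n (\<lambda>i. x i - y i)"
    if "0 \<le> s" "s \<le> 1" for s x y
    using V_convex[OF that, of x y] by (simp add: algebra_simps)
  show "((\<lambda>t. V (x(i := t)) + c) has_real_derivative D i x) (at (x i))" if "i < n" for i x
    using V_deriv[OF that] by (auto intro!: derivative_eq_intros)
  show "V x + c = V y + c" if "\<And>i. i < n \<Longrightarrow> x i = y i" for x y using V_cong[OF that] by simp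
qed (fact eps_pos L_nonneg D_cong D_lipschitz D_upper)+

lemma potential_tilt: "potential n \<epsilon> \<Lambda> L (\<lambda>x. V x + (\<Sum>i<n. e i * x i)) (\<lambda>i x. D i x + e i)"
proof
  show "V (\<lambda>i. (1 - s) * x i + s * y i) + (\<Sum>i<n. e i * ((1 - s) * x i + s * y i))
      \<le> (1 - s) * (V x + (\<Sum>i<n. e i * x i)) + s * (V y + (\<Sum>i<n. e i * y i))
        - \<epsilon> * s * (1 - s) / 2 * nsq n (\<lambda>i. x i - y i)"
    if "0 \<le> s" "s \<le> 1" for s x y
  proof -
    have "(\<Sum>i<n. e i * ((1 - s) * x i + s * y i)) = (1 - s) * (\<Sum>i<n. e i * x i) + s * (\<Sum>i<n. e i * y i)"
      by (simp add: sum_distrib_left sum.distrib[symmetric] algebra_simps sum_subtractf[symmetric])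
    thus ?thesis using V_convex[OF that, of x y] by (simp add: algebra_simps)
  qed
  show "((\<lambda>t. V (x(i := t)) + (\<Sum>j<n. e j * (x(i := t)) j)) has_real_derivative D i x + e i) (at (x i))"
    if i: "i < n" for i x
  proof -
    have "(\<Sum>j<n. e j * (x(i := t)) j) = e i * t + (\<Sum>j\<in>{..<n} - {i}. e j * x j)" for t
      using i by (subst sum.remove[of _ i]) auto
    thus ?thesis using V_deriv[OF i] by (auto intro!: derivative_eq_intros)
  qed
  show "V x + (\<Sum>i<n. e i * x i) = V y + (\<Sum>i<n. e i * y i)" if "\<And>i. i < n \<Longrightarrow> x i = y i" for x y
    using V_cong[OF that] that by simp
  show "D j x + e j = D j y + e j" if "j < n" "\<And>i. i < n \<Longrightarrow> x i = y i" for j x y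
    using D_cong[OF that] by simp
  show "\<bar>D i x + e i - (D i y + e i)\<bar> \<le> L * n1 n (\<lambda>j. x j - y j)" if "i < n" for i x y
    using D_lipschitz[OF that] by simp
  show "D i (x(i := t)) + e i - (D i (x(i := s)) + e i) \<le> \<Lambda> * (t - s)" if "i < n" "s \<le> t" for i x s t
    using D_upper[OF that, of x] by simp
qed (fact eps_pos L_nonneg)+

end

lemma potential_section:
  assumes "potential (Suc n) \<epsilon> \<Lambda> L V D"
  shows "potential n \<epsilon> \<Lambda> L (\<lambda>y. V (y(n := x))) (\<lambda>i y. D i (y(n := x)))"
proof -
  interpret potential "Suc n" \<epsilon> \<Lambda> L V D by fact
  show ?thesis
  proof
    show "V ((\<lambda>i. (1 - s) * y i + s * z i)(n := x))
      \<le> (1 - s) * V (y(n := x)) + s * V (z(n := x)) - \<epsilon> * s * (1 - s) / 2 * nsq n (\<lambda>i. y i - z i)"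
      if "0 \<le> s" "s \<le> 1" for s y z
    proof -
      have "(\<lambda>i. (1 - s) * y i + s * z i)(n := x) = (\<lambda>i. (1 - s) * (y(n := x)) i + s * (z(n := x)) i)"
        by (auto simp: fun_eq_iff algebra_simps)
      moreover have "nsq (Suc n) (\<lambda>i. (y(n := x)) i - (z(n := x)) i) = nsq n (\<lambda>i. y i - z i)"
        by (simp add: nsq_def)
      ultimately show ?thesis using V_convex[OF that, of "y(n := x)" "z(n := x)"] by simp
    qed
    show "((\<lambda>t. V ((y(i := t))(n := x))) has_real_derivative D i (y(n := x))) (at (y i))" if "i < n" for i y
      using V_deriv[of i "y(n := x)"] that by (simp add: fun_upd_twist)
    show "\<bar>D i (y(n := x)) - D i (z(n := x))\<bar> \<le> L * n1 n (\<lambda>j. y j - z j)" if "i < n" for i y z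
      using D_lipschitz[of i "y(n := x)" "z(n := x)"] that by (simp add: n1_def)
    show "D i ((y(i := t))(n := x)) - D i ((y(i := s))(n := x)) \<le> \<Lambda> * (t - s)" if "i < n" "s \<le> t" for i y s t
      using D_upper[of i s t "y(n := x)"] that by (simp add: fun_upd_twist)
    show "V (y(n := x)) = V (z(n := x))" if "\<And>i. i < n \<Longrightarrow> y i = z i" for y z
      by (rule V_cong) (use that in auto)
    show "D j (y(n := x)) = D j (z(n := x))" if "j < n" "\<And>i. i < n \<Longrightarrow> y i = z i" for j y z
      by (rule D_cong) (use that in auto)
  qed (fact eps_pos L_nonneg)+
qed

section \<open>Differentiation under the integral sign\<close>

lemma isCont_integral_parameter:
  fixes G :: "'a \<Rightarrow> real \<Rightarrow> real"
  assumes c: "\<And>y. isCont (G y) x0" and m: "\<And>x. (\<lambda>y. G y x) \<in> borel_measurable M"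
    and b: "\<And>x y. \<bar>x - x0\<bar> < 1 \<Longrightarrow> \<bar>G y x\<bar> \<le> B y" and iB: "integrable M B"
  shows "isCont (\<lambda>x. LINT y|M. G y x) x0"
  unfolding continuous_at_sequentially comp_def
proof (intro allI impI)
  fix X assume X: "X \<longlonglongrightarrow> x0"
  hence "\<forall>\<^sub>F i in sequentially. dist (X i) x0 < 1" by (rule tendstoD) simp
  then obtain N where N: "\<And>i. i \<ge> N \<Longrightarrow> \<bar>X i - x0\<bar> < 1"
    by (auto simp: eventually_sequentially dist_real_def)
  have X': "(\<lambda>i. X (i + N)) \<longlonglongrightarrow> x0" using X by (rule LIMSEQ_ignore_initial_segment)
  have "(\<lambda>i. LINT y|M. G y (X (i + N))) \<longlonglongrightarrow> (LINT y|M. G y x0)"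
  proof (rule integral_dominated_convergence[where w = B])
    show "AE y in M. (\<lambda>i. G y (X (i + N))) \<longlonglongrightarrow> G y x0"
      using isCont_tendsto_compose[OF c X'] by simp
    show "AE y in M. norm (G y (X (i + N))) \<le> B y" for i using b N[of "i + N"] by simp
  qed (use m iB in auto)
  thus "(\<lambda>i. LINT y|M. G y (X i)) \<longlonglongrightarrow> (LINT y|M. G y x0)" by (rule LIMSEQ_offset)
qed

lemma has_real_derivative_integral_parameter:
  fixes H G :: "'a \<Rightarrow> real \<Rightarrow> real"
  assumes d: "\<And>y x. (H y has_real_derivative G y x) (at x)"
    and iH: "\<And>x. integrable M (\<lambda>y. H y x)" and m: "(\<lambda>y. G y x0) \<in> borel_measurable M"
    and b: "\<And>x y. \<bar>x - x0\<bar> < 1 \<Longrightarrow> \<bar>G y x\<bar> \<le> B y" and iB: "integrable M B"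
  shows "((\<lambda>x. LINT y|M. H y x) has_real_derivative (LINT y|M. G y x0)) (at x0)"
  unfolding DERIV_def tendsto_at_iff_sequentially comp_def
proof (intro allI impI)
  fix X :: "nat \<Rightarrow> real" assume X0: "\<forall>i. X i \<in> UNIV - {0}" and X: "X \<longlonglongrightarrow> 0"
  from X have "\<forall>\<^sub>F i in sequentially. dist (X i) 0 < 1" by (rule tendstoD) simp
  then obtain N where N: "\<And>i. i \<ge> N \<Longrightarrow> \<bar>X i\<bar> < 1"
    by (auto simp: eventually_sequentially)
  define Y where "Y i = X (i + N)" for i
  have Y: "Y \<longlonglongrightarrow> 0" "\<And>i. Y i \<noteq> 0" "\<And>i. \<bar>Y i\<bar> < 1"
    unfolding Y_def[abs_def] using X0 N LIMSEQ_ignore_initial_segment[OF X, of N] by auto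
  have "(\<lambda>i. LINT y|M. (H y (x0 + Y i) - H y x0) / Y i) \<longlonglongrightarrow> (LINT y|M. G y x0)"
  proof (rule integral_dominated_convergence[where w = B])
    show "AE y in M. (\<lambda>i. (H y (x0 + Y i) - H y x0) / Y i) \<longlonglongrightarrow> G y x0"
    proof (rule AE_I2)
      fix y
      have "((\<lambda>h. (H y (x0 + h) - H y x0) / h) \<longlongrightarrow> G y x0) (at 0)" using d[of y x0] by (simp add: DERIV_def)
      thus "(\<lambda>i. (H y (x0 + Y i) - H y x0) / Y i) \<longlonglongrightarrow> G y x0"
        using Y unfolding tendsto_at_iff_sequentially comp_def by auto
    qed
    show "AE y in M. norm ((H y (x0 + Y i) - H y x0) / Y i) \<le> B y" for i
    proof (rule AE_I2)
      fix y
      have "norm (H y (x0 + Y i) - H y x0) \<le> B y * norm ((x0 + Y i) - x0)"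
      proof (rule field_differentiable_bound[of "closed_segment x0 (x0 + Y i)" _ "G y"])
        fix z assume "z \<in> closed_segment x0 (x0 + Y i)"
        hence "\<bar>z - x0\<bar> < 1" using Y(3)[of i] by (auto simp: closed_segment_eq_real_ivl split: if_splits)
        thus "norm (G y z) \<le> B y" using b by simp
      qed (auto intro: has_field_derivative_at_within d)
      thus "norm ((H y (x0 + Y i) - H y x0) / Y i) \<le> B y"
        using Y(2)[of i] by (simp add: divide_le_eq)
    qed
    show "(\<lambda>y. (H y (x0 + Y i) - H y x0) / Y i) \<in> borel_measurable M" for i
      using borel_measurable_integrable[OF iH] by measurable
  qed (use m iB in auto)
  moreover have "(LINT y|M. (H y (x0 + Y i) - H y x0) / Y i)
      = ((LINT y|M. H y (x0 + Y i)) - (LINT y|M. H y x0)) / Y i" for i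
    using iH by simp
  ultimately have "(\<lambda>i. ((LINT y|M. H y (x0 + X (i + N))) - (LINT y|M. H y x0)) / X (i + N)) \<longlonglongrightarrow> (LINT y|M. G y x0)"
    by (simp only: Y_def)
  thus "(\<lambda>i. ((LINT y|M. H y (x0 + X i)) - (LINT y|M. H y x0)) / X i) \<longlonglongrightarrow> (LINT y|M. G y x0)"
    by (rule LIMSEQ_offset)
qed

lemma lebesgue_n_nontrivial: "\<not> (AE x in lebesgue_n n. False)"
proof
  assume "AE x in lebesgue_n n. False"
  hence "emeasure (lebesgue_n n) (space (lebesgue_n n)) = 0"
    using AE_iff_measurable[of "space (lebesgue_n n)" "lebesgue_n n" "\<lambda>_. False"]
    by (simp del: space_lebesgue_n)
  moreover have "emeasure (lebesgue_n n) (\<Pi>\<^sub>E i\<in>{..<n}. {0..1}) = 1"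
    unfolding lebesgue_n_def by (subst lborel_product.emeasure_PiM) auto
  moreover have "emeasure (lebesgue_n n) (\<Pi>\<^sub>E i\<in>{..<n}. {0..1}) \<le> emeasure (lebesgue_n n) (space (lebesgue_n n))"
    by (rule emeasure_mono[OF _ sets.top]) auto
  ultimately show False by simp
qed

lemma (in potential) exp_integral_pos: "0 < (LINT x|lebesgue_n n. exp (- V x))"
proof -
  have "(LINT x|lebesgue_n n. exp (- V x)) \<noteq> 0"
    using integral_nonneg_eq_0_iff_AE[OF exp_integrable] lebesgue_n_nontrivial[of n] by simp
  moreover have "0 \<le> (LINT x|lebesgue_n n. exp (- V x))" by (intro integral_nonneg_AE) simp
  ultimately show ?thesis by linarith
qed

locale sectioned_potential = potential "Suc n" \<epsilon> \<Lambda> L V D for n \<epsilon> \<Lambda> L V D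
begin

definition J :: "((nat \<Rightarrow> real) \<Rightarrow> real) \<Rightarrow> real \<Rightarrow> real" where
  "J g x = (LINT y|lebesgue_n n. g y * exp (- V (y(n := x))))"

abbreviation p :: "real \<Rightarrow> real" where "p \<equiv> J (\<lambda>_. 1)"

sublocale section_pot: potential n \<epsilon> \<Lambda> L "\<lambda>y. V (y(n := x))" "\<lambda>i y. D i (y(n := x))" for x
  by (rule potential_section) (rule potential_axioms)

lemma D_section_lin: "i < Suc n \<Longrightarrow> lin_bdd_n n (\<lambda>y. D i (y(n := x)))"
proof -
  assume i: "i < Suc n"
  obtain A where A: "\<And>z. \<bar>D i z\<bar> \<le> A * (1 + \<bar>n1 (Suc n) z\<bar>)" and m: "D i \<in> borel_measurable (lebesgue_n (Suc n))"
    using D_lin[OF i] by (auto simp: lin_bdd_def)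
  have "\<bar>D i (y(n := x))\<bar> \<le> (\<bar>A\<bar> * (1 + \<bar>x\<bar>)) * (1 + \<bar>n1 n y\<bar>)" for y
  proof -
    have "n1 (Suc n) (y(n := x)) = n1 n y + \<bar>x\<bar>" by (simp add: n1_def)
    hence "\<bar>D i (y(n := x))\<bar> \<le> A * (1 + (n1 n y + \<bar>x\<bar>))" using A[of "y(n := x)"] by simp
    also have "\<dots> \<le> \<bar>A\<bar> * (1 + (n1 n y + \<bar>x\<bar>))" by (intro mult_right_mono) auto
    also have "\<dots> \<le> \<bar>A\<bar> * ((1 + \<bar>x\<bar>) * (1 + \<bar>n1 n y\<bar>))"
      by (intro mult_left_mono) (simp_all add: algebra_simps)
    finally show ?thesis by (simp add: mult.assoc)
  qed
  thus ?thesis by (intro lin_bddI measurable_section m)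
qed

lemma Dn_continuous: "isCont (\<lambda>x. D n (y(n := x))) x0"
proof -
  have "L-lipschitz_on UNIV (\<lambda>x. D n (y(n := x)))"
    using L_nonneg D_lipschitz[of n "y(n := _)" "y(n := _)"]
    by (auto simp: lipschitz_on_def dist_real_def n1_def)
  thus ?thesis using lipschitz_on_continuous_on continuous_on_eq_continuous_at open_UNIV by blast
qed

lemma V_section_deriv: "((\<lambda>x. V (y(n := x))) has_real_derivative D n (y(n := x))) (at x)"
  using V_deriv[of n "y(n := x)"] by simp

lemma locally_dominated:
  assumes g: "lin_bdd_n n g"
  obtains B where "integrable (lebesgue_n n) B"
    "\<And>x y. \<bar>x - x0\<bar> < 1 \<Longrightarrow> \<bar>g y * D n (y(n := x)) * exp (- V (y(n := x)))\<bar> \<le> B y"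
proof -
  obtain C where C: "\<And>z. \<epsilon> / 4 * nsq (Suc n) z - C \<le> V z" using V_lower_quadratic by blast
  define B where "B y = (\<bar>g y\<bar> * (\<bar>D n (y(n := x0))\<bar> + L + 1) * exp C) * exp (- (\<epsilon> / 4) * nsq n y)" for y
  have lin_abs: "lin_bdd_n n (\<lambda>y. \<bar>h y\<bar>)" if "lin_bdd_n n h" for h
    using that unfolding lin_bdd_def by auto
  have iB: "integrable (lebesgue_n n) B"
    unfolding B_def
  proof (rule quad_exp_nsq_integrable)
    have "quad_bdd_n n (\<lambda>y. exp C * (\<bar>g y\<bar> * (\<bar>D n (y(n := x0))\<bar> + L + 1)))"
      by (intro quad_bdd_cmult quad_bdd_mult lin_bdd_add lin_abs D_section_lin g lin_bdd_const) simp
    thus "quad_bdd_n n (\<lambda>y. \<bar>g y\<bar> * (\<bar>D n (y(n := x0))\<bar> + L + 1) * exp C)"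
      by (simp only: mult.commute)
  qed (use eps_pos in simp)
  have e: "exp (- V (y(n := x))) \<le> exp C * exp (- (\<epsilon> / 4) * nsq n y)" for x y
  proof -
    have "nsq n y \<le> nsq (Suc n) (y(n := x))" by (simp add: nsq_def)
    hence "\<epsilon> / 4 * nsq n y \<le> \<epsilon> / 4 * nsq (Suc n) (y(n := x))" using eps_pos by (intro mult_left_mono) auto
    thus ?thesis using C[of "y(n := x)"] by (simp add: exp_add[symmetric])
  qed
  have dom: "\<bar>g y * h * exp (- V (y(n := x)))\<bar> \<le> B y" if "\<bar>h\<bar> \<le> \<bar>D n (y(n := x0))\<bar> + L + 1" for x y h
  proof -
    have "\<bar>g y * h * exp (- V (y(n := x)))\<bar> \<le> (\<bar>g y\<bar> * (\<bar>D n (y(n := x0))\<bar> + L + 1)) * (exp C * exp (- (\<epsilon> / 4) * nsq n y))"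
      unfolding abs_mult abs_exp_cancel using that e L_nonneg by (intro mult_mono) auto
    thus ?thesis by (simp add: B_def mult_ac)
  qed
  have 1: "\<bar>g y * D n (y(n := x)) * exp (- V (y(n := x)))\<bar> \<le> B y" if x: "\<bar>x - x0\<bar> < 1" for x y
  proof (rule dom)
    have "\<bar>D n (y(n := x)) - D n (y(n := x0))\<bar> \<le> L * \<bar>x - x0\<bar>"
      using D_lipschitz[of n "y(n := x)" "y(n := x0)"] by (simp add: n1_def)
    also have "\<dots> \<le> L * 1" using x L_nonneg by (intro mult_left_mono) auto
    finally show "\<bar>D n (y(n := x))\<bar> \<le> \<bar>D n (y(n := x0))\<bar> + L + 1" by linarith
  qed
  show thesis using that[OF iB 1] .
qed

lemma measurable_integrand:
  assumes "g \<in> borel_measurable (lebesgue_n n)"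
  shows "(\<lambda>y. g y * D n (y(n := x)) * exp (- V (y(n := x)))) \<in> borel_measurable (lebesgue_n n)"
  using assms D_section_lin[of n x] section_pot.measurable_V[of x]
  by (intro borel_measurable_times measurable_compose[OF _ borel_measurable_exp] borel_measurable_uminus)
     (auto simp: lin_bdd_def)

lemma quad_section_integrable:
  "quad_bdd_n n g \<Longrightarrow> integrable (lebesgue_n n) (\<lambda>y. g y * exp (- V (y(n := x))))"
  by (rule section_pot.quad_integrable)

lemma J_deriv:
  assumes g: "lin_bdd_n n g"
  shows "(J g has_real_derivative - J (\<lambda>y. g y * D n (y(n := x))) x) (at x)"
proof -
  obtain B where iB: "integrable (lebesgue_n n) B"
    and B: "\<And>t y. \<bar>t - x\<bar> < 1 \<Longrightarrow> \<bar>g y * D n (y(n := t)) * exp (- V (y(n := t)))\<bar> \<le> B y"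
    by (rule locally_dominated[OF g, of x]) (rule that)
  have [measurable]: "g \<in> borel_measurable (lebesgue_n n)" using g by (simp add: lin_bdd_def)
  have "((\<lambda>x. LINT y|lebesgue_n n. g y * exp (- V (y(n := x)))) has_real_derivative
      (LINT y|lebesgue_n n. - (g y * D n (y(n := x)) * exp (- V (y(n := x)))))) (at x)"
  proof (rule has_real_derivative_integral_parameter[OF _ _ _ _ iB])
    show "((\<lambda>x. g y * exp (- V (y(n := x)))) has_real_derivative - (g y * D n (y(n := t)) * exp (- V (y(n := t))))) (at t)" for y t
      using DERIV_cmult[OF DERIV_fun_exp[OF DERIV_minus[OF V_section_deriv]], of "g y" y t] by (simp add: mult_ac)
    show "integrable (lebesgue_n n) (\<lambda>y. g y * exp (- V (y(n := t))))" for t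
      by (rule quad_section_integrable[OF quad_bdd_lin[OF g]])
    show "(\<lambda>y. - (g y * D n (y(n := x)) * exp (- V (y(n := x))))) \<in> borel_measurable (lebesgue_n n)"
      by (intro borel_measurable_uminus measurable_integrand) measurable
    show "\<bar>- (g y * D n (y(n := t)) * exp (- V (y(n := t))))\<bar> \<le> B y" if "\<bar>t - x\<bar> < 1" for t y
      using B[OF that, of y] by simp
  qed
  thus ?thesis unfolding J_def[abs_def] by simp
qed

lemma J_continuous:
  assumes g: "lin_bdd_n n g"
  shows "isCont (\<lambda>x. J (\<lambda>y. g y * D n (y(n := x))) x) x0"
proof -
  obtain B where iB: "integrable (lebesgue_n n) B"
    and B: "\<And>t y. \<bar>t - x0\<bar> < 1 \<Longrightarrow> \<bar>g y * D n (y(n := t)) * exp (- V (y(n := t)))\<bar> \<le> B y"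
    by (rule locally_dominated[OF g, of x0]) (rule that)
  have [measurable]: "g \<in> borel_measurable (lebesgue_n n)" using g by (simp add: lin_bdd_def)
  show ?thesis
    unfolding J_def
  proof (rule isCont_integral_parameter[OF _ _ B iB])
    show "isCont (\<lambda>x. g y * D n (y(n := x)) * exp (- V (y(n := x)))) x0" for y
      by (intro continuous_intros Dn_continuous DERIV_isCont[OF V_section_deriv])
    show "(\<lambda>y. g y * D n (y(n := x)) * exp (- V (y(n := x)))) \<in> borel_measurable (lebesgue_n n)" for x
      by (rule measurable_integrand) measurable
  qed
qed

lemma p_pos: "0 < p x"
  unfolding J_def using section_pot.exp_integral_pos[of x] by simp

lemma p_continuous: "continuous_on A p"
  by (intro continuous_at_imp_continuous_on ballI DERIV_isCont[OF J_deriv[OF lin_bdd_const]])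

lemma J_integrable: "quad_bdd_n (Suc n) g \<Longrightarrow> integrable lborel (\<lambda>x. J (\<lambda>y. g (y(n := x))) x)"
  unfolding J_def using lebesgue_n_Fubini(2)[OF quad_integrable] by simp

lemma J_Fubini: "quad_bdd_n (Suc n) g \<Longrightarrow>
    (LINT z|lebesgue_n (Suc n). g z * exp (- V z)) = (LINT x|lborel. J (\<lambda>y. g (y(n := x))) x)"
  unfolding J_def using lebesgue_n_Fubini(1)[OF quad_integrable] by simp

end

theorem prekopa_potential:
  assumes "potential n \<epsilon>1 \<Lambda>1 L1 a Da" "potential n \<epsilon>2 \<Lambda>2 L2 b Db" "potential n \<epsilon>3 \<Lambda>3 L3 c Dc"
    and s: "0 \<le> s" "s \<le> 1"
    and le: "\<And>x y. c (\<lambda>i. (1 - s) * x i + s * y i) \<le> (1 - s) * a x + s * b y"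
  shows "(1 - s) * ln (LINT x|lebesgue_n n. exp (- a x)) + s * ln (LINT x|lebesgue_n n. exp (- b x))
    \<le> ln (LINT x|lebesgue_n n. exp (- c x))"
  using assms(1-3) le
proof (induction n arbitrary: a b c Da Db Dc)
  case 0
  interpret c: potential 0 \<epsilon>3 \<Lambda>3 L3 c Dc by fact
  have "(LINT x|lebesgue_n 0. exp (- f x)) = exp (- f (\<lambda>_. undefined))" for f :: "(nat \<Rightarrow> real) \<Rightarrow> real"
    by (simp add: lebesgue_n_def PiM_empty lebesgue_integral_count_space_finite)
  moreover have "c (\<lambda>i. (1 - s) * undefined + s * undefined) = c (\<lambda>_. undefined)"
    by (rule c.V_cong) simp
  ultimately show ?case using "0.prems"(4)[of "\<lambda>_. undefined" "\<lambda>_. undefined"] by simp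
next
  case (Suc n)
  interpret a: sectioned_potential n \<epsilon>1 \<Lambda>1 L1 a Da using Suc.prems(1) by (simp add: sectioned_potential_def)
  interpret b: sectioned_potential n \<epsilon>2 \<Lambda>2 L2 b Db using Suc.prems(2) by (simp add: sectioned_potential_def)
  interpret c: sectioned_potential n \<epsilon>3 \<Lambda>3 L3 c Dc using Suc.prems(3) by (simp add: sectioned_potential_def)
  have sec: "(1 - s) * ln (a.p t) + s * ln (b.p t') \<le> ln (c.p ((1 - s) * t + s * t'))" for t t'
  proof -
    have "c ((\<lambda>i. (1 - s) * x i + s * y i)(n := (1 - s) * t + s * t')) \<le> (1 - s) * a (x(n := t)) + s * b (y(n := t'))" for x y
    proof -
      have "(\<lambda>i. (1 - s) * x i + s * y i)(n := (1 - s) * t + s * t') =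
          (\<lambda>i. (1 - s) * (x(n := t)) i + s * (y(n := t')) i)" by auto
      thus ?thesis using Suc.prems(4)[of "x(n := t)" "y(n := t')"] by (simp only:)
    qed
    from Suc.IH[OF a.section_pot.potential_axioms b.section_pot.potential_axioms c.section_pot.potential_axioms this]
    show ?thesis by (simp only: a.J_def b.J_def c.J_def mult_1_left)
  qed
  have e: "exp (- (- ln (a.p t))) = a.p t" "exp (- (- ln (b.p t))) = b.p t" "exp (- (- ln (c.p t))) = c.p t" for t
    using a.p_pos b.p_pos c.p_pos by simp_all
  have F: "(LINT x|lebesgue_n (Suc n). exp (- a x)) = (LINT t|lborel. a.p t)"
      "(LINT x|lebesgue_n (Suc n). exp (- b x)) = (LINT t|lborel. b.p t)"
      "(LINT x|lebesgue_n (Suc n). exp (- c x)) = (LINT t|lborel. c.p t)"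
    using a.J_Fubini[of "\<lambda>_. 1"] b.J_Fubini[of "\<lambda>_. 1"] c.J_Fubini[of "\<lambda>_. 1"] by simp_all
  have pos: "a.p t \<noteq> 0" "b.p t \<noteq> 0" "c.p t \<noteq> 0" for t
    using a.p_pos[of t] b.p_pos[of t] c.p_pos[of t] by simp_all
  show ?case
    unfolding F
    by (rule prekopa_leindler_real[of "\<lambda>t. - ln (a.p t)" "\<lambda>t. - ln (b.p t)" "\<lambda>t. - ln (c.p t)" s, unfolded e])
       (use s sec a.J_integrable[of "\<lambda>_. 1"] b.J_integrable[of "\<lambda>_. 1"] c.J_integrable[of "\<lambda>_. 1"] in
         \<open>auto intro!: continuous_intros a.p_continuous b.p_continuous c.p_continuous simp: pos algebra_simps\<close>)
qed

section \<open>Variances of linear functions\<close>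

locale normalized_potential = potential +
  assumes mass: "(LINT x|lebesgue_n n. exp (- V x)) = 1"
begin

sublocale quad_weight "lebesgue_n n" "n1 n" "\<lambda>x. exp (- V x)"
  by standard (auto simp: quad_integrable mass)

lemma linear_lin: "lin_bdd_n n (\<lambda>x. \<Sum>i<n. e i * x i)"
  by (intro lin_bdd_sum lin_bdd_cmult coord_lin) simp

lemma exp_moments_product:
  "ln (LINT x|lebesgue_n n. exp ((\<Sum>i<n. e i * x i) - V x)) + ln (LINT x|lebesgue_n n. exp (- (\<Sum>i<n. e i * x i) - V x))
    \<le> (\<Sum>i<n. (e i)\<^sup>2) / \<epsilon>"
proof -
  define k where "k = (\<Sum>i<n. (e i)\<^sup>2) / (2 * \<epsilon>)"
  have le: "V (\<lambda>i. (1 - 1 / 2) * x i + 1 / 2 * y i) + - k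
      \<le> (1 - 1 / 2) * (V x + (\<Sum>i<n. - e i * x i)) + 1 / 2 * (V y + (\<Sum>i<n. e i * y i))" for x y
  proof -
    have "0 \<le> (\<Sum>i<n. (e i / sqrt (2 * \<epsilon>) - sqrt (2 * \<epsilon>) / 4 * (x i - y i))\<^sup>2)" by (simp add: sum_nonneg)
    also have "\<dots> = (\<Sum>i<n. (e i)\<^sup>2 / (2 * \<epsilon>) - 1 / 2 * e i * (x i - y i) + \<epsilon> / 8 * (x i - y i)\<^sup>2)"
      using eps_pos by (intro sum.cong refl) (simp add: power2_diff power_mult_distrib power_divide)
    also have "\<dots> = k - 1 / 2 * (\<Sum>i<n. e i * x i) + 1 / 2 * (\<Sum>i<n. e i * y i) + \<epsilon> / 8 * nsq n (\<lambda>i. x i - y i)"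
      by (simp add: k_def nsq_def sum.distrib sum_subtractf sum_distrib_left sum_divide_distrib diff_divide_distrib algebra_simps)
    finally show ?thesis using V_convex[of "1 / 2" x y]
      by (simp add: sum_negf diff_divide_distrib add_divide_distrib)
  qed
  have "(1 - 1 / 2) * ln (LINT x|lebesgue_n n. exp (- (V x + (\<Sum>i<n. - e i * x i))))
      + 1 / 2 * ln (LINT x|lebesgue_n n. exp (- (V x + (\<Sum>i<n. e i * x i))))
      \<le> ln (LINT x|lebesgue_n n. exp (- (V x + - k)))"
    by (rule prekopa_potential[OF potential_tilt potential_tilt potential_add_const]) (use le in auto)
  also have "(LINT x|lebesgue_n n. exp (- (V x + - k))) = exp k"
  proof -
    have "exp (- (V x + - k)) = exp k * exp (- V x)" for x by (simp add: exp_add[symmetric])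
    thus ?thesis by (simp add: mass)
  qed
  finally have "1 / 2 * ln (LINT x|lebesgue_n n. exp ((\<Sum>i<n. e i * x i) - V x))
      + 1 / 2 * ln (LINT x|lebesgue_n n. exp (- (\<Sum>i<n. e i * x i) - V x)) \<le> k"
    by (simp add: sum_negf minus_diff_commute)
  moreover have "(\<Sum>i<n. (e i)\<^sup>2) / \<epsilon> = 2 * k" by (simp add: k_def)
  ultimately show ?thesis by linarith
qed

lemma exp_sum_ge: "2 + u\<^sup>2 / 2 \<le> exp u + exp (- u)" for u :: real
proof -
  have "2 + u\<^sup>2 / 2 \<le> exp u + exp (- u)" if "u \<ge> 0" for u :: real
    using exp_lower_Taylor_quadratic[OF that] exp_ge_add_one_self[of "- u"] by simp
  from this[of "\<bar>u\<bar>"] show ?thesis by (cases "u \<ge> 0") (auto simp: add.commute)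
qed

lemma var_linear_le_exp:
  "var (\<lambda>x. \<Sum>i<n. e i * x i) \<le> 4 * (exp ((\<Sum>i<n. (e i)\<^sup>2) / \<epsilon>) - 1)"
proof -
  define Y where "Y x = (\<Sum>i<n. e i * x i)" for x
  define m where "m = E Y"
  define K where "K = exp ((\<Sum>i<n. (e i)\<^sup>2) / \<epsilon>)"
  define a where "a = (LINT x|lebesgue_n n. exp (Y x - m) * exp (- V x))"
  define b where "b = (LINT x|lebesgue_n n. exp (- (Y x - m)) * exp (- V x))"
  have Ylin [simp]: "lin_bdd_n n Y" unfolding Y_def by (rule linear_lin)
  have iY: "integrable (lebesgue_n n) (\<lambda>x. exp (Y x - V x))" "integrable (lebesgue_n n) (\<lambda>x. exp (- Y x - V x))"
    using potential.exp_integrable[OF potential_tilt[of "\<lambda>i. - e i"]]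
      potential.exp_integrable[OF potential_tilt[of e]] by (simp_all add: Y_def sum_negf minus_diff_commute)
  have split: "exp (Y x - m) * exp (- V x) = exp (- m) * exp (Y x - V x)"
      "exp (- (Y x - m)) * exp (- V x) = exp m * exp (- Y x - V x)" for x
    by (simp_all add: exp_add[symmetric] algebra_simps)
  have i: "integrable (lebesgue_n n) (\<lambda>x. exp (Y x - m) * exp (- V x))"
      "integrable (lebesgue_n n) (\<lambda>x. exp (- (Y x - m)) * exp (- V x))"
    unfolding split using iY by auto
  have quad: "integrable (lebesgue_n n) (\<lambda>x. g x * exp (- V x))" if "quad_bdd_n n g" for g
    using quad_integrable[OF that] .
  have a: "1 \<le> a"
  proof -
    have "1 = E (\<lambda>x. 1 + (Y x - m))" by (simp add: E_add E_diff E_const m_def)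
    also have "\<dots> \<le> a" unfolding E_def a_def
      by (intro integral_mono quad i mult_right_mono exp_ge_add_one_self) auto
    finally show ?thesis .
  qed
  have b: "1 \<le> b"
  proof -
    have "1 = E (\<lambda>x. 1 + (- (Y x - m)))" by (simp add: E_add E_diff E_minus E_const m_def)
    also have "\<dots> \<le> b" unfolding E_def b_def
      by (intro integral_mono quad i mult_right_mono exp_ge_add_one_self) auto
    finally show ?thesis .
  qed
  have ab: "a * b \<le> K"
  proof -
    define A B where "A = (LINT x|lebesgue_n n. exp (Y x - V x))" and "B = (LINT x|lebesgue_n n. exp (- Y x - V x))"
    have AB: "a = exp (- m) * A" "b = exp m * B"
      unfolding a_def b_def A_def B_def split by simp_all
    have "a * b = (exp (- m) * exp m) * (A * B)" unfolding AB by (simp only: mult_ac)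
    hence "a * b = A * B" by (simp add: exp_add[symmetric])
    moreover have AB0: "A > 0" "B > 0"
    proof -
      have "0 < exp (- m) * A" "0 < exp m * B" using a b AB by linarith+
      thus "A > 0" "B > 0" by (simp_all add: zero_less_mult_iff)
    qed
    moreover have "ln A + ln B \<le> (\<Sum>i<n. (e i)\<^sup>2) / \<epsilon>"
      using exp_moments_product[of e] by (simp add: A_def B_def Y_def)
    moreover have "A * B = exp (ln A + ln B)" using AB0 by (simp add: exp_add)
    ultimately show ?thesis unfolding K_def by simp
  qed
  have "2 + var Y / 2 = E (\<lambda>x. 2 + (Y x - m)\<^sup>2 / 2)"
    by (simp add: E_add E_divide E_const var_centered m_def)
  also have "\<dots> \<le> (LINT x|lebesgue_n n. exp (Y x - m) * exp (- V x) + exp (- (Y x - m)) * exp (- V x))"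
    unfolding E_def
  proof (rule integral_mono)
    show "integrable (lebesgue_n n) (\<lambda>x. (2 + (Y x - m)\<^sup>2 / 2) * exp (- V x))" by (rule quad) simp
    show "integrable (lebesgue_n n) (\<lambda>x. exp (Y x - m) * exp (- V x) + exp (- (Y x - m)) * exp (- V x))"
      by (intro Bochner_Integration.integrable_add i)
    show "(2 + (Y x - m)\<^sup>2 / 2) * exp (- V x) \<le> exp (Y x - m) * exp (- V x) + exp (- (Y x - m)) * exp (- V x)" for x
      unfolding distrib_right[symmetric] by (intro mult_right_mono exp_sum_ge) simp
  qed
  also have "\<dots> = a + b" unfolding a_def b_def by (rule Bochner_Integration.integral_add[OF i])
  finally have 1: "2 + var Y / 2 \<le> a + b" .
  have "a * 1 \<le> a * b" "1 * b \<le> a * b" using a b by (intro mult_mono; simp)+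
  hence "a + b \<le> 2 * K" using ab by simp
  thus ?thesis using 1 unfolding K_def Y_def by simp
qed

lemma var_linear_le: "var (\<lambda>x. \<Sum>i<n. e i * x i) \<le> 8 / \<epsilon> * (\<Sum>i<n. (e i)\<^sup>2)"
proof (cases "(\<Sum>i<n. (e i)\<^sup>2) = 0")
  case True
  hence "e i = 0" if "i < n" for i using that by (simp add: sum_nonneg_eq_0_iff)
  hence "var (\<lambda>x. \<Sum>i<n. e i * x i) = 0" by (simp add: cov_def E_const)
  thus ?thesis using True by simp
next
  case False
  define q where "q = (\<Sum>i<n. (e i)\<^sup>2)"
  have q: "q > 0" using False sum_nonneg[of "{..<n}" "\<lambda>i. (e i)\<^sup>2"] unfolding q_def by simp
  define r where "r = sqrt (\<epsilon> / q)"
  have r: "r\<^sup>2 = \<epsilon> / q" using eps_pos q by (simp add: r_def)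
  have "var (\<lambda>x. \<Sum>i<n. (r * e i) * x i) \<le> 4 * (exp ((\<Sum>i<n. (r * e i)\<^sup>2) / \<epsilon>) - 1)"
    by (rule var_linear_le_exp)
  also have "(\<Sum>i<n. (r * e i)\<^sup>2) = r\<^sup>2 * q" by (simp add: power_mult_distrib sum_distrib_left q_def)
  also have "r\<^sup>2 * q / \<epsilon> = 1" using eps_pos q by (simp add: r)
  also have "4 * (exp 1 - 1) \<le> (8::real)" using exp_le by simp
  also have "var (\<lambda>x. \<Sum>i<n. (r * e i) * x i) = r\<^sup>2 * var (\<lambda>x. \<Sum>i<n. e i * x i)"
    using var_lincomb[OF linear_lin linear_lin, of r e 0 e] by (simp add: sum_distrib_left mult.assoc)
  finally have "\<epsilon> / q * var (\<lambda>x. \<Sum>i<n. e i * x i) \<le> 8" by (simp add: r)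
  thus ?thesis using eps_pos q unfolding q_def[symmetric] by (simp add: field_simps)
qed

lemma sum_cov_coord_sq_le:
  assumes U: "lin_bdd_n n U"
  shows "(\<Sum>i<n. (cov (\<lambda>x. x i) U)\<^sup>2) \<le> 8 / \<epsilon> * var U"
proof -
  define S where "S = (\<Sum>i<n. (cov (\<lambda>x. x i) U)\<^sup>2)"
  have S0: "S \<ge> 0" by (simp add: S_def sum_nonneg)
  define Y where "Y x = (\<Sum>i<n. cov (\<lambda>x. x i) U * x i)" for x :: "nat \<Rightarrow> real"
  have "cov Y U = S"
    unfolding Y_def S_def power2_eq_square by (rule cov_sum_left) (use coord_lin U in auto)
  moreover have "lin_bdd_n n Y" unfolding Y_def[abs_def] by (rule linear_lin)
  ultimately have "S\<^sup>2 \<le> var Y * var U" using cov_sq_le[of Y U] U by simp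
  also have "\<dots> \<le> (8 / \<epsilon> * S) * var U"
    unfolding Y_def S_def by (intro mult_right_mono var_linear_le var_nonneg U)
  finally have "S * S \<le> S * (8 / \<epsilon> * var U)" by (simp add: power2_eq_square mult_ac)
  moreover have "0 \<le> 8 / \<epsilon> * var U" using eps_pos var_nonneg[OF U] by simp
  ultimately have "S \<le> 8 / \<epsilon> * var U"
    using S0 mult_le_cancel_left_pos[of S S "8 / \<epsilon> * var U"] by (cases "S = 0") (simp, linarith)
  thus ?thesis unfolding S_def .
qed

end

section \<open>The improved logarithmic Sobolev inequality\<close>

definition improved_lsi :: "nat \<Rightarrow> real \<Rightarrow> ((nat \<Rightarrow> real) \<Rightarrow> real) \<Rightarrow> (nat \<Rightarrow> (nat \<Rightarrow> real) \<Rightarrow> real) \<Rightarrow> bool" where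
  "improved_lsi n c V D \<longleftrightarrow>
    (LINT x|lebesgue_n n. (nsq n x / 2 - V x) * exp (- V x)) + real n / 2 * ln (2 * pi)
    \<le> (1 - c) / 2 * (\<Sum>i<n. LINT x|lebesgue_n n. (D i x - x i)\<^sup>2 * exp (- V x))
      + c / 2 * (\<Sum>i<n. (LINT x|lebesgue_n n. x i * exp (- V x))\<^sup>2)"

lemma deriv_mono_of_strong_convexity:
  fixes f f' :: "real \<Rightarrow> real"
  assumes d: "\<And>x. (f has_real_derivative f' x) (at x)"
    and c: "\<And>s x y. 0 \<le> s \<Longrightarrow> s \<le> 1 \<Longrightarrow>
      f ((1 - s) * x + s * y) \<le> (1 - s) * f x + s * f y - \<epsilon> * s * (1 - s) / 2 * (x - y)\<^sup>2"
    and xy: "x \<le> y"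
  shows "\<epsilon> * (y - x) \<le> f' y - f' x"
proof (cases "x = y")
  case False
  have tangent: "f' x * (y - x) \<le> f y - f x - \<epsilon> / 2 * (x - y)\<^sup>2" for x y
  proof -
    have le: "(f (x + s * (y - x)) - f x) / s \<le> f y - f x - \<epsilon> * (1 - s) / 2 * (x - y)\<^sup>2" if s: "0 < s" "s \<le> 1" for s
    proof -
      have "f (x + s * (y - x)) - f x \<le> (f y - f x - \<epsilon> * (1 - s) / 2 * (x - y)\<^sup>2) * s"
        using c[of s x y] s by (simp add: algebra_simps)
      thus ?thesis using s by (simp only: pos_divide_le_eq)
    qed
    have dg: "((\<lambda>s. f (x + s * (y - x))) has_real_derivative f' x * (y - x)) (at 0)"
      by (rule DERIV_chain2[of f]) (auto intro!: derivative_eq_intros d)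
    hence "((\<lambda>s. (f (x + s * (y - x)) - f x) / s) \<longlongrightarrow> f' x * (y - x)) (at_right 0)"
      by (auto simp: DERIV_def intro: filterlim_at_split[THEN iffD1, THEN conjunct2])
    moreover have "((\<lambda>s. f y - f x - \<epsilon> * (1 - s) / 2 * (x - y)\<^sup>2) \<longlongrightarrow> f y - f x - \<epsilon> * (1 - 0) / 2 * (x - y)\<^sup>2) (at_right 0)"
      by (intro tendsto_intros) auto
    moreover have "\<forall>\<^sub>F s in at_right 0. (f (x + s * (y - x)) - f x) / s \<le> f y - f x - \<epsilon> * (1 - s) / 2 * (x - y)\<^sup>2"
      using le by (auto simp: eventually_at_right_field intro!: exI[of _ 1])
    ultimately have "f' x * (y - x) \<le> f y - f x - \<epsilon> * (1 - 0) / 2 * (x - y)\<^sup>2"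
      by (intro tendsto_le) auto
    thus ?thesis by simp
  qed
  have "\<epsilon> * (y - x) * (y - x) \<le> (f' y - f' x) * (y - x)"
    using tangent[of x y] tangent[of y x] by (simp add: power2_eq_square algebra_simps)
  thus ?thesis using False xy by simp
qed simp

locale normalized_section = sectioned_potential +
  assumes total_mass: "(LINT x|lebesgue_n (Suc n). exp (- V x)) = 1"
begin

sublocale tot: normalized_potential "Suc n" \<epsilon> \<Lambda> L V D
  by standard (rule total_mass)

definition Vc :: "real \<Rightarrow> (nat \<Rightarrow> real) \<Rightarrow> real" where "Vc x y = V (y(n := x)) + ln (p x)"

lemma exp_cond: "exp (- Vc x y) = exp (- V (y(n := x))) / p x"
  using p_pos[of x] by (simp add: Vc_def exp_diff)

sublocale cond: normalized_potential n \<epsilon> \<Lambda> L "Vc x" "\<lambda>i y. D i (y(n := x))" for x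
proof (intro normalized_potential.intro normalized_potential_axioms.intro)
  show "potential n \<epsilon> \<Lambda> L (Vc x) (\<lambda>i y. D i (y(n := x)))"
    unfolding Vc_def[abs_def] by (rule section_pot.potential_add_const)
  have "(LINT y|lebesgue_n n. exp (- V (y(n := x)))) = p x" by (simp only: J_def mult_1_left)
  thus "(LINT y|lebesgue_n n. exp (- Vc x y)) = 1"
    unfolding exp_cond using p_pos[of x] by simp
qed

lemma cond_E: "cond.E x g = J g x / p x"
proof -
  have "cond.E x g = (LINT y|lebesgue_n n. (g y * exp (- V (y(n := x)))) / p x)"
    unfolding cond.E_def by (simp add: exp_cond)
  thus ?thesis by (simp add: J_def)
qed

definition \<psi> :: "real \<Rightarrow> real" where "\<psi> x = - ln (p x)"

abbreviation Dn :: "real \<Rightarrow> (nat \<Rightarrow> real) \<Rightarrow> real" where "Dn x \<equiv> \<lambda>y. D n (y(n := x))"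

definition \<psi>' :: "real \<Rightarrow> real" where "\<psi>' x = cond.E x (Dn x)"

lemma exp_\<psi>: "exp (- \<psi> x) = p x"
  using p_pos[of x] by (simp add: \<psi>_def)

lemma J_cond: "J g x = cond.E x g * exp (- \<psi> x)"
  using p_pos[of x] by (simp add: cond_E exp_\<psi>)

lemma Dn_lin [simp]: "lin_bdd_n n (Dn x)"
  by (rule D_section_lin) simp

lemma \<psi>_deriv: "(\<psi> has_real_derivative \<psi>' x) (at x)"
proof -
  have "(p has_real_derivative - J (\<lambda>y. 1 * Dn x y) x) (at x)" by (rule J_deriv) simp
  hence "(p has_real_derivative - J (Dn x) x) (at x)" by simp
  thus ?thesis unfolding \<psi>_def[abs_def] \<psi>'_def cond_E using p_pos[of x]
    by (auto intro!: derivative_eq_intros)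
qed

lemma \<psi>_convex:
  assumes s: "0 \<le> s" "s \<le> 1"
  shows "\<psi> ((1 - s) * t + s * u) \<le> (1 - s) * \<psi> t + s * \<psi> u - \<epsilon> * s * (1 - s) / 2 * (t - u)\<^sup>2"
proof -
  define k where "k = \<epsilon> * s * (1 - s) / 2 * (t - u)\<^sup>2"
  have le: "V ((\<lambda>i. (1 - s) * x i + s * y i)(n := (1 - s) * t + s * u)) + k
      \<le> (1 - s) * V (x(n := t)) + s * V (y(n := u))" for x y
  proof -
    have "(\<lambda>i. (1 - s) * x i + s * y i)(n := (1 - s) * t + s * u) =
        (\<lambda>i. (1 - s) * (x(n := t)) i + s * (y(n := u)) i)" by auto
    hence "V ((\<lambda>i. (1 - s) * x i + s * y i)(n := (1 - s) * t + s * u)) \<le> (1 - s) * V (x(n := t)) + s * V (y(n := u))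
        - \<epsilon> * s * (1 - s) / 2 * nsq (Suc n) (\<lambda>i. (x(n := t)) i - (y(n := u)) i)"
      using V_convex[OF s, of "x(n := t)" "y(n := u)"] by (simp only:)
    moreover have "k \<le> \<epsilon> * s * (1 - s) / 2 * nsq (Suc n) (\<lambda>i. (x(n := t)) i - (y(n := u)) i)"
      unfolding k_def using eps_pos s
      by (intro mult_left_mono) (auto simp: nsq_def intro: sum_nonneg)
    ultimately show ?thesis by linarith
  qed
  have "(1 - s) * ln (LINT y|lebesgue_n n. exp (- V (y(n := t)))) + s * ln (LINT y|lebesgue_n n. exp (- V (y(n := u))))
    \<le> ln (LINT y|lebesgue_n n. exp (- (V (y(n := (1 - s) * t + s * u)) + k)))"
    by (rule prekopa_potential[OF section_pot.potential_axioms section_pot.potential_axioms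
        section_pot.potential_add_const s le])
  also have "(LINT y|lebesgue_n n. exp (- (V (y(n := (1 - s) * t + s * u)) + k))) = exp (- k) * p ((1 - s) * t + s * u)"
    by (simp add: J_def exp_diff exp_minus divide_inverse)
  finally have "(1 - s) * ln (p t) + s * ln (p u) \<le> - k + ln (p ((1 - s) * t + s * u))"
    using p_pos[of "(1 - s) * t + s * u"] by (simp only: J_def mult_1_left ln_mult_pos exp_gt_zero ln_exp)
  thus ?thesis by (simp add: \<psi>_def k_def)
qed

text \<open>Jensen's inequality under the conditional measure at \<open>x\<close>.\<close>

lemma \<psi>_upper: "\<psi> t \<le> \<psi> x + \<psi>' x * (t - x) + \<Lambda> / 2 * (t - x)\<^sup>2"
proof -
  define d where "d = t - x"
  define a where "a = \<psi>' x * d"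
  have vle: "V (y(n := t)) \<le> V (y(n := x)) + Dn x y * d + \<Lambda> / 2 * d\<^sup>2" for y
    unfolding d_def
    by (rule quadratic_upper_bound[of "\<lambda>x. V (y(n := x))" "\<lambda>x. Dn x y"])
       (use V_section_deriv D_upper[of n _ _ y] in auto)
  have low: "exp (- a - \<Lambda> / 2 * d\<^sup>2) * ((1 + a - d * Dn x y) * exp (- V (y(n := x)))) \<le> exp (- V (y(n := t)))" for y
  proof -
    have ge: "1 + a - d * Dn x y \<le> exp (a - d * Dn x y)"
      unfolding add_diff_eq[symmetric] by (rule exp_ge_add_one_self)
    have "exp (- a - \<Lambda> / 2 * d\<^sup>2) * ((1 + a - d * Dn x y) * exp (- V (y(n := x))))
      \<le> exp (- a - \<Lambda> / 2 * d\<^sup>2) * (exp (a - d * Dn x y) * exp (- V (y(n := x))))"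
      by (intro mult_left_mono mult_right_mono ge) auto
    also have "\<dots> = exp (- (V (y(n := x)) + Dn x y * d + \<Lambda> / 2 * d\<^sup>2))"
      unfolding exp_add[symmetric] by (simp add: algebra_simps)
    also have "\<dots> \<le> exp (- V (y(n := t)))" using vle[of y] by simp
    finally show ?thesis .
  qed
  have q: "quad_bdd_n n (\<lambda>y. 1 + a - d * Dn x y)" by simp
  have "exp (- a - \<Lambda> / 2 * d\<^sup>2) * J (\<lambda>y. 1 + a - d * Dn x y) x
      = (LINT y|lebesgue_n n. exp (- a - \<Lambda> / 2 * d\<^sup>2) * ((1 + a - d * Dn x y) * exp (- V (y(n := x)))))"
    by (simp add: J_def)
  also have "\<dots> \<le> (LINT y|lebesgue_n n. exp (- V (y(n := t))))"
    by (intro integral_mono integrable_mult_right quad_section_integrable[OF q] section_pot.exp_integrable low)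
  also have "\<dots> = p t" by (simp only: J_def mult_1_left)
  also have "J (\<lambda>y. 1 + a - d * Dn x y) x = p x"
  proof -
    have "cond.E x (\<lambda>y. 1 + a - d * Dn x y) = 1 + a - d * cond.E x (Dn x)"
      using cond.E_diff[of "\<lambda>_. 1 + a" "\<lambda>y. d * Dn x y" x]
      by (simp only: quad_bdd_const quad_bdd_cmult quad_bdd_lin Dn_lin cond.E_cmult cond.E_const)
    also have "\<dots> = 1" unfolding a_def \<psi>'_def by (simp only: mult.commute add_diff_cancel_right')
    finally show ?thesis using p_pos[of x] unfolding cond_E by simp
  qed
  finally have "ln (exp (- a - \<Lambda> / 2 * d\<^sup>2) * p x) \<le> ln (p t)"
    using p_pos[of x] p_pos[of t] by (subst ln_le_cancel_iff) auto
  hence "- a - \<Lambda> / 2 * d\<^sup>2 + ln (p x) \<le> ln (p t)"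
    using p_pos[of x] by (simp add: ln_mult_pos)
  thus ?thesis by (simp add: \<psi>_def a_def d_def)
qed

sublocale line: line_potential \<epsilon> \<Lambda> \<psi> \<psi>'
proof
  show "(\<psi> has_real_derivative \<psi>' x) (at x)" for x by (rule \<psi>_deriv)
  show "\<epsilon> * (t - s) \<le> \<psi>' t - \<psi>' s" if "s \<le> t" for s t
    by (rule deriv_mono_of_strong_convexity[OF \<psi>_deriv \<psi>_convex that])
  show "\<psi>' t - \<psi>' s \<le> \<Lambda> * (t - s)" if "s \<le> t" for s t
  proof (cases "s = t")
    case False
    have "(\<psi>' t - \<psi>' s) * (t - s) \<le> \<Lambda> * (t - s) * (t - s)"
      using \<psi>_upper[of t s] \<psi>_upper[of s t] by (simp add: power2_eq_square algebra_simps)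
    thus ?thesis using False that by simp
  qed simp
  show "(LINT x|lborel. exp (- \<psi> x)) = 1"
    using J_Fubini[of "\<lambda>_. 1"] total_mass by (simp add: exp_\<psi>)
qed (rule eps_pos)

definition m :: "nat \<Rightarrow> real \<Rightarrow> real" where "m i x = cond.E x (\<lambda>y. y i)"

definition m' :: "nat \<Rightarrow> real \<Rightarrow> real" where "m' i x = - cond.cov x (\<lambda>y. y i) (Dn x)"

lemma coord_lin_n [simp]: "i < n \<Longrightarrow> lin_bdd_n n (\<lambda>y. y i)"
  by (rule section_pot.coord_lin)

lemma m_deriv: "i < n \<Longrightarrow> (m i has_real_derivative m' i x) (at x)"
proof -
  assume i: "i < n"
  have 1: "(J (\<lambda>y. y i) has_real_derivative - J (\<lambda>y. y i * Dn x y) x) (at x)" using i by (intro J_deriv) simp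
  have "(p has_real_derivative - J (\<lambda>y. 1 * Dn x y) x) (at x)" by (rule J_deriv) simp
  hence 2: "(p has_real_derivative - J (Dn x) x) (at x)" by simp
  have "((\<lambda>x. J (\<lambda>y. y i) x / p x) has_real_derivative
      (- J (\<lambda>y. y i * Dn x y) x * p x - J (\<lambda>y. y i) x * - J (Dn x) x) / (p x * p x)) (at x)"
    using p_pos[of x] by (intro DERIV_divide 1 2) simp
  moreover have "(- J (\<lambda>y. y i * Dn x y) x * p x - J (\<lambda>y. y i) x * - J (Dn x) x) / (p x * p x) = m' i x"
    using p_pos[of x] by (simp add: m'_def cond.cov_def cond_E field_simps)
  ultimately show ?thesis by (simp add: m_def[abs_def] cond_E)
qed

lemma m'_continuous: "i < n \<Longrightarrow> continuous_on UNIV (m' i)"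
proof -
  assume i: "i < n"
  have 1: "continuous_on UNIV (\<lambda>x. J (\<lambda>y. y i * Dn x y) x)"
    using i by (intro continuous_at_imp_continuous_on ballI J_continuous) simp
  have "continuous_on UNIV (\<lambda>x. J (\<lambda>y. 1 * Dn x y) x)"
    by (intro continuous_at_imp_continuous_on ballI J_continuous) simp
  hence 2: "continuous_on UNIV (\<lambda>x. J (Dn x) x)" by simp
  have 3: "continuous_on UNIV (J (\<lambda>y. y i))"
    using i by (intro continuous_at_imp_continuous_on ballI DERIV_isCont[OF J_deriv]) simp
  have "p x \<noteq> 0" for x using p_pos[of x] by simp
  thus ?thesis unfolding m'_def[abs_def] cond.cov_def cond_E
    by (intro continuous_intros 1 2 3 p_continuous) auto
qed

lemma cond_var_coord_le: "i < n \<Longrightarrow> cond.var x (\<lambda>y. y i) \<le> 8 / \<epsilon>"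
proof -
  assume i: "i < n"
  define e where "e j = (if j = i then 1 else 0 :: real)" for j
  have "(\<Sum>j<n. e j * y j) = y i" for y using i by (simp add: e_def if_distrib[of "\<lambda>a. a * _"] cong: if_cong)
  moreover have "(\<Sum>j<n. (e j)\<^sup>2) = 1" using i by (simp add: e_def if_distrib[of "\<lambda>a. a\<^sup>2"] cong: if_cong)
  ultimately show ?thesis using cond.var_linear_le[of x e] by simp
qed

lemma cond_var_Dn_le: "cond.var x (Dn x) \<le> L\<^sup>2 * (real n)\<^sup>2 * (8 / \<epsilon>)"
proof -
  define z where "z = (\<lambda>i. m i x)"
  have zi: "quad_bdd_n n (\<lambda>y. (y i - z i)\<^sup>2)" if "i < n" for i using that by auto
  have "cond.var x (Dn x) \<le> cond.E x (\<lambda>y. (Dn x y - Dn x z)\<^sup>2)" by (rule cond.var_le) simp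
  also have "\<dots> \<le> cond.E x (\<lambda>y. (L\<^sup>2 * real n) * (\<Sum>i<n. (y i - z i)\<^sup>2))"
  proof (rule cond.E_mono)
    show "quad_bdd_n n (\<lambda>y. L\<^sup>2 * real n * (\<Sum>i<n. (y i - z i)\<^sup>2))"
      using zi by (intro quad_bdd_cmult quad_bdd_sum) simp
    fix y
    have "\<bar>Dn x y - Dn x z\<bar> \<le> L * n1 n (\<lambda>i. y i - z i)"
      using D_lipschitz[of n "y(n := x)" "z(n := x)"] by (simp add: n1_def)
    hence "\<bar>Dn x y - Dn x z\<bar>\<^sup>2 \<le> (L * n1 n (\<lambda>i. y i - z i))\<^sup>2" by (rule power_mono) simp
    also have "\<dots> \<le> L\<^sup>2 * (real n * nsq n (\<lambda>i. y i - z i))"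
      unfolding power_mult_distrib by (intro mult_left_mono n1_sq_le) simp
    finally show "(Dn x y - Dn x z)\<^sup>2 \<le> (L\<^sup>2 * real n) * (\<Sum>i<n. (y i - z i)\<^sup>2)"
      by (simp add: nsq_def mult.assoc)
  qed simp
  also have "\<dots> = (L\<^sup>2 * real n) * (\<Sum>i<n. cond.var x (\<lambda>y. y i))"
  proof -
    have "cond.E x (\<lambda>y. \<Sum>i<n. (y i - z i)\<^sup>2) = (\<Sum>i<n. cond.E x (\<lambda>y. (y i - z i)\<^sup>2))"
      using zi by (intro cond.E_sum) simp
    also have "\<dots> = (\<Sum>i<n. cond.var x (\<lambda>y. y i))"
      by (intro sum.cong refl) (simp add: cond.var_centered z_def m_def)
    finally show ?thesis by (simp only: cond.E_cmult)
  qed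
  also have "\<dots> \<le> (L\<^sup>2 * real n) * (\<Sum>i<n. 8 / \<epsilon>)"
    by (intro mult_left_mono sum_mono cond_var_coord_le) auto
  finally show ?thesis by (simp add: power2_eq_square mult_ac)
qed

lemma m'_sq_le: "(\<Sum>i<n. (m' i x)\<^sup>2) \<le> 8 / \<epsilon> * cond.var x (Dn x)"
  unfolding m'_def power2_minus by (rule cond.sum_cov_coord_sq_le) simp

lemma m'_bounded: "i < n \<Longrightarrow> \<bar>m' i x\<bar> \<le> L * real n * (8 / \<epsilon>)"
proof -
  assume i: "i < n"
  have "(m' i x)\<^sup>2 \<le> (\<Sum>i<n. (m' i x)\<^sup>2)" by (rule member_le_sum) (use i in auto)
  also have "\<dots> \<le> 8 / \<epsilon> * (L\<^sup>2 * (real n)\<^sup>2 * (8 / \<epsilon>))"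
    by (rule order_trans[OF m'_sq_le mult_left_mono[OF cond_var_Dn_le]]) (use eps_pos in simp)
  also have "\<dots> = (L * real n * (8 / \<epsilon>))\<^sup>2" by (simp add: power2_eq_square mult_ac)
  finally show ?thesis using L_nonneg eps_pos by (simp add: abs_le_square_iff[symmetric])
qed

lemma quad_bdd_bounded: "g \<in> borel_measurable lborel \<Longrightarrow> (\<And>x. \<bar>g x\<bar> \<le> B) \<Longrightarrow> quad_bdd_real g" for g :: "real \<Rightarrow> real"
proof (rule quad_bddI)
  fix x assume b: "\<And>x. \<bar>g x\<bar> \<le> B"
  have "0 \<le> B * x\<^sup>2" using b[of x] by (intro mult_nonneg_nonneg) auto
  thus "\<bar>g x\<bar> \<le> B * (1 + x\<^sup>2)" using b[of x] unfolding distrib_left by linarith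
qed

lemma Dn_lin_total: "lin_bdd_n (Suc n) (D n)"
  by (rule D_lin) simp

lemma coord_lin_total [simp]: "i < Suc n \<Longrightarrow> lin_bdd_n (Suc n) (\<lambda>x. x i)"
  by (rule coord_lin)

lemma cond_var_Dn_quad: "quad_bdd_real (\<lambda>x. cond.var x (Dn x))"
proof (rule quad_bdd_bounded)
  have [measurable]: "p \<in> borel_measurable lborel"
    using borel_measurable_continuous_onI[OF p_continuous] by simp
  have [measurable]: "(\<lambda>x. J (\<lambda>y. D n (y(n := x)) * D n (y(n := x))) x) \<in> borel_measurable lborel"
    by (rule borel_measurable_integrable[OF J_integrable]) (intro quad_bdd_mult Dn_lin_total)
  have [measurable]: "(\<lambda>x. J (\<lambda>y. D n (y(n := x))) x) \<in> borel_measurable lborel"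
    by (rule borel_measurable_integrable[OF J_integrable]) (intro quad_bdd_lin Dn_lin_total)
  show "(\<lambda>x. cond.var x (Dn x)) \<in> borel_measurable lborel"
    unfolding cond.cov_def cond_E by measurable
  show "\<bar>cond.var x (Dn x)\<bar> \<le> L\<^sup>2 * (real n)\<^sup>2 * (8 / \<epsilon>)" for x
    using cond_var_Dn_le[of x] cond.var_nonneg[OF Dn_lin, of x] by simp
qed

text \<open>
  The excess \<open>E Var(D\<^sub>n V | x\<^sub>n)\<close> of the Fisher information over the one of the marginal pays for the
  fluctuation of the conditional barycenter.
\<close>

lemma sum_var_m_le: "(\<Sum>i<n. line.var (m i)) \<le> 8 / \<epsilon>\<^sup>2 * line.E (\<lambda>x. cond.var x (Dn x))"
proof -
  have q: "quad_bdd_real (\<lambda>x. (m' i x)\<^sup>2)" if i: "i < n" for i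
  proof (rule quad_bdd_bounded)
    show "(\<lambda>x. (m' i x)\<^sup>2) \<in> borel_measurable lborel"
      using borel_measurable_continuous_onI[OF m'_continuous[OF i]] by simp
    show "\<bar>(m' i x)\<^sup>2\<bar> \<le> (L * real n * (8 / \<epsilon>))\<^sup>2" for x
      using power_mono[OF m'_bounded[OF i, of x], of 2] by simp
  qed
  have "\<epsilon> * (\<Sum>i<n. line.var (m i)) \<le> (\<Sum>i<n. line.E (\<lambda>x. (m' i x)\<^sup>2))"
    unfolding sum_distrib_left
    by (intro sum_mono line.poincare[OF m_deriv m'_continuous m'_bounded]) auto
  also have "\<dots> = line.E (\<lambda>x. \<Sum>i<n. (m' i x)\<^sup>2)" using q by (subst line.E_sum) auto
  also have "\<dots> \<le> line.E (\<lambda>x. 8 / \<epsilon> * cond.var x (Dn x))"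
    by (rule line.E_mono) (use q cond_var_Dn_quad m'_sq_le in auto)
  also have "\<dots> = 8 / \<epsilon> * line.E (\<lambda>x. cond.var x (Dn x))" by (rule line.E_cmult)
  finally show ?thesis using eps_pos by (simp add: field_simps power2_eq_square)
qed

lemma m_lin: "i < n \<Longrightarrow> lin_bdd_real (m i)"
  by (rule line.lin_of_bounded_deriv[OF m_deriv m'_bounded])

end

context normalized_section
begin

theorem improved_lsi_step:
  assumes IH: "\<And>x. improved_lsi n c (Vc x) (\<lambda>i y. D i (y(n := x)))"
    and L: "1 \<le> \<Lambda>" and c: "0 \<le> c" "c \<le> 1 / 2" "c \<le> \<epsilon> / (2 * sqrt \<Lambda>)" "c * (8 / \<epsilon>\<^sup>2) \<le> 1 - c"
  shows "improved_lsi (Suc n) c V D"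
proof -
  have q1: "quad_bdd_n (Suc n) (\<lambda>z. nsq (Suc n) z / 2 - V z)"
    unfolding nsq_def by (intro quad_bdd_diff quad_bdd_divide quad_bdd_sum quad_bdd_power2 V_quad) simp
  have q2: "quad_bdd_n (Suc n) (\<lambda>z. (D i z - z i)\<^sup>2)" if "i < Suc n" for i
    using that by (intro quad_bdd_power2 lin_bdd_diff D_lin coord_lin_total)
  have nsq_quad: "quad_bdd_n n (nsq n)"
    unfolding nsq_def[abs_def] by (intro quad_bdd_sum quad_bdd_power2) simp
  define A where "A i = tot.E (\<lambda>z. (D i z - z i)\<^sup>2)" for i
  define S where "S = line.E (\<lambda>x. cond.var x (Dn x))"
  have A: "A i = (LINT x|lborel. J (\<lambda>y. (D i (y(n := x)) - y i)\<^sup>2) x)"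
      "integrable lborel (\<lambda>x. J (\<lambda>y. (D i (y(n := x)) - y i)\<^sup>2) x)" if "i < n" for i
    using J_Fubini[OF q2[of i]] J_integrable[OF q2[of i]] that by (simp_all add: A_def tot.E_def)
  have mean: "tot.E (\<lambda>z. z i) = line.E (m i)" if i: "i < n" for i
    using J_Fubini[OF quad_bdd_lin[OF coord_lin_total[of i]]] i
    by (simp add: tot.E_def line.E_def m_def J_cond)
  have mean_n: "tot.E (\<lambda>z. z n) = line.E (\<lambda>x. x)"
    using J_Fubini[OF quad_bdd_lin[OF coord_lin_total[of n]]]
    by (simp add: tot.E_def line.E_def J_cond cond.E_const)
  have An: "A n = S + line.E (\<lambda>x. (\<psi>' x - x)\<^sup>2)"
  proof -
    have "A n = line.E (\<lambda>x. cond.E x (\<lambda>y. (Dn x y - x)\<^sup>2))"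
      using J_Fubini[OF q2[of n]] by (simp add: A_def tot.E_def line.E_def J_cond)
    also have "\<dots> = line.E (\<lambda>x. cond.var x (Dn x) + (\<psi>' x - x)\<^sup>2)"
      by (simp add: cond.var_centered \<psi>'_def)
    also have "\<dots> = S + line.E (\<lambda>x. (\<psi>' x - x)\<^sup>2)"
      unfolding S_def by (intro line.E_add cond_var_Dn_quad quad_bdd_power2 lin_bdd_diff line.V'_lin line.id_lin)
    finally show ?thesis .
  qed
  have pointwise: "J (\<lambda>y. nsq (Suc n) (y(n := x)) / 2 - V (y(n := x))) x \<le>
      (1 - c) / 2 * (\<Sum>i<n. J (\<lambda>y. (D i (y(n := x)) - y i)\<^sup>2) x)
      + (c / 2 * (\<Sum>i<n. (m i x)\<^sup>2) - real n / 2 * ln (2 * pi) + (x\<^sup>2 / 2 - \<psi> x)) * exp (- \<psi> x)" for x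
  proof -
    have cq: "quad_bdd_n n (\<lambda>y. nsq n y / 2 - Vc x y)"
      by (intro quad_bdd_diff quad_bdd_divide nsq_quad cond.V_quad)
    have "cond.E x (\<lambda>y. nsq (Suc n) (y(n := x)) / 2 - V (y(n := x)))
        = cond.E x (\<lambda>y. (nsq n y / 2 - Vc x y) + (x\<^sup>2 / 2 - \<psi> x))"
      by (simp add: nsq_def \<psi>_def Vc_def add_divide_distrib algebra_simps)
    also have "\<dots> = cond.E x (\<lambda>y. nsq n y / 2 - Vc x y) + (x\<^sup>2 / 2 - \<psi> x)"
      by (subst cond.E_add[OF cq]) (simp_all add: cond.E_const)
    also have "\<dots> \<le> (1 - c) / 2 * (\<Sum>i<n. cond.E x (\<lambda>y. (D i (y(n := x)) - y i)\<^sup>2))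
      + (c / 2 * (\<Sum>i<n. (m i x)\<^sup>2) - real n / 2 * ln (2 * pi) + (x\<^sup>2 / 2 - \<psi> x))"
      using IH[of x] unfolding improved_lsi_def cond.E_def[symmetric] m_def by linarith
    finally have "cond.E x (\<lambda>y. nsq (Suc n) (y(n := x)) / 2 - V (y(n := x))) * exp (- \<psi> x) \<le>
      ((1 - c) / 2 * (\<Sum>i<n. cond.E x (\<lambda>y. (D i (y(n := x)) - y i)\<^sup>2))
      + (c / 2 * (\<Sum>i<n. (m i x)\<^sup>2) - real n / 2 * ln (2 * pi) + (x\<^sup>2 / 2 - \<psi> x))) * exp (- \<psi> x)"
      by (intro mult_right_mono) auto
    thus ?thesis unfolding J_cond distrib_right[of _ _ "exp (- \<psi> x)"] mult.assoc sum_distrib_right .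
  qed
  define R where "R x = c / 2 * (\<Sum>i<n. (m i x)\<^sup>2) - real n / 2 * ln (2 * pi) + (x\<^sup>2 / 2 - \<psi> x)" for x
  have mq: "quad_bdd_real (\<lambda>x. (m i x)\<^sup>2)" if "i < n" for i
    using m_lin[OF that] by (rule quad_bdd_power2)
  have lq: "quad_bdd_real (\<lambda>x. x\<^sup>2 / 2 - \<psi> x)" by simp
  have sq: "quad_bdd_real (\<lambda>x. \<Sum>i<n. (m i x)\<^sup>2)" using mq by auto
  have Rq: "quad_bdd_real R"
    unfolding R_def[abs_def] by (rule quad_bdd_add[OF quad_bdd_diff[OF quad_bdd_cmult[OF sq] quad_bdd_const] lq])
  have Ri: "integrable lborel (\<lambda>x. R x * exp (- \<psi> x))"
    by (rule line.integrable_quad[OF Rq])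
  have "tot.E (\<lambda>z. nsq (Suc n) z / 2 - V z) = (LINT x|lborel. J (\<lambda>y. nsq (Suc n) (y(n := x)) / 2 - V (y(n := x))) x)"
    using J_Fubini[OF q1] by (simp only: tot.E_def)
  also have "\<dots> \<le> (LINT x|lborel. (1 - c) / 2 * (\<Sum>i<n. J (\<lambda>y. (D i (y(n := x)) - y i)\<^sup>2) x) + R x * exp (- \<psi> x))"
    using pointwise
    by (intro integral_mono J_integrable q1 Bochner_Integration.integrable_add Ri integrable_mult_right
          Bochner_Integration.integrable_sum A) (auto simp: R_def)
  also have "\<dots> = (1 - c) / 2 * (\<Sum>i<n. A i) + line.E R"
  proof -
    have "integrable lborel (\<lambda>x. (1 - c) / 2 * (\<Sum>i<n. J (\<lambda>y. (D i (y(n := x)) - y i)\<^sup>2) x))"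
      by (intro integrable_mult_right Bochner_Integration.integrable_sum A) simp
    from Bochner_Integration.integral_add[OF this Ri]
    have "(LINT x|lborel. (1 - c) / 2 * (\<Sum>i<n. J (\<lambda>y. (D i (y(n := x)) - y i)\<^sup>2) x) + R x * exp (- \<psi> x))
      = (LINT x|lborel. (1 - c) / 2 * (\<Sum>i<n. J (\<lambda>y. (D i (y(n := x)) - y i)\<^sup>2) x)) + line.E R"
      by (simp only: line.E_def)
    also have "(LINT x|lborel. (1 - c) / 2 * (\<Sum>i<n. J (\<lambda>y. (D i (y(n := x)) - y i)\<^sup>2) x))
      = (1 - c) / 2 * (\<Sum>i<n. A i)"
      using A by (subst integral_mult_right_zero, subst Bochner_Integration.integral_sum) auto
    finally show ?thesis .
  qed
  also have "line.E R = c / 2 * (\<Sum>i<n. line.E (\<lambda>x. (m i x)\<^sup>2)) - real n / 2 * ln (2 * pi) + line.E (\<lambda>x. x\<^sup>2 / 2 - \<psi> x)"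
  proof -
    have "line.E R = line.E (\<lambda>x. c / 2 * (\<Sum>i<n. (m i x)\<^sup>2) - real n / 2 * ln (2 * pi)) + line.E (\<lambda>x. x\<^sup>2 / 2 - \<psi> x)"
      unfolding R_def[abs_def] by (rule line.E_add[OF quad_bdd_diff[OF quad_bdd_cmult[OF sq] quad_bdd_const] lq])
    also have "line.E (\<lambda>x. c / 2 * (\<Sum>i<n. (m i x)\<^sup>2) - real n / 2 * ln (2 * pi))
        = c / 2 * line.E (\<lambda>x. \<Sum>i<n. (m i x)\<^sup>2) - real n / 2 * ln (2 * pi)"
      unfolding line.E_diff[OF quad_bdd_cmult[OF sq] quad_bdd_const] line.E_cmult line.E_const ..
    also have "line.E (\<lambda>x. \<Sum>i<n. (m i x)\<^sup>2) = (\<Sum>i<n. line.E (\<lambda>x. (m i x)\<^sup>2))"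
      by (rule line.E_sum) (simp add: mq)
    finally show ?thesis .
  qed
  also have "(\<Sum>i<n. line.E (\<lambda>x. (m i x)\<^sup>2)) = (\<Sum>i<n. line.var (m i)) + (\<Sum>i<n. (tot.E (\<lambda>z. z i))\<^sup>2)"
    unfolding sum.distrib[symmetric]
    by (intro sum.cong refl) (use line.var_centered[OF m_lin, of _ 0] mean in simp)
  finally have 1: "tot.E (\<lambda>z. nsq (Suc n) z / 2 - V z) \<le> (1 - c) / 2 * (\<Sum>i<n. A i)
      + (c / 2 * ((\<Sum>i<n. line.var (m i)) + (\<Sum>i<n. (tot.E (\<lambda>z. z i))\<^sup>2)) - real n / 2 * ln (2 * pi)
         + line.E (\<lambda>x. x\<^sup>2 / 2 - \<psi> x))" by simp
  have 2: "line.E (\<lambda>x. x\<^sup>2 / 2 - \<psi> x) + ln (2 * pi) / 2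
      \<le> (1 - c) / 2 * (A n - S) + c / 2 * (tot.E (\<lambda>z. z n))\<^sup>2"
    using line.log_sobolev_centered[OF L c(1-3)] by (simp add: An mean_n)
  have S: "0 \<le> S" unfolding S_def by (intro line.E_nonneg cond.var_nonneg) simp
  have 3: "c * (\<Sum>i<n. line.var (m i)) \<le> (1 - c) * S"
  proof -
    have "c * (\<Sum>i<n. line.var (m i)) \<le> c * (8 / \<epsilon>\<^sup>2 * S)"
      using sum_var_m_le c(1) unfolding S_def by (rule mult_left_mono)
    also have "\<dots> = c * (8 / \<epsilon>\<^sup>2) * S" by simp
    also have "\<dots> \<le> (1 - c) * S" using c(4) S by (rule mult_right_mono)
    finally show ?thesis .
  qed
  have "tot.E (\<lambda>z. nsq (Suc n) z / 2 - V z) + real (Suc n) / 2 * ln (2 * pi) \<le>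
      (1 - c) / 2 * (\<Sum>i<Suc n. A i) + c / 2 * (\<Sum>i<Suc n. (tot.E (\<lambda>z. z i))\<^sup>2)"
    using 1 2 3 by (simp add: field_simps)
  thus ?thesis by (simp add: improved_lsi_def A_def tot.E_def)
qed

end

theorem improved_lsi_potential:
  assumes "normalized_potential n \<epsilon> \<Lambda> L V D" and L: "1 \<le> \<Lambda>"
    and c: "0 \<le> c" "c \<le> 1 / 2" "c \<le> \<epsilon> / (2 * sqrt \<Lambda>)" "c * (8 / \<epsilon>\<^sup>2) \<le> 1 - c"
  shows "improved_lsi n c V D"
  using assms(1)
proof (induction n arbitrary: V D)
  case 0
  interpret normalized_potential 0 \<epsilon> \<Lambda> L V D by fact
  have *: "(LINT x|lebesgue_n 0. f x) = f (\<lambda>_. undefined)" for f :: "(nat \<Rightarrow> real) \<Rightarrow> real"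
    by (simp add: lebesgue_n_def PiM_empty lebesgue_integral_count_space_finite)
  show ?case using mass unfolding improved_lsi_def * by (simp add: nsq_def)
next
  case (Suc n)
  interpret normalized_potential "Suc n" \<epsilon> \<Lambda> L V D by fact
  interpret normalized_section n \<epsilon> \<Lambda> L V D by standard (rule mass)
  show ?case
    by (rule improved_lsi_step[OF Suc.IH L c]) (rule cond.normalized_potential_axioms)
qed

section \<open>From almost everywhere bounds on the Hessian to bounds along segments\<close>

lemma measurable_of_lipschitz:
  fixes g :: "(nat \<Rightarrow> real) \<Rightarrow> real"
  assumes lip: "\<And>x y. \<bar>g x - g y\<bar> \<le> K * n1 n (\<lambda>i. x i - y i)"
  shows "g \<in> borel_measurable (lebesgue_n n)"
proof (rule measurable_of_local_lipschitz)
  show "g x = g y" if "\<And>i. i < n \<Longrightarrow> x i = y i" for x y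
    using lip[of x y] that by (simp add: n1_def)
  show "\<exists>C. \<forall>y. n1 n (\<lambda>i. y i - x i) \<le> 1 \<longrightarrow> \<bar>g y - g x\<bar> \<le> C * n1 n (\<lambda>i. y i - x i)" for x
    by (intro exI[of _ K] allI impI lip)
qed

lemma distr_translation:
  "distr (lebesgue_n n) (lebesgue_n n) (\<lambda>z. \<lambda>i\<in>{..<n}. z i + w i) = lebesgue_n n"
proof -
  let ?T = "\<lambda>z. \<lambda>i\<in>{..<n}. z i + w i :: real"
  have T [measurable]: "?T \<in> measurable (lebesgue_n n) (lebesgue_n n)"
    unfolding lebesgue_n_def by measurable
  have "distr (lebesgue_n n) (lebesgue_n n) ?T = Pi\<^sub>M {..<n} (\<lambda>_. lborel)"
  proof (rule lborel_product.PiM_eqI)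
    fix A :: "nat \<Rightarrow> real set" assume A: "\<And>i. i \<in> {..<n} \<Longrightarrow> A i \<in> sets lborel"
    have pre: "?T -` (\<Pi>\<^sub>E i\<in>{..<n}. A i) \<inter> space (lebesgue_n n) = (\<Pi>\<^sub>E i\<in>{..<n}. (\<lambda>t. t + w i) -` A i)"
      by (auto simp: PiE_def Pi_def extensional_def split: if_splits)
    have m: "(\<lambda>t. t + w i) -` A i \<in> sets lborel" if "i < n" for i
    proof -
      have "(\<lambda>t. t + w i) -` A i \<inter> space lborel \<in> sets lborel"
        using A[of i] that by (intro measurable_sets[of _ _ lborel]) auto
      thus ?thesis by simp
    qed
    have e: "emeasure lborel ((\<lambda>t. t + w i) -` A i) = emeasure lborel (A i)" if "i < n" for i
    proof -
      have "emeasure lborel (A i) = emeasure (distr lborel borel ((+) (w i))) (A i)"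
        by (simp add: lborel_distr_plus)
      also have "\<dots> = emeasure lborel ((+) (w i) -` A i)"
        using A[of i] that by (subst emeasure_distr) auto
      finally show ?thesis by (simp add: add.commute vimage_def)
    qed
    have "emeasure (distr (lebesgue_n n) (lebesgue_n n) ?T) (Pi\<^sub>E {..<n} A)
        = emeasure (lebesgue_n n) (\<Pi>\<^sub>E i\<in>{..<n}. (\<lambda>t. t + w i) -` A i)"
      by (subst emeasure_distr[OF T]) (use A pre in \<open>auto simp: lebesgue_n_def intro!: sets_PiM_I_finite\<close>)
    also have "\<dots> = (\<Prod>i<n. emeasure lborel ((\<lambda>t. t + w i) -` A i))"
      unfolding lebesgue_n_def by (subst lborel_product.emeasure_PiM) (use m in auto)
    finally show "emeasure (distr (lebesgue_n n) (lebesgue_n n) ?T) (Pi\<^sub>E {..<n} A) = (\<Prod>i<n. emeasure lborel (A i))"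
      using e by simp
  qed (simp_all add: lebesgue_n_def)
  thus ?thesis by (simp add: lebesgue_n_def)
qed

lemma integral_translation:
  fixes g :: "(nat \<Rightarrow> real) \<Rightarrow> real"
  assumes g: "g \<in> borel_measurable (lebesgue_n n)"
    and dep: "\<And>x y. (\<And>i. i < n \<Longrightarrow> x i = y i) \<Longrightarrow> g x = g y"
  shows "(LINT z|lebesgue_n n. g (\<lambda>i. z i + w i)) = (LINT z|lebesgue_n n. g z)"
proof -
  let ?T = "\<lambda>z. \<lambda>i\<in>{..<n}. z i + w i :: real"
  have T: "?T \<in> measurable (lebesgue_n n) (lebesgue_n n)"
    unfolding lebesgue_n_def by measurable
  have "(LINT z|lebesgue_n n. g z) = (LINT z|lebesgue_n n. g (?T z))"
    by (subst distr_translation[of n w, symmetric], rule integral_distr[OF T g])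
  also have "(\<lambda>z. g (?T z)) = (\<lambda>z. g (\<lambda>i. z i + w i))" by (intro ext dep) simp
  finally show ?thesis by (rule sym)
qed

text \<open>
  The mollifier is comparable with its translates up to a factor close to one, which makes all
  error terms below multiples of its mass.
\<close>

definition mollifier :: "nat \<Rightarrow> real \<Rightarrow> (nat \<Rightarrow> real) \<Rightarrow> (nat \<Rightarrow> real) \<Rightarrow> real" where
  "mollifier n k w z = exp (- k * n1 n (\<lambda>i. z i - w i))"

lemma mollifier_pos: "0 < mollifier n k w z" by (simp add: mollifier_def)

lemma mollifier_cong: "(\<And>i. i < n \<Longrightarrow> z i = z' i) \<Longrightarrow> mollifier n k w z = mollifier n k w z'"
  by (simp add: mollifier_def n1_def)

lemma mollifier_le:
  assumes "k \<ge> 0"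
  shows "mollifier n k w' z \<le> exp (k * n1 n (\<lambda>i. w' i - w i)) * mollifier n k w z"
proof -
  have "n1 n (\<lambda>i. z i - w i) \<le> n1 n (\<lambda>i. z i - w' i) + n1 n (\<lambda>i. w' i - w i)"
    using n1_add_le[of n "\<lambda>i. z i - w' i" "\<lambda>i. w' i - w i"] by simp
  from mult_left_mono[OF this assms] show ?thesis
    unfolding mollifier_def exp_add[symmetric] by (simp add: algebra_simps)
qed

lemma mollifier_diff_le:
  assumes "k \<ge> 0"
  shows "\<bar>mollifier n k w' z - mollifier n k w z\<bar> \<le> (exp (k * n1 n (\<lambda>i. w' i - w i)) - 1) * mollifier n k w z"
proof -
  define e where "e = exp (k * n1 n (\<lambda>i. w' i - w i))"
  have e: "e \<ge> 1" using assms by (simp add: e_def)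
  have 1: "mollifier n k w' z \<le> e * mollifier n k w z" unfolding e_def by (rule mollifier_le[OF assms])
  have 2: "mollifier n k w z \<le> e * mollifier n k w' z"
    unfolding e_def n1_minus_commute[of n w'] by (rule mollifier_le[OF assms])
  have "(2 - e) * mollifier n k w z \<le> mollifier n k w' z"
  proof (cases "e \<le> 2")
    case True
    have "(2 - e) * mollifier n k w z \<le> (2 - e) * (e * mollifier n k w' z)"
      using True 2 by (intro mult_left_mono) auto
    also have "\<dots> = (1 - (e - 1)\<^sup>2) * mollifier n k w' z" by (simp add: power2_eq_square algebra_simps)
    also have "\<dots> \<le> 1 * mollifier n k w' z"
      using mollifier_pos[of n k w' z] by (intro mult_right_mono) auto
    finally show ?thesis by simp
  next
    case False
    hence "(2 - e) * mollifier n k w z \<le> 0"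
      using mollifier_pos[of n k w z] by (intro mult_nonpos_nonneg) auto
    thus ?thesis using mollifier_pos[of n k w' z] by linarith
  qed
  thus ?thesis using 1 unfolding e_def[symmetric] by (simp add: abs_le_iff algebra_simps)
qed

lemma measurable_mollifier [measurable]: "mollifier n k w \<in> borel_measurable (lebesgue_n n)"
proof -
  have "(\<lambda>z. n1 n (\<lambda>i. z i - w i)) \<in> borel_measurable (lebesgue_n n)"
    unfolding n1_def by (intro borel_measurable_sum borel_measurable_abs borel_measurable_diff) auto
  thus ?thesis unfolding mollifier_def[abs_def] by measurable
qed

lemma integrable_exp_neg_abs:
  fixes k :: real assumes "k > 0" shows "integrable lborel (\<lambda>t. exp (- k * \<bar>t\<bar>))"
proof -
  have f: "integrable lborel (\<lambda>x::real. exp (- x) * indicator {0..} x)"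
    using integrable.intros[OF has_bochner_integral_I0i_power_exp_m'[of 0]] by simp
  have g: "integrable lborel (\<lambda>x::real. exp (- (- x)) * indicator {0..} (- x))"
    using lborel_integrable_real_affine[OF f, of "-1" 0] by simp
  have "integrable lborel (\<lambda>t::real. exp (- \<bar>t\<bar>))"
  proof (rule Bochner_Integration.integrable_bound)
    show "integrable lborel (\<lambda>x::real. exp (- x) * indicator {0..} x + exp (- (- x)) * indicator {0..} (- x))"
      by (intro Bochner_Integration.integrable_add f g)
    show "AE t::real in lborel. norm (exp (- \<bar>t\<bar>)) \<le>
        norm (exp (- t) * indicator {0..} t + exp (- (- t)) * indicator {0..} (- t))"
      by (intro AE_I2) (auto simp: indicator_def)
  qed simp
  from lborel_integrable_real_affine[OF this, of k 0] show ?thesis using assms by (simp add: abs_mult)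
qed

lemma mollifier_zero: "mollifier n k (\<lambda>_. 0) z = (\<Prod>i<n. exp (- k * \<bar>z i\<bar>))"
  unfolding mollifier_def n1_def sum_distrib_left by (simp add: exp_sum)

lemma mollifier_shift: "mollifier n k w z = mollifier n k (\<lambda>_. 0) (\<lambda>i. z i + - w i)"
  by (simp add: mollifier_def)

lemma mollifier_mass:
  assumes "k > 0"
  shows "(LINT z|lebesgue_n n. mollifier n k w z) = ((LINT t|lborel. exp (- \<bar>t\<bar>)) / k) ^ n"
proof -
  have "(LINT z|lebesgue_n n. mollifier n k w z) = (LINT z|lebesgue_n n. mollifier n k (\<lambda>_. 0) z)"
    unfolding mollifier_shift[of n k w]
    by (rule integral_translation[OF measurable_mollifier]) (rule mollifier_cong)
  also have "\<dots> = (\<Prod>i<n. LINT t|lborel. exp (- k * \<bar>t\<bar>))"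
    unfolding mollifier_zero lebesgue_n_def
    by (rule lborel_product.product_integral_prod) (use assms integrable_exp_neg_abs in auto)
  also have "(LINT t|lborel. exp (- k * \<bar>t\<bar>)) = (LINT t|lborel. exp (- \<bar>t\<bar>)) / k"
    using lborel_integral_real_affine[of k "\<lambda>t. exp (- \<bar>t\<bar>)" 0] assms by (simp add: abs_mult)
  finally show ?thesis by simp
qed

lemma integrable_mollifier:
  assumes "k > 0" shows "integrable (lebesgue_n n) (mollifier n k w)"
proof (rule Bochner_Integration.integrable_bound)
  show "integrable (lebesgue_n n) (\<lambda>z. exp (k * n1 n (\<lambda>i. w i - 0)) * mollifier n k (\<lambda>_. 0) z)"
    unfolding mollifier_zero lebesgue_n_def
    by (intro integrable_mult_right lborel_product.product_integrable_prod integrable_exp_neg_abs assms) simp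
  show "AE z in lebesgue_n n. norm (mollifier n k w z) \<le> norm (exp (k * n1 n (\<lambda>i. w i - 0)) * mollifier n k (\<lambda>_. 0) z)"
    using mollifier_le[of k n w _ "\<lambda>_. 0"] assms mollifier_pos
    by (intro AE_I2) (simp add: abs_mult less_imp_le)
qed simp

lemma mollifier_mass_pos: "k > 0 \<Longrightarrow> 0 < (LINT z|lebesgue_n n. mollifier n k w z)"
proof -
  assume k: "k > 0"
  have "(LINT z|lebesgue_n n. mollifier n k w z) \<noteq> 0"
    using integral_nonneg_eq_0_iff_AE[OF integrable_mollifier[OF k]] lebesgue_n_nontrivial[of n]
      mollifier_pos[of n k w] by (simp add: less_imp_le less_imp_neq[symmetric])
  moreover have "0 \<le> (LINT z|lebesgue_n n. mollifier n k w z)"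
    by (intro integral_nonneg_AE) (simp add: mollifier_pos less_imp_le)
  ultimately show ?thesis by linarith
qed

lemma integrable_mollifier_mult:
  assumes k: "k > 0" and g: "g \<in> borel_measurable (lebesgue_n n)" and b: "\<And>z. \<bar>g z\<bar> \<le> B"
  shows "integrable (lebesgue_n n) (\<lambda>z. mollifier n k w z * g z)"
proof (rule Bochner_Integration.integrable_bound)
  show "integrable (lebesgue_n n) (\<lambda>z. mollifier n k w z * B)"
    by (intro integrable_mult_left integrable_mollifier k)
  show "AE z in lebesgue_n n. norm (mollifier n k w z * g z) \<le> norm (mollifier n k w z * B)"
    using mollifier_pos[of n k w] b
    by (intro AE_I2) (auto simp: abs_mult intro!: mult_left_mono order_trans[OF b abs_ge_self])
qed (use g in measurable)

lemma mollifier_integral_translate: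
  assumes g: "g \<in> borel_measurable (lebesgue_n n)"
    and dep: "\<And>x y. (\<And>i. i < n \<Longrightarrow> x i = y i) \<Longrightarrow> g x = g y"
  shows "(LINT z|lebesgue_n n. mollifier n k w z * g (\<lambda>i. z i + h i))
    = (LINT z|lebesgue_n n. mollifier n k (\<lambda>i. w i + h i) z * g z)"
proof -
  have "(LINT z|lebesgue_n n. mollifier n k (\<lambda>i. w i + h i) z * g z)
      = (LINT z|lebesgue_n n. mollifier n k (\<lambda>i. w i + h i) (\<lambda>i. z i + h i) * g (\<lambda>i. z i + h i))"
  proof (rule integral_translation[symmetric])
    show "(\<lambda>z. mollifier n k (\<lambda>i. w i + h i) z * g z) \<in> borel_measurable (lebesgue_n n)"
      by (intro borel_measurable_times g measurable_mollifier)
    show "mollifier n k (\<lambda>i. w i + h i) x * g x = mollifier n k (\<lambda>i. w i + h i) y * g y"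
      if "\<And>i. i < n \<Longrightarrow> x i = y i" for x y
      using mollifier_cong[of n x y, OF that] dep[of x y, OF that] by simp
  qed
  thus ?thesis by (simp add: mollifier_def)
qed

lemma nonneg_of_mollified_nonneg:
  fixes W :: "(nat \<Rightarrow> real) \<Rightarrow> real"
  assumes lip: "\<And>z z'. \<bar>W z - W z'\<bar> \<le> K * n1 n (\<lambda>i. z i - z' i)" and K: "K \<ge> 0"
    and int: "\<And>k. k > 0 \<Longrightarrow> integrable (lebesgue_n n) (\<lambda>z. mollifier n k x z * W z)"
    and nn: "\<And>k. k > 0 \<Longrightarrow> 0 \<le> (LINT z|lebesgue_n n. mollifier n k x z * W z)"
  shows "0 \<le> W x"
proof -
  have bound: "- (2 ^ n * (2 * K) / k) \<le> W x" if k: "k > 0" for k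
  proof -
    define R where "R = (LINT z|lebesgue_n n. mollifier n k x z)"
    have R: "R > 0" unfolding R_def by (rule mollifier_mass_pos[OF k])
    have pw: "mollifier n k x z * W z \<le> mollifier n k x z * W x + K * (2 / k) * mollifier n (k / 2) x z" for z
    proof -
      let ?r = "n1 n (\<lambda>i. z i - x i)"
      have "k / 2 * ?r \<le> exp (k / 2 * ?r)" using exp_ge_add_one_self[of "k / 2 * ?r"] by linarith
      hence "?r \<le> 2 / k * exp (k / 2 * ?r)" using k by (simp add: field_simps)
      hence "mollifier n k x z * ?r \<le> mollifier n k x z * (2 / k * exp (k / 2 * ?r))"
        using mollifier_pos[of n k x z] by (intro mult_left_mono) auto
      also have "\<dots> = 2 / k * mollifier n (k / 2) x z"
      proof -
        have "mollifier n k x z * exp (k / 2 * ?r) = mollifier n (k / 2) x z"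
          unfolding mollifier_def exp_add[symmetric] by (simp add: field_simps)
        thus ?thesis by (metis mult.left_commute)
      qed
      finally have "K * (mollifier n k x z * ?r) \<le> K * (2 / k * mollifier n (k / 2) x z)"
        using K by (rule mult_left_mono)
      moreover have "mollifier n k x z * W z \<le> mollifier n k x z * (W x + K * ?r)"
        using lip[of z x] mollifier_pos[of n k x z] by (intro mult_left_mono) auto
      ultimately show ?thesis by (simp add: algebra_simps)
    qed
    have k2: "k / 2 > 0" using k by simp
    have "0 \<le> (LINT z|lebesgue_n n. mollifier n k x z * W z)" by (rule nn[OF k])
    also have "\<dots> \<le> (LINT z|lebesgue_n n. mollifier n k x z * W x + K * (2 / k) * mollifier n (k / 2) x z)"
      by (intro integral_mono int[OF k] Bochner_Integration.integrable_add integrable_mult_left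
            integrable_mult_right integrable_mollifier k k2 pw)
    also have "\<dots> = R * W x + K * (2 / k) * (LINT z|lebesgue_n n. mollifier n (k / 2) x z)"
      using integrable_mollifier[OF k, of n x] integrable_mollifier[OF k2, of n x] by (simp add: R_def)
    also have "(LINT z|lebesgue_n n. mollifier n (k / 2) x z) = 2 ^ n * R"
      unfolding R_def mollifier_mass[OF k] mollifier_mass[OF k2] by (simp add: power_divide power_mult_distrib)
    finally have "0 \<le> R * (W x + 2 ^ n * (2 * K) / k)" by (simp add: algebra_simps)
    thus ?thesis using R by (simp add: zero_le_mult_iff)
  qed
  have "((\<lambda>k. - (2 ^ n * (2 * K) / k)) \<longlongrightarrow> - 0) at_top"
    by (intro tendsto_minus tendsto_divide_0[OF tendsto_const]) (simp add: filterlim_at_top_imp_at_infinity filterlim_ident)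
  moreover have "\<forall>\<^sub>F k in at_top. - (2 ^ n * (2 * K) / k) \<le> W x"
    using eventually_gt_at_top[of 0] by eventually_elim (rule bound)
  ultimately have "- 0 \<le> W x" by (intro tendsto_upperbound) auto
  thus ?thesis by simp
qed

lemma n1_scale: "n1 n (\<lambda>i. s * v i) = \<bar>s\<bar> * n1 n v"
  by (simp add: n1_def abs_mult sum_distrib_left)

lemma n1_truncate_le: "n1 n (\<lambda>i. if i < j then v i else 0) \<le> n1 n v"
  unfolding n1_def by (rule sum_mono) simp

locale lipschitz_directional =
  fixes n :: nat and K a :: real and u :: "(nat \<Rightarrow> real) \<Rightarrow> real" and v :: "nat \<Rightarrow> real"
    and d :: "nat \<Rightarrow> (nat \<Rightarrow> real) \<Rightarrow> real"
  assumes K: "K \<ge> 0" and lip: "\<And>x y. \<bar>u x - u y\<bar> \<le> K * n1 n (\<lambda>i. x i - y i)"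
    and ae: "AE z in lebesgue_n n. (\<forall>j<n. ((\<lambda>t. u (z(j := t))) has_real_derivative d j z) (at (z j)))
      \<and> a \<le> (\<Sum>j<n. v j * d j z)"
begin

lemma u_cong: "(\<And>i. i < n \<Longrightarrow> x i = y i) \<Longrightarrow> u x = u y"
  using lip[of x y] by (simp add: n1_def)

lemma u_shift_measurable [measurable]: "(\<lambda>z. u (\<lambda>i. z i + h i)) \<in> borel_measurable (lebesgue_n n)"
proof (rule measurable_of_lipschitz)
  show "\<bar>u (\<lambda>i. x i + h i) - u (\<lambda>i. y i + h i)\<bar> \<le> K * n1 n (\<lambda>i. x i - y i)" for x y
    using lip[of "\<lambda>i. x i + h i" "\<lambda>i. y i + h i"] by simp
qed

lemma u_measurable [measurable]: "u \<in> borel_measurable (lebesgue_n n)"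
  using lip by (rule measurable_of_lipschitz)

definition q :: "nat \<Rightarrow> real \<Rightarrow> (nat \<Rightarrow> real) \<Rightarrow> real" where
  "q j t z = u (z(j := z j + t * v j)) - u z"

definition Q :: "real \<Rightarrow> (nat \<Rightarrow> real) \<Rightarrow> real" where "Q t z = (\<Sum>j<n. q j t z)"

definition r :: "real \<Rightarrow> (nat \<Rightarrow> real) \<Rightarrow> real" where "r t z = max 0 (a - Q t z / t)"

lemma q_cong: "(\<And>i. i < n \<Longrightarrow> x i = y i) \<Longrightarrow> j < n \<Longrightarrow> q j t x = q j t y"
  unfolding q_def by (intro arg_cong2[where f = "(-)"] u_cong) auto

lemma q_measurable [measurable]: "q j t \<in> borel_measurable (lebesgue_n n)"
proof -
  have "z(j := z j + t * v j) = (\<lambda>i. z i + (if i = j then t * v j else 0))" for z by auto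
  thus ?thesis unfolding q_def[abs_def] by simp
qed

lemma q_bound: "t \<ge> 0 \<Longrightarrow> j < n \<Longrightarrow> \<bar>q j t z\<bar> \<le> K * t * \<bar>v j\<bar>"
proof -
  assume t: "t \<ge> 0" and j: "j < n"
  have "n1 n (\<lambda>i. (z(j := z j + t * v j)) i - z i) = (\<Sum>i<n. if i = j then \<bar>t * v j\<bar> else 0)"
    unfolding n1_def by (intro sum.cong) auto
  also have "\<dots> = t * \<bar>v j\<bar>" using j t by (simp add: abs_mult)
  finally show ?thesis using lip[of "z(j := z j + t * v j)" z] by (simp add: q_def mult.assoc)
qed

lemma Q_measurable [measurable]: "Q t \<in> borel_measurable (lebesgue_n n)"
  unfolding Q_def[abs_def] by measurable

lemma Q_bound: "t \<ge> 0 \<Longrightarrow> \<bar>Q t z\<bar> \<le> K * t * n1 n v"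
proof -
  assume t: "t \<ge> 0"
  have "\<bar>Q t z\<bar> \<le> (\<Sum>j<n. K * t * \<bar>v j\<bar>)"
    unfolding Q_def by (rule order_trans[OF sum_abs sum_mono]) (use q_bound[OF t] in simp)
  thus ?thesis by (simp add: n1_def sum_distrib_left)
qed

lemma r_measurable [measurable]: "r t \<in> borel_measurable (lebesgue_n n)"
  unfolding r_def[abs_def] by measurable

lemma r_bound: "t > 0 \<Longrightarrow> \<bar>r t z\<bar> \<le> \<bar>a\<bar> + K * n1 n v"
proof -
  assume t: "t > 0"
  have "\<bar>Q t z / t\<bar> \<le> K * n1 n v"
    using Q_bound[of t z] t by (simp add: divide_le_eq mult_ac)
  moreover have "0 \<le> K * n1 n v" using K by simp
  ultimately show ?thesis unfolding r_def by linarith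
qed

lemma r_nonneg: "0 \<le> r t z" by (simp add: r_def)

lemma Q_ge: "t > 0 \<Longrightarrow> t * (a - r t z) \<le> Q t z"
proof -
  assume t: "t > 0"
  have "a - r t z \<le> Q t z / t" by (simp add: r_def)
  hence "t * (a - r t z) \<le> t * (Q t z / t)" using t by (intro mult_left_mono) auto
  thus ?thesis using t by simp
qed

lemma r_tendsto: "AE z in lebesgue_n n. (\<lambda>N. r (1 / real (Suc N)) z) \<longlonglongrightarrow> 0"
  using ae
proof eventually_elim
  case (elim z)
  let ?t = "\<lambda>N. 1 / real (Suc N)"
  have t0: "?t \<longlonglongrightarrow> 0" using LIMSEQ_inverse_real_of_nat unfolding inverse_eq_divide .
  have "(\<lambda>N. q j (?t N) z / ?t N) \<longlonglongrightarrow> v j * d j z" if j: "j < n" for j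
  proof -
    have "((\<lambda>s. u (z(j := z j + s * v j))) has_real_derivative d j z * v j) (at 0)"
      by (rule DERIV_chain2[where f = "\<lambda>t. u (z(j := t))" and g = "\<lambda>s. z j + s * v j"])
         (use elim j in \<open>auto intro!: derivative_eq_intros\<close>)
    hence lim: "((\<lambda>s. (u (z(j := z j + s * v j)) - u z) / s) \<longlongrightarrow> v j * d j z) (at 0)"
      by (simp add: DERIV_def mult.commute)
    have "filterlim ?t (at 0) sequentially"
      unfolding filterlim_at using t0 by auto
    from filterlim_compose[OF lim this] show ?thesis unfolding q_def .
  qed
  hence "(\<lambda>N. \<Sum>j<n. q j (?t N) z / ?t N) \<longlonglongrightarrow> (\<Sum>j<n. v j * d j z)" by (intro tendsto_sum) auto
  hence "(\<lambda>N. Q (?t N) z / ?t N) \<longlonglongrightarrow> (\<Sum>j<n. v j * d j z)"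
    by (simp only: Q_def sum_divide_distrib)
  hence "(\<lambda>N. max 0 (a - Q (?t N) z / ?t N)) \<longlonglongrightarrow> max 0 (a - (\<Sum>j<n. v j * d j z))"
    by (intro tendsto_max tendsto_diff tendsto_const)
  moreover have "max 0 (a - (\<Sum>j<n. v j * d j z)) = 0" using elim by simp
  ultimately show ?case by (simp only: r_def)
qed

lemma telescope: "u (\<lambda>i. z i + t * v i) - u z = (\<Sum>j<n. q j t (\<lambda>i. z i + t * (if i < j then v i else 0)))"
proof -
  define P where "P j = (\<lambda>i. z i + t * (if i < j then v i else 0))" for j
  have "q j t (P j) = u (P (Suc j)) - u (P j)" for j
  proof -
    have "(P j)(j := P j j + t * v j) = P (Suc j)" by (auto simp: P_def fun_eq_iff less_Suc_eq)
    thus ?thesis by (simp add: q_def)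
  qed
  hence "(\<Sum>j<n. q j t (P j)) = u (P n) - u (P 0)" using sum_lessThan_telescope[of "\<lambda>j. u (P j)" n] by simp
  also have "u (P n) = u (\<lambda>i. z i + t * v i)" by (rule u_cong) (simp add: P_def)
  also have "u (P 0) = u z" by (simp add: P_def)
  finally show ?thesis by (simp add: P_def)
qed

lemma one_step:
  assumes k: "k > 0" and t: "t > 0"
    and C: "\<And>z. mollifier n k w z \<le> C * mollifier n k x z" and R: "R = (LINT z|lebesgue_n n. mollifier n k x z)"
  shows "t * (a * R - C * (LINT z|lebesgue_n n. mollifier n k x z * r t z)
      - (exp (k * t * n1 n v) - 1) * K * n1 n v * R)
    \<le> (LINT z|lebesgue_n n. mollifier n k w z * (u (\<lambda>i. z i + t * v i) - u z))"
proof -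
  define G where "G = exp (k * t * n1 n v) - 1"
  have G: "G \<ge> 0" using k t by (simp add: G_def)
  have t': "t \<ge> 0" and k': "k \<ge> 0" using t k by simp_all
  have Rw: "(LINT z|lebesgue_n n. mollifier n k w z) = R" for w unfolding R mollifier_mass[OF k] ..
  note int = integrable_mollifier_mult[OF k]
  have iq: "integrable (lebesgue_n n) (\<lambda>z. mollifier n k w z * q j t z)" if "j < n" for j w
    by (rule int[OF q_measurable q_bound[OF t' that]])
  have step: "(LINT z|lebesgue_n n. mollifier n k w z * q j t z) - G * (K * t * \<bar>v j\<bar>) * R
      \<le> (LINT z|lebesgue_n n. mollifier n k w z * q j t (\<lambda>i. z i + t * (if i < j then v i else 0)))"
    if j: "j < n" for j
  proof -
    define w' where "w' i = w i + t * (if i < j then v i else 0)" for i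
    have "n1 n (\<lambda>i. w' i - w i) \<le> t * n1 n v"
      using mult_left_mono[OF n1_truncate_le t', of n j v] by (simp add: w'_def n1_scale abs_of_nonneg[OF t'])
    hence "k * n1 n (\<lambda>i. w' i - w i) \<le> k * (t * n1 n v)" using k' by (rule mult_left_mono)
    hence G': "exp (k * n1 n (\<lambda>i. w' i - w i)) - 1 \<le> G" by (simp add: G_def mult.assoc)
    have pw: "mollifier n k w z * q j t z - mollifier n k w z * (G * (K * t * \<bar>v j\<bar>)) \<le> mollifier n k w' z * q j t z" for z
    proof -
      have "\<bar>mollifier n k w' z - mollifier n k w z\<bar> \<le> G * mollifier n k w z"
        using mollifier_pos[of n k w z]
        by (intro order_trans[OF mollifier_diff_le[OF k'] mult_right_mono[OF G']]) simp
      hence "\<bar>mollifier n k w' z - mollifier n k w z\<bar> * \<bar>q j t z\<bar> \<le> (G * mollifier n k w z) * (K * t * \<bar>v j\<bar>)"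
        using q_bound[OF t' j, of z] G mollifier_pos[of n k w z] by (intro mult_mono) auto
      hence "\<bar>(mollifier n k w' z - mollifier n k w z) * q j t z\<bar> \<le> mollifier n k w z * (G * (K * t * \<bar>v j\<bar>))"
        by (simp add: abs_mult mult_ac)
      thus ?thesis unfolding left_diff_distrib by linarith
    qed
    have "(LINT z|lebesgue_n n. mollifier n k w z * q j t z) - G * (K * t * \<bar>v j\<bar>) * R
        = (LINT z|lebesgue_n n. mollifier n k w z * q j t z - mollifier n k w z * (G * (K * t * \<bar>v j\<bar>)))"
      using iq[OF j] integrable_mollifier[OF k, of n w] Rw[of w]
      by (subst Bochner_Integration.integral_diff) auto
    also have "\<dots> \<le> (LINT z|lebesgue_n n. mollifier n k w' z * q j t z)"
      by (intro integral_mono Bochner_Integration.integrable_diff iq j integrable_mult_left integrable_mollifier k pw)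
    also have "\<dots> = (LINT z|lebesgue_n n. mollifier n k w z * q j t (\<lambda>i. z i + t * (if i < j then v i else 0)))"
      unfolding w'_def
    proof (rule mollifier_integral_translate[OF q_measurable, symmetric])
      show "q j t y = q j t z" if "\<And>i. i < n \<Longrightarrow> y i = z i" for y z
        using that j by (rule q_cong)
    qed
    finally show ?thesis .
  qed
  have ir: "integrable (lebesgue_n n) (\<lambda>z. mollifier n k w z * r t z)" for w
    by (rule int[OF r_measurable r_bound[OF t]])
  have "t * (a * R - C * (LINT z|lebesgue_n n. mollifier n k x z * r t z))
      \<le> (LINT z|lebesgue_n n. mollifier n k w z * Q t z)"
  proof -
    have "(LINT z|lebesgue_n n. mollifier n k w z * r t z) \<le> (LINT z|lebesgue_n n. C * (mollifier n k x z * r t z))"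
    proof (intro integral_mono ir integrable_mult_right)
      show "mollifier n k w z * r t z \<le> C * (mollifier n k x z * r t z)" for z
        using mult_right_mono[OF C r_nonneg, of z t z] by (simp add: mult.assoc)
    qed
    hence "t * (LINT z|lebesgue_n n. mollifier n k w z * r t z) \<le> t * (C * (LINT z|lebesgue_n n. mollifier n k x z * r t z))"
      using t' by (intro mult_left_mono) simp_all
    hence "t * (a * R - C * (LINT z|lebesgue_n n. mollifier n k x z * r t z))
        \<le> t * a * R - t * (LINT z|lebesgue_n n. mollifier n k w z * r t z)"
      by (simp add: right_diff_distrib mult.assoc)
    also have "\<dots> = (LINT z|lebesgue_n n. mollifier n k w z * (t * a) - t * (mollifier n k w z * r t z))"
      using integrable_mollifier[OF k, of n w] ir[of w] Rw[of w]
      by (subst Bochner_Integration.integral_diff) (auto simp: mult_ac)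
    also have "\<dots> \<le> (LINT z|lebesgue_n n. mollifier n k w z * Q t z)"
    proof (intro integral_mono Bochner_Integration.integrable_diff integrable_mult_left integrable_mult_right
        integrable_mollifier k ir int[OF Q_measurable Q_bound[OF t']])
      show "mollifier n k w z * (t * a) - t * (mollifier n k w z * r t z) \<le> mollifier n k w z * Q t z" for z
        using mult_left_mono[OF Q_ge[OF t, of z], of "mollifier n k w z"] mollifier_pos[of n k w z]
        by (simp add: algebra_simps)
    qed
    finally show ?thesis .
  qed
  moreover have "(LINT z|lebesgue_n n. mollifier n k w z * Q t z) - t * (G * K * n1 n v * R)
      = (\<Sum>j<n. (LINT z|lebesgue_n n. mollifier n k w z * q j t z) - G * (K * t * \<bar>v j\<bar>) * R)"
  proof -
    have "(LINT z|lebesgue_n n. mollifier n k w z * Q t z) = (\<Sum>j<n. LINT z|lebesgue_n n. mollifier n k w z * q j t z)"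
      unfolding Q_def sum_distrib_left by (rule Bochner_Integration.integral_sum) (use iq in simp)
    moreover have "t * (G * K * n1 n v * R) = (\<Sum>j<n. G * (K * t * \<bar>v j\<bar>) * R)"
      by (simp add: n1_def sum_distrib_left sum_distrib_right mult_ac)
    ultimately show ?thesis by (simp add: sum_subtractf)
  qed
  moreover have "(\<Sum>j<n. (LINT z|lebesgue_n n. mollifier n k w z * q j t z) - G * (K * t * \<bar>v j\<bar>) * R)
      \<le> (\<Sum>j<n. LINT z|lebesgue_n n. mollifier n k w z * q j t (\<lambda>i. z i + t * (if i < j then v i else 0)))"
    by (rule sum_mono) (use step in simp)
  moreover have "(\<Sum>j<n. LINT z|lebesgue_n n. mollifier n k w z * q j t (\<lambda>i. z i + t * (if i < j then v i else 0)))
      = (LINT z|lebesgue_n n. mollifier n k w z * (u (\<lambda>i. z i + t * v i) - u z))"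
    unfolding telescope sum_distrib_left
  proof (rule Bochner_Integration.integral_sum[symmetric])
    fix j assume "j \<in> {..<n}"
    hence j: "j < n" by simp
    have "(\<lambda>z. q j t (\<lambda>i. z i + t * (if i < j then v i else 0))) \<in> borel_measurable (lebesgue_n n)"
    proof -
      have "q j t (\<lambda>i. z i + t * (if i < j then v i else 0)) =
          u (\<lambda>i. z i + t * (if i < Suc j then v i else 0)) - u (\<lambda>i. z i + t * (if i < j then v i else 0))" for z
      proof -
        have "(\<lambda>i. z i + t * (if i < j then v i else 0))(j := z j + t * v j) = (\<lambda>i. z i + t * (if i < Suc j then v i else 0))"
          by (auto simp: fun_eq_iff less_Suc_eq)
        thus ?thesis by (simp add: q_def)
      qed
      thus ?thesis by simp
    qed
    thus "integrable (lebesgue_n n) (\<lambda>z. mollifier n k w z * q j t (\<lambda>i. z i + t * (if i < j then v i else 0)))"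
      by (rule int) (rule q_bound[OF t' j])
  qed
  ultimately show ?thesis unfolding G_def by (simp only: right_diff_distrib)
qed

lemma mollified_increment:
  assumes k: "k > 0"
  shows "a * (LINT z|lebesgue_n n. mollifier n k x z)
    \<le> (LINT z|lebesgue_n n. mollifier n k x z * (u (\<lambda>i. z i + v i) - u z))"
proof -
  define R where "R = (LINT z|lebesgue_n n. mollifier n k x z)"
  define C where "C = exp (k * n1 n v)"
  define \<rho> where "\<rho> t = (LINT z|lebesgue_n n. mollifier n k x z * r t z)" for t
  let ?t = "\<lambda>N. 1 / real (Suc N)"
  have main: "a * R - C * \<rho> (?t N) - (exp (k * ?t N * n1 n v) - 1) * K * n1 n v * R
     \<le> (LINT z|lebesgue_n n. mollifier n k x z * (u (\<lambda>i. z i + v i) - u z))" for N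
  proof -
    define t where "t = ?t N"
    have t: "t > 0" by (simp add: t_def)
    define B where "B = t * (a * R - C * \<rho> t - (exp (k * t * n1 n v) - 1) * K * n1 n v * R)"
    define p where "p s z = u (\<lambda>i. z i + s * v i)" for s z
    have inc: "B \<le> (LINT z|lebesgue_n n. mollifier n k x z * (p (real (Suc m) * t) z - p (real m * t) z))" if m: "m < Suc N" for m
    proof -
      define h where "h i = real m * t * v i" for i
      have mt: "real m * t \<le> 1" "0 \<le> real m * t" using m by (simp_all add: t_def)
      have "mollifier n k (\<lambda>i. x i + h i) z \<le> C * mollifier n k x z" for z
      proof -
        have "n1 n h \<le> 1 * n1 n v"
          unfolding h_def n1_scale using mt by (intro mult_right_mono) auto
        hence "k * n1 n h \<le> k * n1 n v" using k by simp
        hence "exp (k * n1 n h) * mollifier n k x z \<le> C * mollifier n k x z"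
          using mollifier_pos[of n k x z] by (intro mult_right_mono) (auto simp: C_def)
        thus ?thesis using mollifier_le[of k n "\<lambda>i. x i + h i" z x] k by simp
      qed
      from one_step[OF k t this R_def]
      have "B \<le> (LINT z|lebesgue_n n. mollifier n k (\<lambda>i. x i + h i) z * (u (\<lambda>i. z i + t * v i) - u z))"
        by (simp only: B_def \<rho>_def)
      also have "\<dots> = (LINT z|lebesgue_n n. mollifier n k x z * (u (\<lambda>i. (z i + h i) + t * v i) - u (\<lambda>i. z i + h i)))"
      proof (rule mollifier_integral_translate[symmetric])
        show "(\<lambda>z. u (\<lambda>i. z i + t * v i) - u z) \<in> borel_measurable (lebesgue_n n)" by measurable
        show "u (\<lambda>i. y i + t * v i) - u y = u (\<lambda>i. z i + t * v i) - u z" if "\<And>i. i < n \<Longrightarrow> y i = z i" for y z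
          using that by (intro arg_cong2[where f = "(-)"] u_cong) auto
      qed
      also have "\<dots> = (LINT z|lebesgue_n n. mollifier n k x z * (p (real (Suc m) * t) z - p (real m * t) z))"
        by (simp add: p_def h_def algebra_simps)
      finally show ?thesis .
    qed
    have ip: "integrable (lebesgue_n n) (\<lambda>z. mollifier n k x z * (p s z - p s' z))" for s s'
    proof (rule integrable_mollifier_mult[OF k])
      show "(\<lambda>z. p s z - p s' z) \<in> borel_measurable (lebesgue_n n)" unfolding p_def by measurable
      show "\<bar>p s z - p s' z\<bar> \<le> K * n1 n (\<lambda>i. s * v i - s' * v i)" for z
        using lip[of "\<lambda>i. z i + s * v i" "\<lambda>i. z i + s' * v i"] by (simp add: p_def)
    qed
    have "real (Suc N) * B = (\<Sum>m<Suc N. B)" by simp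
    also have "\<dots> \<le> (\<Sum>m<Suc N. (LINT z|lebesgue_n n. mollifier n k x z * (p (real (Suc m) * t) z - p (real m * t) z)))"
      by (rule sum_mono) (use inc in simp)
    also have "\<dots> = (LINT z|lebesgue_n n. (\<Sum>m<Suc N. mollifier n k x z * (p (real (Suc m) * t) z - p (real m * t) z)))"
      by (rule Bochner_Integration.integral_sum[symmetric]) (rule ip)
    also have "\<dots> = (LINT z|lebesgue_n n. mollifier n k x z * (p (real (Suc N) * t) z - p (real 0 * t) z))"
    proof -
      have "(\<Sum>m<Suc N. p (real (Suc m) * t) z - p (real m * t) z) = p (real (Suc N) * t) z - p (real 0 * t) z" for z
        using sum_lessThan_telescope[of "\<lambda>m. p (real m * t) z" "Suc N"] .
      thus ?thesis by (simp only: sum_distrib_left[symmetric])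
    qed
    also have "\<dots> = (LINT z|lebesgue_n n. mollifier n k x z * (u (\<lambda>i. z i + v i) - u z))"
      by (simp add: p_def t_def)
    finally have "real (Suc N) * B \<le> (LINT z|lebesgue_n n. mollifier n k x z * (u (\<lambda>i. z i + v i) - u z))" .
    moreover have "real (Suc N) * B = a * R - C * \<rho> t - (exp (k * t * n1 n v) - 1) * K * n1 n v * R"
      unfolding B_def mult.assoc[symmetric] by (simp add: t_def)
    ultimately show ?thesis by (simp only: t_def)
  qed
  have t0: "?t \<longlonglongrightarrow> 0" using LIMSEQ_inverse_real_of_nat unfolding inverse_eq_divide .
  have "(\<lambda>N. \<rho> (?t N)) \<longlonglongrightarrow> (LINT z|lebesgue_n n. 0)"
    unfolding \<rho>_def
  proof (rule integral_dominated_convergence[where w = "\<lambda>z. mollifier n k x z * (\<bar>a\<bar> + K * n1 n v)"])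
    show "AE z in lebesgue_n n. (\<lambda>N. mollifier n k x z * r (?t N) z) \<longlonglongrightarrow> 0"
      using r_tendsto by eventually_elim (rule tendsto_mult_right_zero)
    show "AE z in lebesgue_n n. norm (mollifier n k x z * r (?t N) z) \<le> mollifier n k x z * (\<bar>a\<bar> + K * n1 n v)" for N
      unfolding real_norm_def abs_mult abs_of_pos[OF mollifier_pos]
      by (intro AE_I2 mult_left_mono r_bound less_imp_le[OF mollifier_pos]) simp
    show "integrable (lebesgue_n n) (\<lambda>z. mollifier n k x z * (\<bar>a\<bar> + K * n1 n v))"
      by (intro integrable_mult_left integrable_mollifier k)
  qed measurable
  hence "(\<lambda>N. \<rho> (?t N)) \<longlonglongrightarrow> 0" by simp
  hence "(\<lambda>N. a * R - C * \<rho> (?t N) - (exp (k * ?t N * n1 n v) - 1) * K * n1 n v * R)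
      \<longlonglongrightarrow> a * R - C * 0 - (exp (k * 0 * n1 n v) - 1) * K * n1 n v * R"
    by (intro tendsto_intros t0)
  hence "(\<lambda>N. a * R - C * \<rho> (?t N) - (exp (k * ?t N * n1 n v) - 1) * K * n1 n v * R) \<longlonglongrightarrow> a * R" by simp
  from LIMSEQ_le_const2[OF this] main show ?thesis unfolding R_def by blast
qed

theorem increment_ge: "a \<le> u (\<lambda>i. x i + v i) - u x"
proof -
  define W where "W z = u (\<lambda>i. z i + v i) - u z - a" for z
  have int: "integrable (lebesgue_n n) (\<lambda>z. mollifier n k x z * (u (\<lambda>i. z i + v i) - u z))" if k: "k > 0" for k
  proof (rule integrable_mollifier_mult[OF k])
    show "(\<lambda>z. u (\<lambda>i. z i + v i) - u z) \<in> borel_measurable (lebesgue_n n)" by measurable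
    show "\<bar>u (\<lambda>i. z i + v i) - u z\<bar> \<le> K * n1 n v" for z
      using lip[of "\<lambda>i. z i + v i" z] by simp
  qed
  have W: "mollifier n k x z * W z = mollifier n k x z * (u (\<lambda>i. z i + v i) - u z) - mollifier n k x z * a" for k z
    by (simp add: W_def right_diff_distrib)
  have "0 \<le> W x"
  proof (rule nonneg_of_mollified_nonneg[where n = n and W = W and x = x])
    show "\<bar>W z - W z'\<bar> \<le> (2 * K) * n1 n (\<lambda>i. z i - z' i)" for z z'
      using lip[of "\<lambda>i. z i + v i" "\<lambda>i. z' i + v i"] lip[of z z'] by (simp add: W_def)
    show "integrable (lebesgue_n n) (\<lambda>z. mollifier n k x z * W z)" if "k > 0" for k
      unfolding W by (intro Bochner_Integration.integrable_diff int that integrable_mult_left integrable_mollifier)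
    show "0 \<le> (LINT z|lebesgue_n n. mollifier n k x z * W z)" if k: "k > 0" for k
      unfolding W using mollified_increment[OF k, of x] int[OF k] integrable_mollifier[OF k, of n x]
      by (subst Bochner_Integration.integral_diff) (auto simp: mult.commute)
  qed (use K in simp)
  thus ?thesis by (simp add: W_def)
qed

end

section \<open>The potential of a member of the family\<close>

definition ext :: "nat \<Rightarrow> (nat \<Rightarrow> real) \<Rightarrow> nat \<Rightarrow> real" where "ext n x = restrict x {..<n}"

lemma ext_in_Rn [simp]: "ext n x \<in> Rn n" by (simp add: ext_def Rn_def)

lemma ext_Rn: "x \<in> Rn n \<Longrightarrow> ext n x = x"
  by (auto simp: ext_def Rn_def PiE_def extensional_def restrict_def fun_eq_iff)

lemma ext_upd: "i < n \<Longrightarrow> ext n (x(i := t)) = (ext n x)(i := t)"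
  by (auto simp: ext_def restrict_def fun_eq_iff)

lemma ext_apply [simp]: "i < n \<Longrightarrow> ext n x i = x i" by (simp add: ext_def)

lemma ext_cong: "(\<And>i. i < n \<Longrightarrow> x i = y i) \<Longrightarrow> ext n x = ext n y"
  by (auto simp: ext_def fun_eq_iff)

lemma space_eq_Rn: "space (lebesgue_n n) = Rn n" by (simp add: Rn_def)

lemma norm_n_sq: "(norm_n n v)\<^sup>2 = nsq n v"
  by (simp add: norm_n_def L2_set_def nsq_def sum_nonneg)

lemma norm_n_le_n1: "norm_n n v \<le> n1 n v"
  unfolding norm_n_def n1_def by (rule L2_set_le_sum_abs)

lemma coord_le_norm_n: "i < n \<Longrightarrow> \<bar>v i\<bar> \<le> norm_n n v"
  unfolding norm_n_def
proof -
  assume i: "i < n"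
  have "\<bar>v i\<bar> \<le> L2_set (\<lambda>i. \<bar>v i\<bar>) {..<n}" using i by (intro member_le_L2_set) auto
  thus "\<bar>v i\<bar> \<le> L2_set v {..<n}" by (simp add: L2_set_def)
qed

lemma partial_deriv: "has_partial i g x \<Longrightarrow> ((\<lambda>t. g (x(i := t))) has_real_derivative partial i g x) (at (x i))"
  unfolding has_partial_def partial_def by (rule field_differentiable_derivI)

lemma has_real_derivative_of_quadratic_error:
  fixes g :: "real \<Rightarrow> real"
  assumes "\<And>h. \<bar>g (s + h) - g s - h * c\<bar> \<le> K * h\<^sup>2"
  shows "(g has_real_derivative c) (at s)"
proof -
  have "((\<lambda>h. (g (s + h) - g s) / h - c) \<longlongrightarrow> 0) (at 0)"
  proof (rule Lim_null_comparison)
    have "norm ((g (s + h) - g s) / h - c) \<le> K * \<bar>h\<bar>" if "h \<noteq> 0" for h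
    proof -
      have "(g (s + h) - g s) / h - c = (g (s + h) - g s - h * c) / h" using that by (simp add: field_simps)
      hence "norm ((g (s + h) - g s) / h - c) = \<bar>g (s + h) - g s - h * c\<bar> / \<bar>h\<bar>" by simp
      also have "\<dots> \<le> K * h\<^sup>2 / \<bar>h\<bar>" by (intro divide_right_mono assms) simp
      also have "\<dots> = K * \<bar>h\<bar>" using that by (simp add: power2_eq_square field_simps abs_mult_self_eq)
      finally show ?thesis .
    qed
    thus "\<forall>\<^sub>F h in at 0. norm ((g (s + h) - g s) / h - c) \<le> K * \<bar>h\<bar>"
      by (auto simp: eventually_at intro!: exI[of _ 1])
    have "((\<lambda>h. K * \<bar>h\<bar>) \<longlongrightarrow> K * \<bar>0\<bar>) (at 0)" by (intro tendsto_intros)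
    thus "((\<lambda>h. K * \<bar>h\<bar>) \<longlongrightarrow> 0) (at 0)" by simp
  qed
  thus ?thesis unfolding DERIV_def by (simp add: LIM_zero_iff)
qed

locale family_member =
  fixes n :: nat and \<epsilon> M L :: real and h :: "(nat \<Rightarrow> real) \<Rightarrow> real"
  assumes eps: "\<epsilon> > 0"
    and hp: "\<And>x i. x \<in> Rn n \<Longrightarrow> i < n \<Longrightarrow> has_partial i h x"
    and hL: "\<And>x y. x \<in> Rn n \<Longrightarrow> y \<in> Rn n \<Longrightarrow>
        norm_n n (\<lambda>i. grad h x i - grad h y i) \<le> L * norm_n n (\<lambda>i. x i - y i)"
    and hess: "hessian_between n (- 1 + \<epsilon>) M h"
begin

definition P :: "nat \<Rightarrow> (nat \<Rightarrow> real) \<Rightarrow> real" where "P i x = partial i h (ext n x)"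

definition V :: "(nat \<Rightarrow> real) \<Rightarrow> real" where
  "V x = h (ext n x) + nsq n x / 2 + real n / 2 * ln (2 * pi)"

definition D :: "nat \<Rightarrow> (nat \<Rightarrow> real) \<Rightarrow> real" where "D i x = P i x + x i"

lemma P_lip: "i < n \<Longrightarrow> \<bar>P i x - P i y\<bar> \<le> \<bar>L\<bar> * n1 n (\<lambda>j. x j - y j)"
proof -
  assume i: "i < n"
  have "\<bar>P i x - P i y\<bar> \<le> norm_n n (\<lambda>i. grad h (ext n x) i - grad h (ext n y) i)"
    using coord_le_norm_n[OF i, of "\<lambda>i. grad h (ext n x) i - grad h (ext n y) i"] by (simp add: grad_def P_def)
  also have "\<dots> \<le> L * norm_n n (\<lambda>i. ext n x i - ext n y i)" by (rule hL) simp_all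
  also have "\<dots> \<le> \<bar>L\<bar> * norm_n n (\<lambda>i. ext n x i - ext n y i)"
    by (intro mult_right_mono) (simp_all add: norm_n_def)
  also have "\<dots> \<le> \<bar>L\<bar> * n1 n (\<lambda>i. ext n x i - ext n y i)" by (intro mult_left_mono norm_n_le_n1) simp
  also have "n1 n (\<lambda>i. ext n x i - ext n y i) = n1 n (\<lambda>i. x i - y i)" by (simp add: n1_def)
  finally show ?thesis .
qed

definition u :: "(nat \<Rightarrow> real) \<Rightarrow> (nat \<Rightarrow> real) \<Rightarrow> real" where "u v x = (\<Sum>i<n. v i * P i x)"

lemma u_lip: "\<bar>u v x - u v y\<bar> \<le> (\<bar>L\<bar> * n1 n v) * n1 n (\<lambda>j. x j - y j)"
proof -
  have "\<bar>u v x - u v y\<bar> \<le> (\<Sum>i<n. \<bar>v i\<bar> * \<bar>P i x - P i y\<bar>)"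
    unfolding u_def sum_subtractf[symmetric] right_diff_distrib[symmetric]
    by (rule order_trans[OF sum_abs]) (simp add: abs_mult)
  also have "\<dots> \<le> (\<Sum>i<n. \<bar>v i\<bar> * (\<bar>L\<bar> * n1 n (\<lambda>j. x j - y j)))"
    by (intro sum_mono mult_left_mono P_lip) simp_all
  also have "\<dots> = n1 n v * (\<bar>L\<bar> * n1 n (\<lambda>j. x j - y j))"
    unfolding n1_def[of n v] by (rule sum_distrib_right[symmetric])
  finally show ?thesis by (simp add: mult_ac)
qed

lemma hess_AE: "AE z in lebesgue_n n.
    (\<forall>j<n. ((\<lambda>t. u v (z(j := t))) has_real_derivative (\<Sum>i<n. v i * hess h z i j)) (at (z j)))
    \<and> (- 1 + \<epsilon>) * nsq n v \<le> (\<Sum>j<n. v j * (\<Sum>i<n. v i * hess h z i j))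
    \<and> (\<Sum>j<n. v j * (\<Sum>i<n. v i * hess h z i j)) \<le> M * nsq n v"
  using hess[unfolded hessian_between_def] AE_space
proof eventually_elim
  case (elim z)
  have z: "z \<in> Rn n" using elim(2) unfolding space_eq_Rn .
  have "((\<lambda>t. u v (z(j := t))) has_real_derivative (\<Sum>i<n. v i * hess h z i j)) (at (z j))" if j: "j < n" for j
  proof -
    have "((\<lambda>t. \<Sum>i<n. v i * partial i h (z(j := t))) has_real_derivative (\<Sum>i<n. v i * hess h z i j)) (at (z j))"
      unfolding hess_def
      by (intro DERIV_sum DERIV_cmult partial_deriv) (use elim(1) j in simp)
    moreover have "u v (z(j := t)) = (\<Sum>i<n. v i * partial i h (z(j := t)))" for t
      unfolding u_def P_def ext_upd[OF j] ext_Rn[OF z] ..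
    ultimately show ?thesis by simp
  qed
  moreover have "(\<Sum>j<n. v j * (\<Sum>i<n. v i * hess h z i j)) = (\<Sum>i<n. \<Sum>j<n. v i * hess h z i j * v j)"
    by (subst sum.swap) (simp add: sum_distrib_left mult_ac)
  ultimately show ?case using elim(1) by (simp add: norm_n_sq)
qed

lemma u_increment_ge: "(- 1 + \<epsilon>) * nsq n v \<le> u v (\<lambda>i. x i + v i) - u v x"
proof -
  interpret lipschitz_directional n "\<bar>L\<bar> * n1 n v" "(- 1 + \<epsilon>) * nsq n v" "u v" v "\<lambda>j z. \<Sum>i<n. v i * hess h z i j"
  proof
    show "AE z in lebesgue_n n.
      (\<forall>j<n. ((\<lambda>t. u v (z(j := t))) has_real_derivative (\<Sum>i<n. v i * hess h z i j)) (at (z j)))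
      \<and> (- 1 + \<epsilon>) * nsq n v \<le> (\<Sum>j<n. v j * (\<Sum>i<n. v i * hess h z i j))"
      using hess_AE[of v] by eventually_elim simp
  qed (simp, rule u_lip)
  show ?thesis by (rule increment_ge)
qed

lemma u_increment_le: "u v (\<lambda>i. x i + v i) - u v x \<le> M * nsq n v"
proof -
  interpret lipschitz_directional n "\<bar>L\<bar> * n1 n v" "- (M * nsq n v)" "\<lambda>x. - u v x" v "\<lambda>j z. - (\<Sum>i<n. v i * hess h z i j)"
  proof
    show "\<bar>- u v x - - u v y\<bar> \<le> (\<bar>L\<bar> * n1 n v) * n1 n (\<lambda>j. x j - y j)" for x y
      using u_lip[of v x y] by simp
    show "AE z in lebesgue_n n.
      (\<forall>j<n. ((\<lambda>t. - u v (z(j := t))) has_real_derivative - (\<Sum>i<n. v i * hess h z i j)) (at (z j)))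
      \<and> - (M * nsq n v) \<le> (\<Sum>j<n. v j * - (\<Sum>i<n. v i * hess h z i j))"
      using hess_AE[of v] by eventually_elim (simp add: sum_negf DERIV_minus)
  qed simp
  show ?thesis using increment_ge[of x] by simp
qed

lemma V_deriv: "i < n \<Longrightarrow> ((\<lambda>t. V (x(i := t))) has_real_derivative D i x) (at (x i))"
proof -
  assume i: "i < n"
  have "((\<lambda>t. h ((ext n x)(i := t))) has_real_derivative P i x) (at (x i))"
    using partial_deriv[OF hp[OF ext_in_Rn i], of x] i by (simp add: P_def)
  moreover have "nsq n (x(i := t)) = t\<^sup>2 + (\<Sum>j\<in>{..<n} - {i}. (x j)\<^sup>2)" for t
    unfolding nsq_def using i by (subst sum.remove[of _ i]) auto
  ultimately show ?thesis unfolding V_def D_def ext_upd[OF i]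
    by (auto intro!: derivative_eq_intros)
qed

lemma D_lip: "i < n \<Longrightarrow> \<bar>D i x - D i y\<bar> \<le> (\<bar>L\<bar> + 1) * n1 n (\<lambda>j. x j - y j)"
  using P_lip[of i x y] coord_le_n1[of i n "\<lambda>j. x j - y j"] by (simp add: D_def distrib_right)

lemma V_cong: "(\<And>i. i < n \<Longrightarrow> x i = y i) \<Longrightarrow> V x = V y"
  using ext_cong[of n x y] by (simp add: V_def nsq_def)

lemma V_strongly_convex:
  assumes s: "0 \<le> s" "s \<le> 1"
  shows "V (\<lambda>i. (1 - s) * x i + s * y i) \<le> (1 - s) * V x + s * V y - \<epsilon> * s * (1 - s) / 2 * nsq n (\<lambda>i. x i - y i)"
proof -
  define w where "w i = y i - x i" for i
  define p where "p t = (\<lambda>i. x i + t * w i)" for t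
  define g where "g t = V (p t)" for t
  define g' where "g' t = (\<Sum>i<n. D i (p t) * w i)" for t
  have dg: "(g has_real_derivative g' t) (at t)" for t
  proof (rule has_real_derivative_of_quadratic_error)
    fix k
    have "\<bar>V (\<lambda>i. p t i + k * w i) - V (p t) - (\<Sum>i<n. D i (p t) * (k * w i))\<bar> \<le> (\<bar>L\<bar> + 1) * (n1 n (\<lambda>i. k * w i))\<^sup>2"
    proof (rule taylor_of_lipschitz_partials[where V = V and D = D])
      show "V a = V b" if "\<And>i. i < n \<Longrightarrow> a i = b i" for a b using that by (rule V_cong)
    qed (simp, rule V_deriv, assumption, rule D_lip, assumption)
    moreover have "(\<lambda>i. p t i + k * w i) = p (t + k)" by (auto simp: p_def algebra_simps)
    moreover have "(\<Sum>i<n. D i (p t) * (k * w i)) = k * g' t" by (simp add: g'_def sum_distrib_left mult_ac)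
    moreover have "(n1 n (\<lambda>i. k * w i))\<^sup>2 = (n1 n w)\<^sup>2 * k\<^sup>2" by (simp add: n1_scale power_mult_distrib)
    ultimately show "\<bar>g (t + k) - g t - k * g' t\<bar> \<le> ((\<bar>L\<bar> + 1) * (n1 n w)\<^sup>2) * k\<^sup>2"
      by (simp add: g_def mult.assoc)
  qed
  define \<kappa> where "\<kappa> = \<epsilon> * nsq n w"
  have mono: "- g' b - - g' a \<le> - \<kappa> * (b - a)" if ab: "a \<le> b" for a b
  proof (cases "a = b")
    case False
    define v where "v i = (b - a) * w i" for i
    have "(- 1 + \<epsilon>) * nsq n v \<le> u v (\<lambda>i. p a i + v i) - u v (p a)" by (rule u_increment_ge)
    moreover have "(\<lambda>i. p a i + v i) = p b" by (auto simp: p_def v_def algebra_simps)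
    moreover have "nsq n v = (b - a) * ((b - a) * nsq n w)"
      by (simp add: nsq_def v_def power_mult_distrib power2_eq_square sum_distrib_left mult_ac)
    moreover have "u v z = (b - a) * u w z" for z by (simp add: u_def v_def sum_distrib_left mult_ac)
    ultimately have "(b - a) * ((- 1 + \<epsilon>) * ((b - a) * nsq n w)) \<le> (b - a) * (u w (p b) - u w (p a))"
      by (simp add: algebra_simps)
    moreover have "0 < b - a" using ab False by simp
    ultimately have "(- 1 + \<epsilon>) * ((b - a) * nsq n w) \<le> u w (p b) - u w (p a)"
      by (simp only: mult_le_cancel_left_pos)
    moreover have "g' t = u w (p t) + (\<Sum>i<n. x i * w i) + t * nsq n w" for t
      by (simp add: g'_def u_def D_def p_def nsq_def power2_eq_square sum.distrib sum_distrib_left algebra_simps)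
    ultimately show ?thesis by (simp add: \<kappa>_def algebra_simps)
  qed simp
  have ub: "- g t \<le> - g s + - g' s * (t - s) + - \<kappa> / 2 * (t - s)\<^sup>2" for t
    by (rule quadratic_upper_bound[of "\<lambda>t. - g t" "\<lambda>t. - g' t"]) (use mono in \<open>auto intro: DERIV_minus dg\<close>)
  have "(1 - s) * (- g 0) + s * (- g 1)
      \<le> (1 - s) * (- g s + - g' s * (0 - s) + - \<kappa> / 2 * (0 - s)\<^sup>2) + s * (- g s + - g' s * (1 - s) + - \<kappa> / 2 * (1 - s)\<^sup>2)"
    using s by (intro add_mono mult_left_mono ub) auto
  also have "\<dots> = - g s - \<kappa> / 2 * (s * (1 - s))" by (simp add: power2_eq_square field_simps)
  finally have "g s \<le> (1 - s) * g 0 + s * g 1 - \<kappa> / 2 * (s * (1 - s))" by simp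
  moreover have "p s = (\<lambda>i. (1 - s) * x i + s * y i)" "p 0 = x" "p 1 = y"
    by (auto simp: p_def w_def algebra_simps)
  moreover have "nsq n w = nsq n (\<lambda>i. x i - y i)" by (simp add: nsq_def w_def power2_commute)
  ultimately show ?thesis by (simp add: g_def \<kappa>_def mult_ac)
qed

lemma D_upper:
  assumes i: "i < n" and st: "s \<le> t"
  shows "D i (x(i := t)) - D i (x(i := s)) \<le> (1 + M) * (t - s)"
proof (cases "s = t")
  case False
  define v where "v j = (if j = i then t - s else 0)" for j
  have "u v (\<lambda>j. (x(i := s)) j + v j) - u v (x(i := s)) \<le> M * nsq n v" by (rule u_increment_le)
  moreover have "(\<lambda>j. (x(i := s)) j + v j) = x(i := t)" by (auto simp: v_def)
  moreover have "u v z = (t - s) * P i z" for z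
    unfolding u_def v_def using i by (simp add: if_distrib[of "\<lambda>a. a * _"] cong: if_cong)
  moreover have "nsq n v = (t - s) * (t - s)"
  proof -
    have "nsq n v = (\<Sum>j<n. if j = i then (t - s) * (t - s) else 0)"
      unfolding nsq_def by (intro sum.cong) (auto simp: v_def power2_eq_square)
    thus ?thesis using i by simp
  qed
  ultimately have "(t - s) * (P i (x(i := t)) - P i (x(i := s))) \<le> (t - s) * (M * (t - s))"
    by (simp add: algebra_simps)
  moreover have "0 < t - s" using st False by simp
  ultimately have "P i (x(i := t)) - P i (x(i := s)) \<le> M * (t - s)"
    by (simp only: mult_le_cancel_left_pos)
  thus ?thesis by (simp add: D_def algebra_simps)
qed simp

sublocale potential n \<epsilon> "1 + M" "\<bar>L\<bar> + 1" V D
proof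
  show "D j x = D j y" if "j < n" "\<And>i. i < n \<Longrightarrow> x i = y i" for j x y
    using ext_cong[OF that(2)] that by (simp add: D_def P_def)
  show "V x = V y" if "\<And>i. i < n \<Longrightarrow> x i = y i" for x y using that by (rule V_cong)
  show "0 \<le> \<bar>L\<bar> + 1" by simp
qed (rule eps V_deriv D_lip V_strongly_convex D_upper; assumption)+

definition f :: "(nat \<Rightarrow> real) \<Rightarrow> real" where "f x = exp (- h x)"

lemma h_eq: "x \<in> Rn n \<Longrightarrow> h x = V x - nsq n x / 2 - real n / 2 * ln (2 * pi)"
  by (simp add: V_def ext_Rn)

lemma gauss_integral:
  assumes g: "g \<in> borel_measurable (lebesgue_n n)" and eq: "\<And>x. x \<in> Rn n \<Longrightarrow> F x = g x * f x"
  shows "(LINT x|gauss n. F x) = (LINT x|lebesgue_n n. g x * exp (- V x))"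
proof -
  have dens: "(2 * pi) powr (- real n / 2) * exp (- (norm_n n x)\<^sup>2 / 2) * F x = g x * exp (- V x)"
    if "x \<in> Rn n" for x
  proof -
    have "(2 * pi) powr (- real n / 2) * exp (- (norm_n n x)\<^sup>2 / 2) * f x = exp (- V x)"
      unfolding f_def h_eq[OF that] norm_n_sq powr_def by (simp add: exp_add[symmetric])
    thus ?thesis by (simp add: eq[OF that] mult_ac)
  qed
  have m: "(\<lambda>x. g x * exp (- V x)) \<in> borel_measurable (lebesgue_n n)" using g by measurable
  have normm: "(\<lambda>x. (2 * pi) powr (- real n / 2) * exp (- (norm_n n x)\<^sup>2 / 2)) \<in> borel_measurable (lebesgue_n n)"
    unfolding norm_n_sq by measurable
  define G where "G x = g x * exp (- V x) * ((2 * pi) powr (real n / 2) * exp (nsq n x / 2))" for x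
  have "F x = G x" if "x \<in> space (lebesgue_n n)" for x
  proof -
    have x: "x \<in> Rn n" using that unfolding space_eq_Rn .
    show ?thesis unfolding G_def dens[OF x, symmetric] norm_n_sq
      by (simp add: powr_minus exp_minus field_simps)
  qed
  hence "F \<in> borel_measurable (lebesgue_n n) \<longleftrightarrow> G \<in> borel_measurable (lebesgue_n n)"
    by (rule measurable_cong)
  moreover have "G \<in> borel_measurable (lebesgue_n n)"
    unfolding G_def[abs_def] using g by measurable
  ultimately have Fm: "F \<in> borel_measurable (lebesgue_n n)" by simp
  have "(LINT x|gauss n. F x) =
      (LINT x|lebesgue_n n. ((2 * pi) powr (- real n / 2) * exp (- (norm_n n x)\<^sup>2 / 2)) *\<^sub>R F x)"
    unfolding gauss_def by (rule integral_density[OF Fm normm]) simp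
  also have "\<dots> = (LINT x|lebesgue_n n. g x * exp (- V x))"
  proof (rule Bochner_Integration.integral_cong[OF refl])
    fix x assume "x \<in> space (lebesgue_n n)"
    hence "x \<in> Rn n" unfolding space_eq_Rn .
    thus "((2 * pi) powr (- real n / 2) * exp (- (norm_n n x)\<^sup>2 / 2)) *\<^sub>R F x = g x * exp (- V x)"
      unfolding real_scaleR_def by (rule dens)
  qed
  finally show ?thesis .
qed

lemma L1_norm_f: "L1_norm n f = (LINT x|lebesgue_n n. exp (- V x))"
  unfolding L1_norm_def using gauss_integral[of "\<lambda>_. 1" "\<lambda>x. \<bar>f x\<bar>"] by (simp add: f_def)

lemma entropy_f: 
  assumes "L1_norm n f = 1"
  shows "Ent n f = (LINT x|lebesgue_n n. (nsq n x / 2 - V x) * exp (- V x)) + real n / 2 * ln (2 * pi)"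
proof -
  let ?k = "real n / 2 * ln (2 * pi)"
  have mass: "(LINT x|lebesgue_n n. exp (- V x)) = 1" using assms by (simp add: L1_norm_f)
  have q: "quad_bdd_n n (\<lambda>x. nsq n x / 2 - V x)"
    unfolding nsq_def by (intro quad_bdd_diff quad_bdd_divide quad_bdd_sum quad_bdd_power2 coord_lin V_quad) simp
  have "(LINT x|gauss n. f x * ln (f x)) = (LINT x|lebesgue_n n. (nsq n x / 2 - V x + ?k) * exp (- V x))"
    by (rule gauss_integral) (measurable, simp add: f_def h_eq)
  also have "\<dots> = (LINT x|lebesgue_n n. (nsq n x / 2 - V x) * exp (- V x)) + ?k"
  proof -
    have "(nsq n x / 2 - V x + ?k) * exp (- V x) = (nsq n x / 2 - V x) * exp (- V x) + ?k * exp (- V x)" for x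
      by (rule distrib_right)
    thus ?thesis using quad_integrable[OF q] exp_integrable mass by simp
  qed
  finally show ?thesis by (simp add: Ent_def assms)
qed

lemma partial_f: "x \<in> Rn n \<Longrightarrow> i < n \<Longrightarrow> partial i f x = - partial i h x * f x"
proof -
  assume x: "x \<in> Rn n" and i: "i < n"
  have "((\<lambda>t. f (x(i := t))) has_real_derivative - partial i h x * f x) (at (x i))"
  proof -
    have "((\<lambda>t. exp (- h (x(i := t)))) has_real_derivative exp (- h (x(i := x i))) * - partial i h x) (at (x i))"
      by (rule DERIV_fun_exp[OF DERIV_minus[OF partial_deriv[OF hp[OF x i]]]])
    moreover have "exp (- h (x(i := x i))) * - partial i h x = - partial i h x * exp (- h x)" by simp
    ultimately show ?thesis by (simp only: f_def)
  qed
  thus ?thesis unfolding partial_def[of i f] by (rule DERIV_imp_deriv)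
qed

lemma Fisher_f: "Fisher n f = (\<Sum>i<n. LINT x|lebesgue_n n. (D i x - x i)\<^sup>2 * exp (- V x))"
proof -
  have q: "quad_bdd_n n (\<lambda>x. (D i x - x i)\<^sup>2)" if "i < n" for i
    using that by (intro quad_bdd_power2 lin_bdd_diff D_lin coord_lin)
  have "Fisher n f = (LINT x|lebesgue_n n. (\<Sum>i<n. (D i x - x i)\<^sup>2) * exp (- V x))"
    unfolding Fisher_def
  proof (rule gauss_integral)
    show "(\<lambda>x. \<Sum>i<n. (D i x - x i)\<^sup>2) \<in> borel_measurable (lebesgue_n n)"
      using q by (intro borel_measurable_sum) (auto simp: quad_bdd_def)
    fix x assume x: "x \<in> Rn n"
    have "(norm_n n (grad f x))\<^sup>2 = (\<Sum>i<n. (D i x - x i)\<^sup>2 * (f x)\<^sup>2)"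
      unfolding norm_n_sq nsq_def grad_def
      by (intro sum.cong refl) (simp add: partial_f[OF x] D_def P_def ext_Rn[OF x] power_mult_distrib)
    thus "(norm_n n (grad f x))\<^sup>2 / f x = (\<Sum>i<n. (D i x - x i)\<^sup>2) * f x"
      by (simp add: sum_distrib_right[symmetric] power2_eq_square f_def)
  qed
  also have "\<dots> = (\<Sum>i<n. LINT x|lebesgue_n n. (D i x - x i)\<^sup>2 * exp (- V x))"
    unfolding sum_distrib_right by (rule Bochner_Integration.integral_sum) (use quad_integrable q in simp)
  finally show ?thesis .
qed

lemma barycenter_f: "i < n \<Longrightarrow> barycenter n f i = (LINT x|lebesgue_n n. x i * exp (- V x))"
  unfolding barycenter_def by (rule gauss_integral) simp_all

lemma deficit_inequality:
  assumes M: "M > 0" and mass: "L1_norm n f = 1"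
    and c: "0 < c" "c \<le> 1 / 2" "c \<le> \<epsilon> / (2 * sqrt (1 + M))" "c * (8 / \<epsilon>\<^sup>2) \<le> 1 - c"
  shows "Ent n f \<le> (1 - c) / c * deficit n f + 1 / 2 * (norm_n n (barycenter n f))\<^sup>2"
proof -
  have "normalized_potential n \<epsilon> (1 + M) (\<bar>L\<bar> + 1) V D"
    by (intro normalized_potential.intro normalized_potential_axioms.intro potential_axioms)
       (use mass in \<open>simp add: L1_norm_f\<close>)
  from improved_lsi_potential[OF this] have "improved_lsi n c V D" using M c by simp
  moreover have "(norm_n n (barycenter n f))\<^sup>2 = (\<Sum>i<n. (LINT x|lebesgue_n n. x i * exp (- V x))\<^sup>2)"
    unfolding norm_n_sq nsq_def by (simp add: barycenter_f)
  ultimately have "Ent n f \<le> (1 - c) / 2 * Fisher n f + c / 2 * (norm_n n (barycenter n f))\<^sup>2"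
    unfolding improved_lsi_def entropy_f[OF mass] Fisher_f by simp
  hence "c * Ent n f \<le> (1 - c) * deficit n f + c * (1 / 2 * (norm_n n (barycenter n f))\<^sup>2)"
    by (simp add: deficit_def field_simps)
  hence "c * Ent n f \<le> c * ((1 - c) / c * deficit n f + 1 / 2 * (norm_n n (barycenter n f))\<^sup>2)"
    using c(1) by (simp add: distrib_left)
  thus ?thesis using c(1) by (simp only: mult_le_cancel_left_pos)
qed

end

theorem corollary4p2:
  fixes \<epsilon> M :: real
  assumes "\<epsilon> > 0" and "M > 0"
  shows "\<exists>C>0. \<forall>n\<ge>1. \<forall>f\<in>family_F n \<epsilon> M. L1_norm n f = 1 \<longrightarrow>
           Ent n f \<le> C * deficit n f + 1 / 2 * (norm_n n (barycenter n f))\<^sup>2"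
proof -
  define c where "c = min (1 / 2) (min (\<epsilon> / (2 * sqrt (1 + M))) (1 / (1 + 8 / \<epsilon>\<^sup>2)))"
  have e8: "0 < 1 + 8 / \<epsilon>\<^sup>2" using assms by (intro add_pos_pos divide_pos_pos) auto
  have c: "0 < c" "c \<le> 1 / 2" "c \<le> \<epsilon> / (2 * sqrt (1 + M))"
    using assms e8 by (auto simp: c_def)
  have "c \<le> 1 / (1 + 8 / \<epsilon>\<^sup>2)" by (simp add: c_def)
  hence "c * (1 + 8 / \<epsilon>\<^sup>2) \<le> 1" using e8 by (simp only: pos_le_divide_eq)
  hence c4: "c * (8 / \<epsilon>\<^sup>2) \<le> 1 - c" by (simp add: distrib_left)
  show ?thesis
  proof (intro exI[of _ "(1 - c) / c"] conjI allI impI ballI)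
    show "0 < (1 - c) / c" using c by simp
    fix n :: nat and f assume "f \<in> family_F n \<epsilon> M" and mass: "L1_norm n f = 1"
    then obtain h where f: "f = (\<lambda>x. exp (- h x))" and h: "C11 n h" "hessian_between n (- 1 + \<epsilon>) M h"
      by (auto simp: family_F_def)
    obtain L where L: "\<And>x y. x \<in> Rn n \<Longrightarrow> y \<in> Rn n \<Longrightarrow>
        norm_n n (\<lambda>i. grad h x i - grad h y i) \<le> L * norm_n n (\<lambda>i. x i - y i)"
      using h(1) unfolding C11_def by blast
    interpret F: family_member n \<epsilon> M L h
      by standard (use assms h L in \<open>auto simp: C11_def\<close>)
    have "f = F.f" unfolding f F.f_def[abs_def] ..
    thus "Ent n f \<le> (1 - c) / c * deficit n f + 1 / 2 * (norm_n n (barycenter n f))\<^sup>2"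
      using F.deficit_inequality[OF assms(2) _ c c4] mass by simp
  qed
qed

end
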